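(* (a) Let $(W,S)$ be an extended Weyl system of domestic or wild type. Then it is isomorphic to an extended Coxeter system of star type. (b) Let $(\mathcal W,\mathcal S)$ be an extended Coxeter system of star type, where $\mathcal W=\mathcal W(\overline W,\overline S)$ and $\overline\Gamma$ is the Coxeter diagram of $(\overline W,\overline S)$. If $\overline\Gamma$ is not an affine diagram, then $(\mathcal W,\mathcal S)$ is isomorphic to an extended Weyl system of domestic or wild type. If $\overline\Gamma$ is an affine diagram, then $(\mathcal W,\mathcal S)$ is isomorphic to the hyperbolic cover of an extended Weyl system of tubular type.
   Context: Isomorphic: for groups $G,G'$ generated by $X,X'$, $(G,X)$ and $(G',X')$ are isomorphic if there is a group isomorphism $G\to G'$ mapping $X$ bijectively onto $X'$. Extended Weyl systems: given integers $r\ge0$ and $p_1,\ldots,p_r\ge1$, let $Q=\{1,1^*\}\cup\{(i,j)\mid1\le i\le r,1\le j\le p_i\}$ be the vertex set of the diagram in which single edges join $(i,j)$ with $(i,j+1)$ ($1\le j<p_i$), $1$ with $(i,1)$, and $1^*$ with $(i,1)$, and $1,1^*$ are joined by a dotted double bond. $V$ is the real vector space with basis $B=\{\alpha_\nu\mid\nu\in Q\}$ and symmetric form with $(\alpha_\nu\mid\alpha_\nu)=2=(\alpha_1\mid\alpha_{1^*})$, $-1$ for single edges, $0$ otherwise; $s_\alpha(v)=v-\frac{2(\alpha\mid v)}{(\alpha\mid\alpha)}\alpha$ for $(\alpha\mid\alpha)\neq0$; $S=\{s_\alpha\mid\alpha\in B\}$, $W=\langle S\rangle\le\mathrm{GL}(V)$.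 The type is wild, tubular or domestic if the signature (positive, negative, zero) is $(|B|-2,1,1)$, $(|B|-2,0,2)$ or $(|B|-1,0,1)$, respectively. Hyperbolic cover in tubular type: here the diagram on $Q\setminus\{1^*\}$ is affine of type $\tilde D_4,\tilde E_6,\tilde E_7$ or $\tilde E_8$. Let $a=\alpha_{1^*}-\alpha_1$, $\overline B=B\setminus\{\alpha_{1^*}\}$, $\alpha_0\in\overline B$ the simple root at the end vertex of an arm of maximal length (the affine node), $\tilde\alpha$ the highest root of the finite root system with simple system $\overline B\setminus\{\alpha_0\}$, $V_{\mathrm{fin}}=\mathrm{span}_{\mathbb R}(\overline B\setminus\{\alpha_0\})$, $b=\alpha_0+\tilde\alpha$; then $V=V_{\mathrm{fin}}\oplus\mathbb Ra\oplus\mathbb Rb$. Let $\tilde V=V\oplus\mathbb Rb'$ with $(V_{\mathrm{fin}}\mid b')=0=(a\mid b')$, $(b\mid b')=1$, $(b'\mid b')=0$. With $\tilde s_\alpha$ the reflection of $\tilde V$ in $\alpha\in B$, $\tilde S=\{\tilde s_\alpha\mid\alpha\in B\}$ and $\tilde W=\langle\tilde S\rangle\le\mathrm{GL}(\tilde V)$, the pair $(\tilde W,\tilde S)$ is the hyperbolic cover. Extended Coxeter systems of star type: a star is a tree with at most one vertex of degree larger than $2$. Let $(\overline W,\overline S)$, $\overline S=\{s_1,\ldots,s_n\}$, be a (simply laced) Coxeter system whose Coxeter diagram $\overline\Gamma$ is a star, where $1$ labels a vertex of maximal degree (any vertex if $\overline\Gamma$ is a path). Let $\overline V$ be its geometric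 representation with basis of simple roots $\alpha_1,\ldots,\alpha_n$, $\langle\alpha_i\mid\alpha_i\rangle=2$, $\langle\alpha_i\mid\alpha_j\rangle=-1$ for adjacent $i,j$, $0$ otherwise, $\overline\Phi=\overline W\{\alpha_1,\ldots,\alpha_n\}$ and $L(\overline\Phi)=\mathrm{span}_{\mathbb Z}(\overline\Phi)$. Then $\mathcal W=\mathcal W(\overline W,\overline S)=\overline W\ltimes L(\overline\Phi)$, with elements $(\overline w,\lambda)$ and multiplication $(\overline w_1,\lambda_1)(\overline w_2,\lambda_2)=(\overline w_1\overline w_2,\overline w_2^{-1}(\lambda_1)+\lambda_2)$. With $s_i=(s_i,0)$ and $s_{1^*}=(s_1,\alpha_1)$, put $\mathcal S=\overline S\cup\{s_{1^*}\}$. *)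

theory Defs
  imports
    "HOL-Algebra.Bij"
    "HOL-Algebra.Generated_Groups"
    "HOL-Algebra.Multiplicative_Group"
    "HOL-Analysis.Product_Vector"
    "HOL-Library.Function_Algebras"
begin

section \<open>Vector spaces with a finite basis and a symmetric form\<close>

instantiation "fun" :: (type, real_vector) real_vector
begin

definition scaleR_fun :: "real \<Rightarrow> ('a \<Rightarrow> 'b) \<Rightarrow> 'a \<Rightarrow> 'b"
  where "scaleR_fun c f = (\<lambda>x. c *\<^sub>R f x)"

instance
  by standard (simp_all add: scaleR_fun_def fun_eq_iff scaleR_add_right scaleR_add_left)

end

text \<open>
  The real vector space with basis \<open>(\<alpha>\<^sub>i)\<close>, \<open>i \<in> I\<close>, for a finite index set \<open>I\<close>, is the span of the
  unit vectors \<open>simple_root i\<close>, \<open>i \<in> I\<close>, in \<open>'i \<Rightarrow> real\<close>; thus \<open>v i\<close> is the coefficient of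
  \<open>\<alpha>\<^sub>i\<close> in \<open>v\<close>.
\<close>

definition simple_root :: "'i \<Rightarrow> 'i \<Rightarrow> real"
  where "simple_root i = (\<lambda>j. if j = i then 1 else 0)"

definition gram_form :: "'i set \<Rightarrow> ('i \<Rightarrow> 'i \<Rightarrow> real) \<Rightarrow> ('i \<Rightarrow> real) \<Rightarrow> ('i \<Rightarrow> real) \<Rightarrow> real"
  where "gram_form I g x y = (\<Sum>i\<in>I. \<Sum>j\<in>I. g i j * x i * y j)"

text \<open>
  The signature (positive, negative, zero), read off from an orthogonal basis; by Sylvester's law
  it does not depend on that basis.
\<close>

definition has_signature ::
    "'v::real_vector set \<Rightarrow> ('v \<Rightarrow> 'v \<Rightarrow> real) \<Rightarrow> nat \<times> nat \<times> nat \<Rightarrow> bool"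
  where "has_signature V f sg \<longleftrightarrow>
    (\<exists>E. finite E \<and> independent E \<and> span E = V \<and>
         (\<forall>x\<in>E. \<forall>y\<in>E. x \<noteq> y \<longrightarrow> f x y = 0) \<and>
         sg = (card {x\<in>E. f x x > 0}, card {x\<in>E. f x x < 0}, card {x\<in>E. f x x = 0}))"

text \<open>As in \<^const>\<open>BijGroup\<close>, linear automorphisms of \<open>V\<close> are extensional functions on \<open>V\<close>.\<close>

definition GL :: "'v::real_vector set \<Rightarrow> ('v \<Rightarrow> 'v) monoid"
  where "GL V = (BijGroup V)\<lparr>carrier :=
    {f \<in> Bij V. (\<forall>x\<in>V. \<forall>y\<in>V. f (x + y) = f x + f y) \<and> (\<forall>c. \<forall>x\<in>V. f (c *\<^sub>R x) = c *\<^sub>R f x)}\<rparr>"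

definition reflection ::
    "'v::real_vector set \<Rightarrow> ('v \<Rightarrow> 'v \<Rightarrow> real) \<Rightarrow> 'v \<Rightarrow> 'v \<Rightarrow> 'v"
  where "reflection V f \<alpha> = (\<lambda>v\<in>V. v - (2 * f \<alpha> v / f \<alpha> \<alpha>) *\<^sub>R \<alpha>)"

definition generated_subgroup :: "'g monoid \<Rightarrow> 'g set \<Rightarrow> 'g monoid"
  where "generated_subgroup G X = G\<lparr>carrier := generate G X\<rparr>"

definition isomorphic_pairs :: "'g monoid \<Rightarrow> 'g set \<Rightarrow> 'h monoid \<Rightarrow> 'h set \<Rightarrow> bool"
  where "isomorphic_pairs G X G' X' \<longleftrightarrow> (\<exists>\<phi>\<in>iso G G'. bij_betw \<phi> X X')"


section \<open>Extended Weyl systems\<close>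

text \<open>
  \<open>Center\<close> and \<open>CenterStar\<close> are the vertices \<open>1\<close> and \<open>1\<^sup>*\<close>.  The parameters \<open>r\<close> and
  \<open>p\<^sub>1, \<dots>, p\<^sub>r\<close> are given as the list \<open>p\<close> of length \<open>r\<close>.  Arms are numbered from \<open>0\<close> (so
  \<open>p ! i\<close> is the length of arm \<open>i\<close>), the vertices of an arm from \<open>1\<close>, starting next to the center.
\<close>

datatype vertex = Center | CenterStar | Arm nat nat

definition arm_lengths :: "nat list \<Rightarrow> bool"
  where "arm_lengths p \<longleftrightarrow> (\<forall>k\<in>set p. k \<ge> 1)"

definition vertices :: "nat list \<Rightarrow> vertex set"
  where "vertices p = {Center, CenterStar} \<union> {Arm i j |i j. i < length p \<and> 1 \<le> j \<and> j \<le> p ! i}"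

definition single_edge :: "vertex \<Rightarrow> vertex \<Rightarrow> bool"
  where "single_edge u v \<longleftrightarrow>
    (\<exists>i. {u, v} = {Center, Arm i 1} \<or> {u, v} = {CenterStar, Arm i 1} \<or>
         (\<exists>j. {u, v} = {Arm i j, Arm i (Suc j)}))"

definition weyl_gram :: "vertex \<Rightarrow> vertex \<Rightarrow> real"
  where "weyl_gram u v =
    (if u = v \<or> {u, v} = {Center, CenterStar} then 2 else if single_edge u v then -1 else 0)"

definition weyl_form :: "nat list \<Rightarrow> (vertex \<Rightarrow> real) \<Rightarrow> (vertex \<Rightarrow> real) \<Rightarrow> real"
  where "weyl_form p = gram_form (vertices p) weyl_gram"

definition weyl_basis :: "nat list \<Rightarrow> (vertex \<Rightarrow> real) set"
  where "weyl_basis p = simple_root ` vertices p"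

definition weyl_space :: "nat list \<Rightarrow> (vertex \<Rightarrow> real) set"
  where "weyl_space p = span (weyl_basis p)"

definition weyl_gens :: "nat list \<Rightarrow> ((vertex \<Rightarrow> real) \<Rightarrow> (vertex \<Rightarrow> real)) set"
  where "weyl_gens p = reflection (weyl_space p) (weyl_form p) ` weyl_basis p"

definition weyl_group :: "nat list \<Rightarrow> ((vertex \<Rightarrow> real) \<Rightarrow> (vertex \<Rightarrow> real)) monoid"
  where "weyl_group p = generated_subgroup (GL (weyl_space p)) (weyl_gens p)"

definition wild :: "nat list \<Rightarrow> bool"
  where "wild p \<longleftrightarrow>
    has_signature (weyl_space p) (weyl_form p) (card (weyl_basis p) - 2, 1, 1)"

definition tubular :: "nat list \<Rightarrow> bool"
  where "tubular p \<longleftrightarrow>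
    has_signature (weyl_space p) (weyl_form p) (card (weyl_basis p) - 2, 0, 2)"

definition domestic :: "nat list \<Rightarrow> bool"
  where "domestic p \<longleftrightarrow>
    has_signature (weyl_space p) (weyl_form p) (card (weyl_basis p) - 1, 0, 1)"


section \<open>The hyperbolic cover\<close>

text \<open>
  Several arms may have maximal length; the cover is defined relative to the choice \<open>k\<close> of one of
  them, whose end vertex is the affine node.
\<close>

definition maximal_arm :: "nat list \<Rightarrow> nat \<Rightarrow> bool"
  where "maximal_arm p k \<longleftrightarrow> k < length p \<and> (\<forall>i<length p. p ! i \<le> p ! k)"

definition affine_root :: "nat list \<Rightarrow> nat \<Rightarrow> vertex \<Rightarrow> real"
  where "affine_root p k = simple_root (Arm k (p ! k))"

definition fin_simple :: "nat list \<Rightarrow> nat \<Rightarrow> (vertex \<Rightarrow> real) set"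
  where "fin_simple p k = weyl_basis p - {simple_root CenterStar, affine_root p k}"

definition fin_space :: "nat list \<Rightarrow> nat \<Rightarrow> (vertex \<Rightarrow> real) set"
  where "fin_space p k = span (fin_simple p k)"

definition fin_roots :: "nat list \<Rightarrow> nat \<Rightarrow> (vertex \<Rightarrow> real) set"
  where "fin_roots p k =
    {w \<alpha> |w \<alpha>. \<alpha> \<in> fin_simple p k \<and>
       w \<in> generate (GL (fin_space p k)) (reflection (fin_space p k) (weyl_form p) ` fin_simple p k)}"

text \<open>
  The highest root is the root \<open>\<theta>\<close> such that \<open>\<theta> - \<beta>\<close> is a nonnegative combination of simple roots
  for every root \<open>\<beta>\<close>; the coefficients are the coordinates.
\<close>

definition highest_root :: "nat list \<Rightarrow> nat \<Rightarrow> vertex \<Rightarrow> real"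
  where "highest_root p k =
    (THE \<theta>. \<theta> \<in> fin_roots p k \<and> (\<forall>\<beta>\<in>fin_roots p k. \<forall>v. \<beta> v \<le> \<theta> v))"

definition vec_a :: "vertex \<Rightarrow> real"
  where "vec_a = simple_root CenterStar - simple_root Center"

definition vec_b :: "nat list \<Rightarrow> nat \<Rightarrow> vertex \<Rightarrow> real"
  where "vec_b p k = affine_root p k + highest_root p k"

text \<open>The coefficient of \<open>b\<close> with respect to \<open>V = V\<^sub>f\<^sub>i\<^sub>n \<oplus> \<real>a \<oplus> \<real>b\<close>.\<close>

definition b_coeff :: "nat list \<Rightarrow> nat \<Rightarrow> (vertex \<Rightarrow> real) \<Rightarrow> real"
  where "b_coeff p k x =
    (THE c. \<exists>u\<in>fin_space p k. \<exists>d. x = u + d *\<^sub>R vec_a + c *\<^sub>R vec_b p k)"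

text \<open>
  The space \<open>V \<oplus> \<real>b'\<close> is \<open>V \<times> \<real>\<close>, with \<open>b' = (0, 1)\<close>; the form extends that of \<open>V\<close>, with
  \<open>(b'|b') = 0\<close> and \<open>(x|b') = b_coeff x\<close> for \<open>x \<in> V\<close>.
\<close>

definition cover_space :: "nat list \<Rightarrow> ((vertex \<Rightarrow> real) \<times> real) set"
  where "cover_space p = weyl_space p \<times> UNIV"

definition cover_form ::
    "nat list \<Rightarrow> nat \<Rightarrow> (vertex \<Rightarrow> real) \<times> real \<Rightarrow> (vertex \<Rightarrow> real) \<times> real \<Rightarrow> real"
  where "cover_form p k x y =
    weyl_form p (fst x) (fst y) + snd y * b_coeff p k (fst x) + snd x * b_coeff p k (fst y)"

definition cover_gens ::
    "nat list \<Rightarrow> nat \<Rightarrow> ((vertex \<Rightarrow> real) \<times> real \<Rightarrow> (vertex \<Rightarrow> real) \<times> real) set"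
  where "cover_gens p k =
    (\<lambda>\<alpha>. reflection (cover_space p) (cover_form p k) (\<alpha>, 0)) ` weyl_basis p"

definition cover_group ::
    "nat list \<Rightarrow> nat \<Rightarrow> ((vertex \<Rightarrow> real) \<times> real \<Rightarrow> (vertex \<Rightarrow> real) \<times> real) monoid"
  where "cover_group p k = generated_subgroup (GL (cover_space p)) (cover_gens p k)"


section \<open>Diagrams\<close>

text \<open>A (simply laced) diagram is a vertex set \<open>A\<close> with a symmetric irreflexive adjacency \<open>E\<close>.\<close>

definition degree_in :: "'a set \<Rightarrow> ('a \<Rightarrow> 'a \<Rightarrow> bool) \<Rightarrow> 'a \<Rightarrow> nat"
  where "degree_in A E v = card {w\<in>A. E v w}"

definition is_cycle :: "'a set \<Rightarrow> ('a \<Rightarrow> 'a \<Rightarrow> bool) \<Rightarrow> 'a list \<Rightarrow> bool"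
  where "is_cycle A E xs \<longleftrightarrow> length xs \<ge> 3 \<and> distinct xs \<and> set xs \<subseteq> A \<and>
    (\<forall>i<length xs. E (xs ! i) (xs ! (Suc i mod length xs)))"

definition is_tree :: "'a set \<Rightarrow> ('a \<Rightarrow> 'a \<Rightarrow> bool) \<Rightarrow> bool"
  where "is_tree A E \<longleftrightarrow> finite A \<and> A \<noteq> {} \<and>
    (\<forall>u\<in>A. \<forall>v\<in>A. (u, v) \<in> {(x, y). x \<in> A \<and> y \<in> A \<and> E x y}\<^sup>*) \<and> (\<nexists>xs. is_cycle A E xs)"

definition is_star :: "'a set \<Rightarrow> ('a \<Rightarrow> 'a \<Rightarrow> bool) \<Rightarrow> bool"
  where "is_star A E \<longleftrightarrow> is_tree A E \<and> card {v\<in>A. degree_in A E v > 2} \<le> 1"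

definition is_path :: "'a set \<Rightarrow> ('a \<Rightarrow> 'a \<Rightarrow> bool) \<Rightarrow> bool"
  where "is_path A E \<longleftrightarrow> is_tree A E \<and> (\<forall>v\<in>A. degree_in A E v \<le> 2)"

definition isomorphic_diagrams ::
    "'a set \<Rightarrow> ('a \<Rightarrow> 'a \<Rightarrow> bool) \<Rightarrow> 'b set \<Rightarrow> ('b \<Rightarrow> 'b \<Rightarrow> bool) \<Rightarrow> bool"
  where "isomorphic_diagrams A E A' E' \<longleftrightarrow>
    (\<exists>f. bij_betw f A A' \<and> (\<forall>x\<in>A. \<forall>y\<in>A. E x y \<longleftrightarrow> E' (f x) (f y)))"

text \<open>The cycle \<open>0 - 1 - \<dots> - n - 0\<close>, for \<open>n \<ge> 2\<close>.\<close>

definition affine_A_edge :: "nat \<Rightarrow> nat \<Rightarrow> nat \<Rightarrow> bool"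
  where "affine_A_edge n x y \<longleftrightarrow> (\<exists>i<n. {x, y} = {i, Suc i}) \<or> {x, y} = {0, n}"

text \<open>
  The path \<open>1 - 2 - \<dots> - (n - 1)\<close> with one further vertex attached at each of \<open>2\<close> and \<open>n - 2\<close>,
  for \<open>n \<ge> 4\<close>.
\<close>

definition affine_D_edge :: "nat \<Rightarrow> nat \<Rightarrow> nat \<Rightarrow> bool"
  where "affine_D_edge n x y \<longleftrightarrow>
    (\<exists>i. 1 \<le> i \<and> i < n - 1 \<and> {x, y} = {i, Suc i}) \<or> {x, y} = {0, 2} \<or> {x, y} = {n - 2, n}"

text \<open>
  The simply laced affine diagrams: types A (\<open>n \<ge> 2\<close>) and D (\<open>n \<ge> 4\<close>), and types E6, E7, E8,
  which are the stars with three arms of the lengths listed.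
\<close>

definition affine_diagram :: "'a set \<Rightarrow> ('a \<Rightarrow> 'a \<Rightarrow> bool) \<Rightarrow> bool"
  where "affine_diagram A E \<longleftrightarrow>
    (\<exists>n\<ge>2. isomorphic_diagrams A E {0..n} (affine_A_edge n)) \<or>
    (\<exists>n\<ge>4. isomorphic_diagrams A E {0..n} (affine_D_edge n)) \<or>
    (\<exists>p\<in>{[2,2,2], [1,3,3], [1,2,5]}.
       isomorphic_diagrams A E (vertices p - {CenterStar}) single_edge)"


section \<open>Coxeter systems and extended Coxeter systems of star type\<close>

text \<open>
  Equality of words in the monoid presented by \<open>S\<close> and the relations \<open>(st)\<^bsup>m(s,t)\<^esup> = 1\<close>, where
  \<open>m(s,t)\<close> is the order of \<open>st\<close> in \<open>W\<close>.  If it is infinite, then \<^const>\<open>group.ord\<close> is \<open>0\<close> and the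
  relation is void.  If all \<open>s \<in> S\<close> are involutions, the case \<open>s = t\<close> gives the relation \<open>s\<^sup>2 = 1\<close>,
  so the presented monoid is the presented group.
\<close>

inductive word_eq :: "'g monoid \<Rightarrow> 'g set \<Rightarrow> 'g list \<Rightarrow> 'g list \<Rightarrow> bool"
  for W :: "'g monoid" and S :: "'g set"
  where
    rel: "\<lbrakk>u \<in> lists S; v \<in> lists S; s \<in> S; t \<in> S\<rbrakk> \<Longrightarrow>
      word_eq W S (u @ concat (replicate (group.ord W (s \<otimes>\<^bsub>W\<^esub> t)) [s, t]) @ v) (u @ v)"
  | refl: "u \<in> lists S \<Longrightarrow> word_eq W S u u"
  | sym: "word_eq W S u v \<Longrightarrow> word_eq W S v u"
  | trans: "\<lbrakk>word_eq W S u v; word_eq W S v w\<rbrakk> \<Longrightarrow> word_eq W S u w"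

definition word_value :: "'g monoid \<Rightarrow> 'g list \<Rightarrow> 'g"
  where "word_value W u = foldr (\<lambda>x y. x \<otimes>\<^bsub>W\<^esub> y) u \<one>\<^bsub>W\<^esub>"

definition coxeter_system :: "'g monoid \<Rightarrow> 'g set \<Rightarrow> bool"
  where "coxeter_system W S \<longleftrightarrow>
    group W \<and> finite S \<and> S \<subseteq> carrier W \<and> generate W S = carrier W \<and>
    (\<forall>s\<in>S. group.ord W s = 2) \<and>
    (\<forall>u\<in>lists S. word_value W u = \<one>\<^bsub>W\<^esub> \<longrightarrow> word_eq W S u [])"

definition simply_laced :: "'g monoid \<Rightarrow> 'g set \<Rightarrow> bool"
  where "simply_laced W S \<longleftrightarrow>
    (\<forall>s\<in>S. \<forall>t\<in>S. s \<noteq> t \<longrightarrow> group.ord W (s \<otimes>\<^bsub>W\<^esub> t) \<in> {2, 3})"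

definition coxeter_edge :: "'g monoid \<Rightarrow> 'g \<Rightarrow> 'g \<Rightarrow> bool"
  where "coxeter_edge W s t \<longleftrightarrow> s \<noteq> t \<and> group.ord W (s \<otimes>\<^bsub>W\<^esub> t) \<noteq> 2"

text \<open>\<open>c\<close> is the generator labelled \<open>1\<close>.\<close>

definition star_coxeter_system :: "'g monoid \<Rightarrow> 'g set \<Rightarrow> 'g \<Rightarrow> bool"
  where "star_coxeter_system W S c \<longleftrightarrow>
    coxeter_system W S \<and> simply_laced W S \<and> is_star S (coxeter_edge W) \<and> c \<in> S \<and>
    (is_path S (coxeter_edge W) \<or>
     (\<forall>s\<in>S. degree_in S (coxeter_edge W) s \<le> degree_in S (coxeter_edge W) c))"

definition cox_gram :: "'g monoid \<Rightarrow> 'g \<Rightarrow> 'g \<Rightarrow> real"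
  where "cox_gram W s t = (if s = t then 2 else if coxeter_edge W s t then -1 else 0)"

definition cox_form :: "'g monoid \<Rightarrow> 'g set \<Rightarrow> ('g \<Rightarrow> real) \<Rightarrow> ('g \<Rightarrow> real) \<Rightarrow> real"
  where "cox_form W S = gram_form S (cox_gram W)"

definition cox_space :: "'g set \<Rightarrow> ('g \<Rightarrow> real) set"
  where "cox_space S = span (simple_root ` S)"

text \<open>For a Coxeter system, the choice is unique on \<^term>\<open>carrier W\<close>, since \<open>S\<close> generates \<open>W\<close>.\<close>

definition geometric_rep :: "'g monoid \<Rightarrow> 'g set \<Rightarrow> 'g \<Rightarrow> ('g \<Rightarrow> real) \<Rightarrow> ('g \<Rightarrow> real)"
  where "geometric_rep W S =
    (SOME \<sigma>. \<sigma> \<in> hom W (GL (cox_space S)) \<and>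
       (\<forall>s\<in>S. \<sigma> s = reflection (cox_space S) (cox_form W S) (simple_root s)))"

definition cox_roots :: "'g monoid \<Rightarrow> 'g set \<Rightarrow> ('g \<Rightarrow> real) set"
  where "cox_roots W S = {geometric_rep W S w (simple_root s) |w s. w \<in> carrier W \<and> s \<in> S}"

definition int_span :: "'v::real_vector set \<Rightarrow> 'v set"
  where "int_span A = {\<Sum>x\<in>F. of_int (c x) *\<^sub>R x |F (c :: 'v \<Rightarrow> int). finite F \<and> F \<subseteq> A}"

definition root_lattice :: "'g monoid \<Rightarrow> 'g set \<Rightarrow> ('g \<Rightarrow> real) set"
  where "root_lattice W S = int_span (cox_roots W S)"

definition ext_cox_group :: "'g monoid \<Rightarrow> 'g set \<Rightarrow> ('g \<times> ('g \<Rightarrow> real)) monoid"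
  where "ext_cox_group W S =
    \<lparr>carrier = carrier W \<times> root_lattice W S,
     mult = (\<lambda>(w1, l1) (w2, l2). (w1 \<otimes>\<^bsub>W\<^esub> w2, geometric_rep W S (inv\<^bsub>W\<^esub> w2) l1 + l2)),
     one = (\<one>\<^bsub>W\<^esub>, 0)\<rparr>"

definition ext_cox_gens :: "'g set \<Rightarrow> 'g \<Rightarrow> ('g \<times> ('g \<Rightarrow> real)) set"
  where "ext_cox_gens S c = (\<lambda>s. (s, 0)) ` S \<union> {(c, simple_root c)}"

end

theory Submission
  imports Defs "HOL-Combinatorics.Permutations"
begin

text \<open>
  All three kinds of groups are instances of one construction.  Let \<open>X\<close> carry a symmetric form,
  let \<open>\<beta>\<^sub>s\<close>, \<open>s \<in> S\<close>, have the Gram matrix of the star, and let \<open>a \<noteq> 0\<close> lie in the radical.  If the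
  functionals \<open>(\<beta>\<^sub>s|-)\<close> are linearly independent, then the reflections in the \<open>\<beta>\<^sub>s\<close> and in
  \<open>\<beta>\<^sub>1 + a\<close> generate a copy of \<open>W \<ltimes> L(\<Phi>)\<close>: an element \<open>\<lambda>\<close> of the root lattice acts as
  \<open>v \<mapsto> v - (\<lambda>|v) a\<close>, and \<open>W\<close> acts faithfully by Tits' theorem.  With \<open>a = \<alpha>\<^sub>1\<^sub>* - \<alpha>\<^sub>1\<close>, the independence
  holds on \<open>V\<close> when the radical of the form is spanned by \<open>a\<close>, which is the domestic and the wild
  case, and on the hyperbolic cover in the tubular case, where \<open>b'\<close> separates the remaining null
  vector \<open>b\<close>.

  Up to the positive definite arms, the form of a star is determined by the norm
  \<open>2 - \<Sum>\<^sub>i p\<^sub>i / (p\<^sub>i + 1)\<close> of the projection of \<open>\<alpha>\<^sub>1\<close> orthogonal to the arms.  It vanishes only for the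
  four affine stars, whose diagrams are recognised by a null vector of the Cartan matrix.
\<close>

section \<open>Coordinates and Gram forms\<close>

text \<open>Tits' argument is used in two directions. For a given Coxeter system it shows that
  \<open>W\<close> acts faithfully; for the reflections in the star vertices it shows that the
  expected relations already present the group they generate, which is how part (a) obtains its
  Coxeter system. It is therefore carried out on words modulo \<open>word_eq\<close>, without word
  values in a group. In the isomorphism, the reflections in \<beta>_1 and \<beta>_1 + a yield only
  the translation by \<alpha>_1; conjugation along the edges of the connected star spreads it over
  all simple roots. The signature in \<open>domestic\<close> and \<open>wild\<close> comes with an
  unknown orthogonal basis. Sylvester's law is bypassed: the radical lies in the span of the null
  vectors of that basis, and there is only one. The highest root is defined inside an orbit, with no
  table of root systems at hand. It is identified through integral vectors of norm 2: the
  nonnegative ones in the finite part are roots by descent on the height, and all roots lie below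
  the null root because the lattice is even and semidefinite.\<close>

lemma sum_fun_apply: "(\<Sum>i\<in>A. f i) x = (\<Sum>i\<in>A. f i x)"
  by (induction A rule: infinite_finite_induct) auto

lemma scaleR_fun_apply [simp]: "(c *\<^sub>R f) x = c *\<^sub>R f x"
  by (simp add: scaleR_fun_def)

lemma simple_root_apply: "simple_root i j = (if j = i then 1 else 0)"
  by (simp add: simple_root_def)

lemma simple_root_self [simp]: "simple_root i i = 1"
  by (simp add: simple_root_def)

lemma simple_root_neq [simp]: "i \<noteq> j \<Longrightarrow> simple_root i j = 0"
  by (simp add: simple_root_def)

lemma simple_root_eq_iff [simp]: "simple_root i = simple_root j \<longleftrightarrow> i = j"
  by (metis simple_root_self simple_root_neq zero_neq_one)

lemma inj_simple_root: "inj_on simple_root I"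
  by (simp add: inj_on_def)

lemma expand_simple_roots:
  assumes "finite I" "\<And>j. j \<notin> I \<Longrightarrow> x j = 0"
  shows "x = (\<Sum>i\<in>I. x i *\<^sub>R simple_root i)"
proof
  fix j
  have "(\<Sum>i\<in>I. x i *\<^sub>R simple_root i) j = (\<Sum>i\<in>I. if j = i then x i else 0)"
    unfolding sum_fun_apply by (intro sum.cong) (auto simp: simple_root_def)
  then show "x j = (\<Sum>i\<in>I. x i *\<^sub>R simple_root i) j"
    using assms by simp
qed

lemma span_simple_roots:
  assumes "finite I"
  shows "span (simple_root ` I) = {x. \<forall>j. j \<notin> I \<longrightarrow> x j = 0}"
proof
  show "span (simple_root ` I) \<subseteq> {x. \<forall>j. j \<notin> I \<longrightarrow> x j = 0}"
    by (rule span_minimal) (auto simp: subspace_def simple_root_def)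
  have "x \<in> span (simple_root ` I)" if "\<forall>j. j \<notin> I \<longrightarrow> x j = 0" for x
  proof -
    have "(\<Sum>i\<in>I. x i *\<^sub>R simple_root i) \<in> span (simple_root ` I)"
      by (intro span_sum span_scale span_base) auto
    then show ?thesis using expand_simple_roots[OF assms, of x] that by simp
  qed
  then show "{x. \<forall>j. j \<notin> I \<longrightarrow> x j = 0} \<subseteq> span (simple_root ` I)" by blast
qed

lemma independent_simple_roots:
  assumes "finite I"
  shows "independent (simple_root ` I)"
proof (rule independent_if_scalars_zero)
  fix c v assume *: "(\<Sum>x\<in>simple_root ` I. c x *\<^sub>R x) = 0" and v: "v \<in> simple_root ` I"
  from v obtain i where i: "i \<in> I" "v = simple_root i" by auto
  have "(\<Sum>x\<in>simple_root ` I. c x *\<^sub>R x) i = (\<Sum>j\<in>I. c (simple_root j) * simple_root j i)"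
    by (simp add: sum.reindex inj_simple_root sum_fun_apply)
  also have "\<dots> = c v"
    by (subst sum.remove[OF assms i(1)]) (use i in \<open>auto intro!: sum.neutral\<close>)
  finally show "c v = 0" using * by simp
qed (use assms in auto)

lemma gram_form_add_right: "gram_form I g x (y + z) = gram_form I g x y + gram_form I g x z"
  by (simp add: gram_form_def distrib_left sum.distrib)

lemma gram_form_scale_right: "gram_form I g x (c *\<^sub>R z) = c * gram_form I g x z"
  by (simp add: gram_form_def sum_distrib_left mult_ac)

lemma gram_form_commute:
  assumes "\<And>i j. i \<in> I \<Longrightarrow> j \<in> I \<Longrightarrow> g i j = g j i"
  shows "gram_form I g x y = gram_form I g y x"
  unfolding gram_form_def by (subst sum.swap) (simp add: assms mult_ac cong: sum.cong)

lemma gram_form_simple_root_left: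
  assumes "finite I" "i \<in> I"
  shows "gram_form I g (simple_root i) y = (\<Sum>j\<in>I. g i j * y j)"
proof -
  have "gram_form I g (simple_root i) y = (\<Sum>k\<in>I. if k = i then \<Sum>j\<in>I. g i j * y j else 0)"
    unfolding gram_form_def by (intro sum.cong) (auto simp: simple_root_def)
  then show ?thesis using assms by simp
qed

lemma gram_form_simple_root:
  assumes "finite I" "i \<in> I" "j \<in> I"
  shows "gram_form I g (simple_root i) (simple_root j) = g i j"
proof -
  have "(\<Sum>k\<in>I. g i k * simple_root j k) = (\<Sum>k\<in>I. if k = j then g i j else 0)"
    by (intro sum.cong) (auto simp: simple_root_def)
  then show ?thesis using assms by (simp add: gram_form_simple_root_left)
qed

section \<open>Linear groups and reflections\<close>

lemma GL_mult:
  assumes "g \<in> carrier (GL X)" "h \<in> carrier (GL X)"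
  shows "g \<otimes>\<^bsub>GL X\<^esub> h = compose X g h"
  using assms by (simp add: GL_def BijGroup_def)

lemma GL_one: "\<one>\<^bsub>GL X\<^esub> = (\<lambda>x\<in>X. x)"
  by (simp add: GL_def BijGroup_def)

lemma GL_closed: "g \<in> carrier (GL X) \<Longrightarrow> x \<in> X \<Longrightarrow> g x \<in> X"
  by (auto simp: GL_def Bij_def bij_betw_def)

lemma GL_add: "g \<in> carrier (GL X) \<Longrightarrow> x \<in> X \<Longrightarrow> y \<in> X \<Longrightarrow> g (x + y) = g x + g y"
  by (simp add: GL_def)

lemma GL_scale: "g \<in> carrier (GL X) \<Longrightarrow> x \<in> X \<Longrightarrow> g (c *\<^sub>R x) = c *\<^sub>R g x"
  by (simp add: GL_def)

lemma GL_ext: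
  assumes "g \<in> carrier (GL X)" "h \<in> carrier (GL X)" "\<And>x. x \<in> X \<Longrightarrow> g x = h x"
  shows "g = h"
  using assms by (auto simp: GL_def Bij_def intro: extensionalityI)

lemma group_GL:
  assumes "subspace X"
  shows "group (GL X)"
proof -
  interpret B: group "BijGroup X" by (rule group_BijGroup)
  let ?H = "{f \<in> Bij X. (\<forall>x\<in>X. \<forall>y\<in>X. f (x + y) = f x + f y) \<and> (\<forall>c. \<forall>x\<in>X. f (c *\<^sub>R x) = c *\<^sub>R f x)}"
  have "subgroup ?H (BijGroup X)"
  proof (rule B.subgroupI)
    show "?H \<subseteq> carrier (BijGroup X)" by (auto simp: BijGroup_def)
    have "(\<lambda>x\<in>X. x) \<in> ?H"
      using assms by (simp add: id_Bij subspace_add subspace_scale)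
    then show "?H \<noteq> {}" by blast
    fix g assume g: "g \<in> ?H"
    then have bij: "bij_betw g X X" by (simp add: Bij_def)
    have mem: "inv_into X g x \<in> X" if "x \<in> X" for x
      using bij that by (metis bij_betw_imp_surj_on inv_into_into)
    have inv: "g (inv_into X g x) = x" if "x \<in> X" for x
      using bij that by (metis bij_betw_inv_into_right)
    have eq: "inv_into X g y = x" if "x \<in> X" "g x = y" for x y
      using bij that by (metis bij_betw_inv_into_left)
    have "inv_into X g (x + y) = inv_into X g x + inv_into X g y" if "x \<in> X" "y \<in> X" for x y
      by (rule eq) (use that g mem inv assms in \<open>simp_all add: subspace_add\<close>)
    moreover have "inv_into X g (c *\<^sub>R x) = c *\<^sub>R inv_into X g x" if "x \<in> X" for x c
      by (rule eq) (use that g mem inv assms in \<open>simp_all add: subspace_scale\<close>)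
    ultimately show "inv\<^bsub>BijGroup X\<^esub> g \<in> ?H"
      using g assms by (simp add: inv_BijGroup restrict_inv_into_Bij subspace_add subspace_scale)
    fix h assume h: "h \<in> ?H"
    then have "h x \<in> X" if "x \<in> X" for x using that by (auto simp: Bij_def bij_betw_def)
    with g h assms show "g \<otimes>\<^bsub>BijGroup X\<^esub> h \<in> ?H"
      by (simp add: BijGroup_def compose_Bij) (simp add: compose_def subspace_add subspace_scale)
  qed
  then show ?thesis
    unfolding GL_def by (rule B.subgroup_imp_group)
qed

lemma carrier_GLI:
  assumes "g \<in> extensional X" "\<And>x. x \<in> X \<Longrightarrow> g x \<in> X" "\<And>x. x \<in> X \<Longrightarrow> h x \<in> X"
    "\<And>x. x \<in> X \<Longrightarrow> h (g x) = x" "\<And>x. x \<in> X \<Longrightarrow> g (h x) = x"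
    "\<And>x y. x \<in> X \<Longrightarrow> y \<in> X \<Longrightarrow> g (x + y) = g x + g y"
    "\<And>c x. x \<in> X \<Longrightarrow> g (c *\<^sub>R x) = c *\<^sub>R g x"
  shows "g \<in> carrier (GL X)"
proof -
  have "bij_betw g X X" by (rule bij_betw_byWitness[where f' = h]) (use assms in auto)
  then show ?thesis using assms by (simp add: GL_def Bij_def)
qed

text \<open>All axioms are relative to the carrier: \<open>b_coeff\<close>, and with it
  \<open>cover_form\<close>, is given by a description that is meaningful only on
  \<open>weyl_space\<close>.\<close>

locale form_space =
  fixes X :: "'v::real_vector set" and f :: "'v \<Rightarrow> 'v \<Rightarrow> real"
  assumes subspace: "subspace X"
    and form_add_right: "\<And>x y z. \<lbrakk>x \<in> X; y \<in> X; z \<in> X\<rbrakk> \<Longrightarrow> f x (y + z) = f x y + f x z"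
    and form_scale_right: "\<And>c x y. \<lbrakk>x \<in> X; y \<in> X\<rbrakk> \<Longrightarrow> f x (c *\<^sub>R y) = c * f x y"
    and form_commute: "\<And>x y. \<lbrakk>x \<in> X; y \<in> X\<rbrakk> \<Longrightarrow> f x y = f y x"
begin

sublocale GL: group "GL X"
  using subspace by (rule group_GL)

lemmas closed = subspace_add[OF subspace] subspace_scale[OF subspace] subspace_diff[OF subspace]
  subspace_neg[OF subspace] subspace_0[OF subspace]

lemma form_add_left: "\<lbrakk>x \<in> X; y \<in> X; z \<in> X\<rbrakk> \<Longrightarrow> f (x + y) z = f x z + f y z"
  using form_commute[of "x + y" z] form_commute[of x z] form_commute[of y z]
  by (simp add: closed form_add_right)

lemma form_scale_left: "\<lbrakk>x \<in> X; y \<in> X\<rbrakk> \<Longrightarrow> f (c *\<^sub>R x) y = c * f x y"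
  using form_commute[of "c *\<^sub>R x" y] form_commute[of x y]
  by (simp add: closed form_scale_right)

lemma form_zero_right [simp]: "x \<in> X \<Longrightarrow> f x 0 = 0"
  using form_scale_right[of x 0 0] closed by simp

lemma form_zero_left [simp]: "x \<in> X \<Longrightarrow> f 0 x = 0"
  using form_scale_left[of 0 x 0] closed by simp

lemma form_minus_right: "\<lbrakk>x \<in> X; y \<in> X\<rbrakk> \<Longrightarrow> f x (- y) = - f x y"
  using form_scale_right[of x y "-1"] by simp

lemma form_minus_left: "\<lbrakk>x \<in> X; y \<in> X\<rbrakk> \<Longrightarrow> f (- x) y = - f x y"
  using form_scale_left[of x y "-1"] by simp

lemma form_diff_right: "\<lbrakk>x \<in> X; y \<in> X; z \<in> X\<rbrakk> \<Longrightarrow> f x (y - z) = f x y - f x z"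
  using form_add_right[of x y "- z"] by (simp add: form_minus_right closed)

lemma form_diff_left: "\<lbrakk>x \<in> X; y \<in> X; z \<in> X\<rbrakk> \<Longrightarrow> f (x - y) z = f x z - f y z"
  using form_add_left[of x "- y" z] by (simp add: form_minus_left closed)

lemmas form_simps = form_add_right form_add_left form_scale_right form_scale_left
  form_minus_right form_minus_left form_diff_right form_diff_left

lemma form_sum_right:
  "\<lbrakk>x \<in> X; \<And>i. i \<in> I \<Longrightarrow> y i \<in> X\<rbrakk> \<Longrightarrow> f x (\<Sum>i\<in>I. y i) = (\<Sum>i\<in>I. f x (y i))"
  by (induction I rule: infinite_finite_induct)
     (simp_all add: form_add_right subspace_sum[OF subspace])

lemma form_sum_left:
  "\<lbrakk>x \<in> X; \<And>i. i \<in> I \<Longrightarrow> y i \<in> X\<rbrakk> \<Longrightarrow> f (\<Sum>i\<in>I. y i) x = (\<Sum>i\<in>I. f (y i) x)"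
  by (induction I rule: infinite_finite_induct)
     (simp_all add: form_add_left subspace_sum[OF subspace])

lemma reflection_apply:
  "f \<alpha> \<alpha> = 2 \<Longrightarrow> v \<in> X \<Longrightarrow> reflection X f \<alpha> v = v - f \<alpha> v *\<^sub>R \<alpha>"
  by (simp add: reflection_def)

lemma reflection_in_GL:
  assumes "\<alpha> \<in> X" "f \<alpha> \<alpha> = 2"
  shows "reflection X f \<alpha> \<in> carrier (GL X)"
proof (rule carrier_GLI[where h = "reflection X f \<alpha>"])
  show "reflection X f \<alpha> \<in> extensional X" by (simp add: reflection_def)
qed (use assms in \<open>simp_all add: reflection_apply closed form_simps algebra_simps\<close>)

lemma reflection_involution:
  assumes "\<alpha> \<in> X" "f \<alpha> \<alpha> = 2"
  shows "reflection X f \<alpha> \<otimes>\<^bsub>GL X\<^esub> reflection X f \<alpha> = \<one>\<^bsub>GL X\<^esub>"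
  using assms reflection_in_GL[OF assms]
  by (auto simp: GL_mult GL_one compose_def reflection_apply closed form_simps algebra_simps fun_eq_iff)

lemma reflection_isometry:
  assumes "\<alpha> \<in> X" "f \<alpha> \<alpha> = 2" "x \<in> X" "y \<in> X"
  shows "f (reflection X f \<alpha> x) (reflection X f \<alpha> y) = f x y"
  using assms form_commute[of x \<alpha>] by (simp add: reflection_apply closed form_simps algebra_simps)

lemma reflections_pow_2:
  assumes "\<alpha> \<in> X" "f \<alpha> \<alpha> = 2" "\<beta> \<in> X" "f \<beta> \<beta> = 2" "f \<alpha> \<beta> = 0"
  shows "(reflection X f \<alpha> \<otimes>\<^bsub>GL X\<^esub> reflection X f \<beta>) [^]\<^bsub>GL X\<^esub> (2::nat) = \<one>\<^bsub>GL X\<^esub>"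
proof -
  let ?g = "reflection X f \<alpha> \<otimes>\<^bsub>GL X\<^esub> reflection X f \<beta>"
  have r: "reflection X f \<alpha> \<in> carrier (GL X)" "reflection X f \<beta> \<in> carrier (GL X)"
    using assms by (auto intro: reflection_in_GL)
  have g: "?g \<in> carrier (GL X)" using r by (rule GL.m_closed)
  have "f \<beta> \<alpha> = 0" using assms by (simp add: form_commute)
  then have gv: "?g v = v - f \<beta> v *\<^sub>R \<beta> - f \<alpha> v *\<^sub>R \<alpha>" if "v \<in> X" for v
    using r assms that by (simp add: GL_mult compose_def reflection_apply closed form_simps)
  have "?g \<otimes>\<^bsub>GL X\<^esub> ?g = \<one>\<^bsub>GL X\<^esub>"
  proof (rule GL_ext)
    fix v assume v: "v \<in> X"
    show "(?g \<otimes>\<^bsub>GL X\<^esub> ?g) v = \<one>\<^bsub>GL X\<^esub> v"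
      using v assms \<open>f \<beta> \<alpha> = 0\<close>
      by (simp add: GL_mult[OF g g] compose_def gv closed GL_one)
         (simp add: form_simps closed)
  qed (use g in auto)
  with g show ?thesis by (simp add: numeral_2_eq_2)
qed

text \<open>On the plane of the two roots the product is a rotation by a third of a turn. Its
  square, computed in \<open>g2v\<close>, is the product in the opposite order, so one further
  factor gives the identity.\<close>

lemma reflections_pow_3:
  assumes "\<alpha> \<in> X" "f \<alpha> \<alpha> = 2" "\<beta> \<in> X" "f \<beta> \<beta> = 2" "f \<alpha> \<beta> = -1"
  shows "(reflection X f \<alpha> \<otimes>\<^bsub>GL X\<^esub> reflection X f \<beta>) [^]\<^bsub>GL X\<^esub> (3::nat) = \<one>\<^bsub>GL X\<^esub>"
proof -
  let ?g = "reflection X f \<alpha> \<otimes>\<^bsub>GL X\<^esub> reflection X f \<beta>"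
  have r: "reflection X f \<alpha> \<in> carrier (GL X)" "reflection X f \<beta> \<in> carrier (GL X)"
    using assms by (auto intro: reflection_in_GL)
  have g: "?g \<in> carrier (GL X)" using r by (rule GL.m_closed)
  have g2: "?g \<otimes>\<^bsub>GL X\<^esub> ?g \<in> carrier (GL X)" using g g by (rule GL.m_closed)
  have ba: "f \<beta> \<alpha> = -1" using assms by (simp add: form_commute)
  then have gv: "?g v = v - f \<beta> v *\<^sub>R \<beta> - (f \<alpha> v + f \<beta> v) *\<^sub>R \<alpha>" if "v \<in> X" for v
    using r assms that by (simp add: GL_mult compose_def reflection_apply closed form_simps)
  have g2v: "(?g \<otimes>\<^bsub>GL X\<^esub> ?g) v = v - (f \<alpha> v + f \<beta> v) *\<^sub>R \<beta> - f \<alpha> v *\<^sub>R \<alpha>" if "v \<in> X" for v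
    using that assms ba
    by (simp add: GL_mult[OF g g] compose_def gv closed)
       (simp add: form_simps closed algebra_simps)
  have "?g \<otimes>\<^bsub>GL X\<^esub> ?g \<otimes>\<^bsub>GL X\<^esub> ?g = \<one>\<^bsub>GL X\<^esub>"
  proof (rule GL_ext)
    fix v assume v: "v \<in> X"
    show "(?g \<otimes>\<^bsub>GL X\<^esub> ?g \<otimes>\<^bsub>GL X\<^esub> ?g) v = \<one>\<^bsub>GL X\<^esub> v"
      using v assms ba
      by (simp add: GL_mult[OF g2 g] compose_def g2v gv closed GL_one)
         (simp add: form_simps closed algebra_simps)
  qed (use g g2 in auto)
  with g show ?thesis by (simp add: numeral_3_eq_3)
qed

text \<open>Evaluating both reflections at \<alpha> and pairing the results with \<alpha> gives -2 =
  2 - (\<alpha>|\<beta>)^2, which fails for the values 0 and -1.\<close>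

lemma reflection_neq:
  assumes "\<alpha> \<in> X" "f \<alpha> \<alpha> = 2" "\<beta> \<in> X" "f \<beta> \<beta> = 2" "f \<alpha> \<beta> \<in> {0, -1}"
  shows "reflection X f \<alpha> \<noteq> reflection X f \<beta>"
proof
  assume "reflection X f \<alpha> = reflection X f \<beta>"
  then have "reflection X f \<alpha> \<alpha> = reflection X f \<beta> \<alpha>" by simp
  then have "f \<alpha> (- \<alpha>) = f \<alpha> (\<alpha> - f \<beta> \<alpha> *\<^sub>R \<beta>)"
    using assms by (simp add: reflection_apply scaleR_2)
  moreover have "f \<beta> \<alpha> = f \<alpha> \<beta>" using assms by (simp add: form_commute)
  ultimately have "f \<alpha> (- \<alpha>) = f \<alpha> (\<alpha> - f \<alpha> \<beta> *\<^sub>R \<beta>)" by simp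
  then have "- 2 = 2 - f \<alpha> \<beta> * f \<alpha> \<beta>" using assms by (simp add: form_simps closed)
  then show False using assms(5) by auto
qed

end

section \<open>Words in Coxeter systems\<close>

lemma word_value_Nil [simp]: "word_value W [] = \<one>\<^bsub>W\<^esub>"
  and word_value_Cons [simp]: "word_value W (x # u) = x \<otimes>\<^bsub>W\<^esub> word_value W u"
  by (simp_all add: word_value_def)

text \<open>The locale \<^locale>\<open>group\<close> admits record extensions, for which \<^const>\<open>word_value\<close> is not defined.\<close>

locale plain_group = group G for G :: "'g monoid" (structure)
begin

lemma word_value_closed [simp]: "set u \<subseteq> carrier G \<Longrightarrow> word_value G u \<in> carrier G"
  by (induction u) auto

lemma word_value_append:
  "\<lbrakk>set u \<subseteq> carrier G; set v \<subseteq> carrier G\<rbrakk> \<Longrightarrow> word_value G (u @ v) = word_value G u \<otimes> word_value G v"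
  by (induction u) (auto simp: m_assoc)

lemma word_value_replicate:
  assumes "s \<in> carrier G" "t \<in> carrier G"
  shows "word_value G (concat (replicate n [s, t])) = (s \<otimes> t) [^] n"
proof (induction n)
  case (Suc n)
  have "set (concat (replicate n [s, t])) \<subseteq> carrier G" using assms by auto
  then have "word_value G (concat (replicate (Suc n) [s, t])) = s \<otimes> t \<otimes> word_value G (concat (replicate n [s, t]))"
    using assms by (simp add: m_assoc)
  then show ?case unfolding Suc using assms by (simp only: nat_pow_Suc2 m_closed)
qed simp

lemma word_value_rev:
  assumes "set u \<subseteq> carrier G" "\<And>s. s \<in> set u \<Longrightarrow> s \<otimes> s = \<one>"
  shows "word_value G (rev u) = inv (word_value G u)"
  using assms
proof (induction u)
  case (Cons s u)
  then have "inv s = s" by (intro inv_equality) auto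
  with Cons show ?case by (simp add: word_value_append inv_mult_group)
qed simp

text \<open>Generators are their own inverses, so words without formal inverses reach the whole
  generated subgroup.\<close>

lemma word_value_surj:
  assumes "S \<subseteq> carrier G" "\<And>s. s \<in> S \<Longrightarrow> s \<otimes> s = \<one>" "w \<in> generate G S"
  shows "\<exists>u\<in>lists S. word_value G u = w"
  using assms(3)
proof induction
  case (incl h)
  then show ?case using assms by (intro bexI[of _ "[h]"]) auto
next
  case (inv h)
  moreover from inv have "inv h = h" using assms by (intro inv_equality) auto
  ultimately show ?case using assms by (intro bexI[of _ "[h]"]) auto
next
  case (eng g h)
  then obtain u v where "u \<in> lists S" "word_value G u = g" "v \<in> lists S" "word_value G v = h" by blast
  moreover from this have "set u \<subseteq> carrier G" "set v \<subseteq> carrier G" using assms(1) by auto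
  ultimately show ?case by (intro bexI[of _ "u @ v"]) (auto simp: word_value_append)
qed (auto intro: bexI[of _ "[]"])

end

lemma concat_replicate_lists: "s \<in> S \<Longrightarrow> t \<in> S \<Longrightarrow> concat (replicate n [s, t]) \<in> lists S"
  by (induction n) auto

lemma word_eq_lists: "word_eq W S u v \<Longrightarrow> u \<in> lists S \<and> v \<in> lists S"
  by (induction rule: word_eq.induct) (simp_all add: concat_replicate_lists del: in_lists_conv_set)

text \<open>Soundness of the presentation. With \<open>h\<close> the identity it says that equal
  words have equal values in \<open>W\<close>; with other targets it is the consistency needed to
  extend \<open>h\<close> to a homomorphism.\<close>

lemma word_eq_value:
  assumes "group H" "\<And>s. s \<in> S \<Longrightarrow> h s \<in> carrier H"
    "\<And>s t. s \<in> S \<Longrightarrow> t \<in> S \<Longrightarrow> (h s \<otimes>\<^bsub>H\<^esub> h t) [^]\<^bsub>H\<^esub> group.ord W (s \<otimes>\<^bsub>W\<^esub> t) = \<one>\<^bsub>H\<^esub>"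
    and "word_eq W S u v"
  shows "word_value H (map h u) = word_value H (map h v)"
  using assms(4)
proof induction
  case (rel u v s t)
  interpret H: plain_group H using \<open>group H\<close> by (rule plain_group.intro)
  have *: "map h (concat (replicate n [s, t])) = concat (replicate n [h s, h t])" for n
    by (induction n) auto
  have "set (map h u) \<subseteq> carrier H" "set (map h v) \<subseteq> carrier H"
    "set (concat (replicate n [h s, h t])) \<subseteq> carrier H" for n
    using rel assms(2) by auto
  then show ?case
    using rel assms(2,3) by (simp add: * H.word_value_append H.word_value_replicate del: set_concat)
qed auto

locale coxeter = plain_group W for W :: "'g monoid" (structure) +
  fixes S :: "'g set"
  assumes coxeter: "coxeter_system W S"
begin

lemma gens_closed: "S \<subseteq> carrier W"
  and gens_finite: "finite S"
  and gens_generate: "generate W S = carrier W"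
  and gens_ord: "s \<in> S \<Longrightarrow> ord s = 2"
  and gens_word_eq: "u \<in> lists S \<Longrightarrow> word_value W u = \<one> \<Longrightarrow> word_eq W S u []"
  using coxeter by (auto simp: coxeter_system_def)

lemma gen_square: assumes "s \<in> S" shows "s \<otimes> s = \<one>"
  using gens_ord[OF assms] pow_ord_eq_1[of s] assms gens_closed by (auto simp: numeral_2_eq_2)

lemma gen_inv: assumes "s \<in> S" shows "inv s = s"
  using assms gens_closed by (intro inv_equality) (auto simp: gen_square)

lemma obtain_word:
  assumes "w \<in> carrier W"
  obtains u where "u \<in> lists S" "word_value W u = w"
  using word_value_surj[of S w] assms gens_closed gen_square gens_generate by blast

lemma generators_induct [consumes 1, case_names one gen]:
  assumes "w \<in> carrier W" "P \<one>" "\<And>s w. s \<in> S \<Longrightarrow> w \<in> carrier W \<Longrightarrow> P w \<Longrightarrow> P (s \<otimes> w)"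
  shows "P w"
proof -
  from assms(1) obtain u where "u \<in> lists S" "word_value W u = w" by (rule obtain_word)
  moreover have "u \<in> lists S \<Longrightarrow> P (word_value W u)"
  proof (induction u)
    case (Cons s u)
    moreover from Cons have "set u \<subseteq> carrier W" using gens_closed by auto
    ultimately show ?case using assms(3) by auto
  qed (simp add: assms)
  ultimately show ?thesis by blast
qed

text \<open>Von Dyck's theorem. An element is sent to the value of any word for it;
  \<open>coxeter_system\<close> speaks only about words for the identity, so independence of the
  word is reduced to that case.\<close>

lemma extend_hom:
  fixes H :: "'h monoid"
  assumes H: "group H" and h: "\<And>s. s \<in> S \<Longrightarrow> h s \<in> carrier H"
    and rel: "\<And>s t. s \<in> S \<Longrightarrow> t \<in> S \<Longrightarrow> (h s \<otimes>\<^bsub>H\<^esub> h t) [^]\<^bsub>H\<^esub> ord (s \<otimes> t) = \<one>\<^bsub>H\<^esub>"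
  obtains \<sigma> where "\<sigma> \<in> hom W H" "\<And>s. s \<in> S \<Longrightarrow> \<sigma> s = h s"
proof -
  interpret H: plain_group H using \<open>group H\<close> by (rule plain_group.intro)
  \<comment> \<open>The relation for s = t has exponent \<open>ord\<close> \<one> = 1, so it says
    exactly that \<open>h s\<close> is an involution.\<close>
  have hsq: "h s \<otimes>\<^bsub>H\<^esub> h s = \<one>\<^bsub>H\<^esub>" if "s \<in> S" for s
    using rel[of s s] that h by (simp add: gen_square ord_id[simplified])
  define val where "val u = word_value H (map h u)" for u
  have sub: "set u \<subseteq> carrier W" "set (map h u) \<subseteq> carrier H" if "u \<in> lists S" for u
    using that gens_closed h by auto
  have val_closed: "val u \<in> carrier H" if "u \<in> lists S" for u
    using sub[OF that] by (simp add: val_def)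
  have val_append: "val (u @ v) = val u \<otimes>\<^bsub>H\<^esub> val v" if "u \<in> lists S" "v \<in> lists S" for u v
    using sub[OF that(1)] sub[OF that(2)] by (simp add: val_def H.word_value_append)
  have eq: "val u = val v" if u: "u \<in> lists S" and v: "v \<in> lists S"
    and uv: "word_value W u = word_value W v" for u v
  proof -
    \<comment> \<open>Reversing a word inverts its value, because all letters are
      involutions.\<close>
    have "word_value W (u @ rev v) = \<one>"
      using sub[OF u] sub[OF v] v uv gen_square
      by (subst word_value_append) (auto simp: word_value_rev in_lists_conv_set)
    then have "word_eq W S (u @ rev v) []" using u v by (intro gens_word_eq) auto
    then have "val (u @ rev v) = \<one>\<^bsub>H\<^esub>"
      unfolding val_def using word_eq_value[OF H h rel] by fastforce
    moreover have "val (rev v) = inv\<^bsub>H\<^esub> val v"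
      unfolding val_def rev_map[symmetric]
      using sub[OF v] v hsq by (subst H.word_value_rev[symmetric]) (auto simp: rev_map in_lists_conv_set)
    ultimately have "val u \<otimes>\<^bsub>H\<^esub> inv\<^bsub>H\<^esub> val v = \<one>\<^bsub>H\<^esub>"
      using val_append[of u "rev v"] u v by (simp add: in_lists_conv_set)
    then show ?thesis
      by (metis H.inv_closed H.inv_equality H.inv_inv u v val_closed)
  qed
  define \<sigma> where "\<sigma> w = val (SOME u. u \<in> lists S \<and> word_value W u = w)" for w
  have \<sigma>: "\<sigma> (word_value W u) = val u" if "u \<in> lists S" for u
  proof -
    let ?v = "SOME v. v \<in> lists S \<and> word_value W v = word_value W u"
    have "?v \<in> lists S \<and> word_value W ?v = word_value W u"
      by (rule someI[where x = u]) (use that in auto)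
    then show ?thesis unfolding \<sigma>_def using that by (intro eq) auto
  qed
  show thesis
  proof
    show "\<sigma> \<in> hom W H"
    proof (rule homI)
      fix x assume "x \<in> carrier W"
      then obtain u where u: "u \<in> lists S" "word_value W u = x" by (rule obtain_word)
      then show "\<sigma> x \<in> carrier H" using \<sigma>[OF u(1)] val_closed[OF u(1)] by simp
      fix y assume "y \<in> carrier W"
      then obtain v where v: "v \<in> lists S" "word_value W v = y" by (rule obtain_word)
      have "u @ v \<in> lists S" using u v by simp
      then have "\<sigma> (word_value W (u @ v)) = \<sigma> x \<otimes>\<^bsub>H\<^esub> \<sigma> y"
        using \<sigma>[OF u(1)] \<sigma>[OF v(1)] \<sigma>[of "u @ v"] val_append[OF u(1) v(1)] u v by simp
      then show "\<sigma> (x \<otimes> y) = \<sigma> x \<otimes>\<^bsub>H\<^esub> \<sigma> y"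
        using sub(1)[OF u(1)] sub(1)[OF v(1)] u v by (simp add: word_value_append)
    qed
    show "\<sigma> s = h s" if "s \<in> S" for s
      using \<sigma>[of "[s]"] that gens_closed h by (auto simp: val_def)
  qed
qed

end

section \<open>Faithfulness of the geometric representation\<close>

lemma word_eq_context:
  assumes "word_eq W S u v" "x \<in> lists S" "y \<in> lists S"
  shows "word_eq W S (x @ u @ y) (x @ v @ y)"
  using assms
proof (induction rule: word_eq.induct)
  case (rel u v s t)
  then show ?case
    using word_eq.rel[of "x @ u" S "v @ y" s t W] by simp
next
  case (refl u)
  then show ?case using word_eq.refl[of "x @ u @ y"] by simp
qed (blast intro: word_eq.sym word_eq.trans)+

text \<open>
  \<open>C\<close> plays the role of the cone of nonnegative combinations of the simple roots \<open>\<beta> s\<close>; then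
  \<open>act_pos\<close> is Tits' lemma that \<open>w\<close> maps \<open>\<beta> s\<close> into this cone unless \<open>w s\<close> is shorter than \<open>w\<close>.
\<close>

locale simply_laced_action =
  fixes W :: "'g monoid" (structure) and S :: "'g set" and X C :: "'v::ab_group_add set"
    and r :: "'g \<Rightarrow> 'v \<Rightarrow> 'v" and \<beta> :: "'g \<Rightarrow> 'v"
  assumes ord_same: "s \<in> S \<Longrightarrow> group.ord W (s \<otimes> s) = 1"
    and ord_cases: "\<lbrakk>s \<in> S; t \<in> S; s \<noteq> t\<rbrakk> \<Longrightarrow>
      group.ord W (s \<otimes> t) = 2 \<and> r s (\<beta> t) = \<beta> t \<or>
      group.ord W (s \<otimes> t) = 3 \<and> r s (\<beta> t) = \<beta> s + \<beta> t \<and> r t (\<beta> s) = \<beta> s + \<beta> t"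
    and r_self: "s \<in> S \<Longrightarrow> r s (\<beta> s) = - \<beta> s"
    and X_add: "x \<in> X \<Longrightarrow> y \<in> X \<Longrightarrow> x + y \<in> X"
    and X_minus: "x \<in> X \<Longrightarrow> - x \<in> X"
    and \<beta>_in: "s \<in> S \<Longrightarrow> \<beta> s \<in> X"
    and r_closed: "s \<in> S \<Longrightarrow> x \<in> X \<Longrightarrow> r s x \<in> X"
    and r_add: "\<lbrakk>s \<in> S; x \<in> X; y \<in> X\<rbrakk> \<Longrightarrow> r s (x + y) = r s x + r s y"
    and act_eq: "word_eq W S u v \<Longrightarrow> x \<in> X \<Longrightarrow> foldr r u x = foldr r v x"
    and C_add: "x \<in> C \<Longrightarrow> y \<in> C \<Longrightarrow> x + y \<in> C"
    and \<beta>_pos: "s \<in> S \<Longrightarrow> \<beta> s \<in> C"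
    and \<beta>_not_neg: "s \<in> S \<Longrightarrow> - \<beta> s \<notin> C"
begin

lemma cancel_square:
  assumes "s \<in> S" "u \<in> lists S" "v \<in> lists S"
  shows "word_eq W S (u @ [s, s] @ v) (u @ v)"
  using word_eq.rel[of u S v s s W] assms ord_same by simp

text \<open>The relator followed by the inverse word \<open>[t, s]\<close> is read in two ways:
  delete the relator, or cancel squares from the middle outwards. The braid relation below is
  obtained in the same way.\<close>

lemma swap_letters:
  assumes "s \<in> S" "t \<in> S" "group.ord W (s \<otimes> t) = 2"
  shows "word_eq W S [s, t] [t, s]"
proof -
  have "word_eq W S [s, t, s, t, t, s] [t, s]"
    using word_eq.rel[of "[]" S "[t, s]" s t W] assms by (simp add: numeral_2_eq_2)
  moreover have "word_eq W S [s, t, s, t, t, s] [s, t, s, s]"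
    using cancel_square[of t "[s, t, s]" "[s]"] assms by simp
  moreover have "word_eq W S [s, t, s, s] [s, t]"
    using cancel_square[of s "[s, t]" "[]"] assms by simp
  ultimately show ?thesis by (meson word_eq.sym word_eq.trans)
qed

lemma braid_letters:
  assumes "s \<in> S" "t \<in> S" "group.ord W (s \<otimes> t) = 3"
  shows "word_eq W S [s, t, s] [t, s, t]"
proof -
  have "word_eq W S [s, t, s, t, s, t, t, s, t] [t, s, t]"
    using word_eq.rel[of "[]" S "[t, s, t]" s t W] assms by (simp add: numeral_3_eq_3)
  moreover have "word_eq W S [s, t, s, t, s, t, t, s, t] [s, t, s, t, s, s, t]"
    using cancel_square[of t "[s, t, s, t, s]" "[s, t]"] assms by simp
  moreover have "word_eq W S [s, t, s, t, s, s, t] [s, t, s, t, t]"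
    using cancel_square[of s "[s, t, s, t]" "[t]"] assms by simp
  moreover have "word_eq W S [s, t, s, t, t] [s, t, s]"
    using cancel_square[of t "[s, t, s]" "[]"] assms by simp
  ultimately show ?thesis by (meson word_eq.sym word_eq.trans)
qed

text \<open>The Coxeter length of the element presented by \<open>u\<close>. It is taken over
  equivalent words because the locale provides no values of words.\<close>

definition len :: "'g list \<Rightarrow> nat"
  where "len u = (LEAST n. \<exists>v. word_eq W S u v \<and> length v = n)"

lemma len_le: "word_eq W S u v \<Longrightarrow> len u \<le> length v"
  unfolding len_def by (rule Least_le) blast

lemma len_cong: "word_eq W S u v \<Longrightarrow> len u = len v"
proof -
  assume uv: "word_eq W S u v"
  have "word_eq W S u w \<longleftrightarrow> word_eq W S v w" for w
    using word_eq.trans[OF uv] word_eq.trans[OF word_eq.sym[OF uv]] by blast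
  then show ?thesis by (simp add: len_def)
qed

lemma reduced_word:
  assumes "u \<in> lists S"
  obtains v where "v \<in> lists S" "word_eq W S u v" "length v = len u"
proof -
  have "word_eq W S u u" using assms by (rule word_eq.refl)
  then have "\<exists>n v. word_eq W S u v \<and> length v = n" by auto
  then have "\<exists>v. word_eq W S u v \<and> length v = len u"
    unfolding len_def by (rule LeastI_ex)
  then obtain v where "word_eq W S u v" "length v = len u" by auto
  then show thesis using that[of v] word_eq_lists[of W S u v] by simp
qed

lemma word_eq_append_right:
  "\<lbrakk>word_eq W S u v; y \<in> lists S\<rbrakk> \<Longrightarrow> word_eq W S (u @ y) (v @ y)"
  using word_eq_context[of W S u v "[]" y] by simp

lemma word_eq_append_left:
  "\<lbrakk>word_eq W S u v; x \<in> lists S\<rbrakk> \<Longrightarrow> word_eq W S (x @ u) (x @ v)"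
  using word_eq_context[of W S u v x "[]"] by simp

lemma len_append_le:
  assumes "u \<in> lists S" "v \<in> lists S"
  shows "len (u @ v) \<le> len u + length v"
proof -
  obtain u' where "word_eq W S u u'" "length u' = len u" by (rule reduced_word[OF assms(1)])
  then show ?thesis
    using len_le[OF word_eq_append_right[of u u' v]] assms by simp
qed

lemma act_closed: "u \<in> lists S \<Longrightarrow> x \<in> X \<Longrightarrow> foldr r u x \<in> X"
  by (induction u) (auto simp: r_closed)

lemma act_add: "\<lbrakk>u \<in> lists S; x \<in> X; y \<in> X\<rbrakk> \<Longrightarrow> foldr r u (x + y) = foldr r u x + foldr r u y"
  by (induction u) (auto simp: r_add act_closed)

text \<open>Induction on the length, with u = x t reduced. If s and t commute, u maps \<beta>_s to x
  \<beta>_s. Otherwise it maps \<beta>_s to x \<beta>_s + x \<beta>_t, where x \<beta>_t is positive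
  by induction. If x \<beta>_s is not covered by induction, then x = y s with y shorter, and the sum
  collapses to y \<beta>_t. In each case a failure of the length condition for x or y would produce,
  by a commutation or a braid, a word for u s that is too short.\<close>

lemma act_pos:
  assumes "u \<in> lists S" "s \<in> S" "len u \<le> len (u @ [s])"
  shows "foldr r u (\<beta> s) \<in> C"
  using assms
proof (induction "len u" arbitrary: u s rule: less_induct)
  case (less u s)
  obtain v where v: "v \<in> lists S" "word_eq W S u v" "length v = len u"
    by (rule reduced_word[OF less.prems(1)])
  show ?case
  proof (cases v rule: rev_cases)
    case Nil
    then show ?thesis using v act_eq[OF v(2)] less.prems \<beta>_in \<beta>_pos by simp
  next
    case (snoc x t)
    then have x: "x \<in> lists S" and t: "t \<in> S" using v by auto
    have ux: "word_eq W S u (x @ [t])" using v snoc by simp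
    have len_u: "len u = length x + 1" using v snoc by simp
    have len_x: "len x = length x"
      using len_le[OF word_eq.refl[OF x]] len_append_le[OF x, of "[t]"] len_cong[OF ux] t len_u by simp
    have us: "word_eq W S (u @ [s]) (x @ [t, s])"
      using word_eq_append_right[OF ux, of "[s]"] less.prems by simp
    \<comment> \<open>The length hypothesis in the form used below: no word for u s has fewer than
      \<open>len u\<close> letters.\<close>
    have bound: "len u \<le> length y" if "word_eq W S (x @ [t, s]) y" for y
      using len_le[OF word_eq.trans[OF us that]] less.prems by simp
    have "s \<noteq> t"
      using bound[of x] cancel_square[OF t x, of "[]"] len_u by auto
    have act_u: "foldr r u (\<beta> s) = foldr r x (r t (\<beta> s))"
      using act_eq[OF ux, of "\<beta> s"] less.prems \<beta>_in by simp
    have red: "\<exists>y\<in>lists S. word_eq W S (z @ [q]) y \<and> length y < len z"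
      if "z \<in> lists S" "q \<in> S" "\<not> len z \<le> len (z @ [q])" for z q
    proof -
      have "z @ [q] \<in> lists S" using that by simp
      then obtain y where "y \<in> lists S" "word_eq W S (z @ [q]) y" "length y = len (z @ [q])"
        by (rule reduced_word)
      then show ?thesis using that(3) by (intro bexI[of _ y]) auto
    qed
    consider (two) "group.ord W (t \<otimes> s) = 2" "r t (\<beta> s) = \<beta> s"
      | (three) "group.ord W (t \<otimes> s) = 3" "r t (\<beta> s) = \<beta> s + \<beta> t" "r s (\<beta> t) = \<beta> s + \<beta> t"
      using ord_cases[OF t less.prems(2)] \<open>s \<noteq> t\<close> by (auto simp: add.commute)
    then show ?thesis
    proof cases
      case two
      have "len x \<le> len (x @ [s])"
      proof (rule ccontr)
        assume "\<not> ?thesis"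
        then obtain y where y: "y \<in> lists S" "word_eq W S (x @ [s]) y" "length y < len x"
          using red[OF x less.prems(2)] by blast
        have "word_eq W S (x @ [s, t]) (y @ [t])"
          using word_eq_append_right[OF y(2), of "[t]"] t by simp
        with word_eq_append_left[OF swap_letters[OF t less.prems(2) two(1)] x]
        have "word_eq W S (x @ [t, s]) (y @ [t])" by (rule word_eq.trans)
        from bound[OF this] y len_x len_u show False by simp
      qed
      then show ?thesis using less.hyps[of x s] x less.prems len_x len_u act_u two by simp
    next
      case three
      have "len x \<le> len (x @ [t])" using len_cong[OF ux] len_u len_x by simp
      then have xt: "foldr r x (\<beta> t) \<in> C" using less.hyps[of x t] x t len_x len_u by simp
      show ?thesis
      proof (cases "len x \<le> len (x @ [s])")
        case True
        then have "foldr r x (\<beta> s) \<in> C" using less.hyps[of x s] x less.prems len_x len_u by simp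
        then show ?thesis using xt act_u three x t less.prems by (simp add: act_add \<beta>_in C_add)
      next
        case False
        then obtain y where y: "y \<in> lists S" "word_eq W S (x @ [s]) y" "length y < len x"
          using red[OF x less.prems(2)] by blast
        have "word_eq W S (x @ [s, s]) x" using cancel_square[OF less.prems(2) x, of "[]"] by simp
        moreover have "word_eq W S (x @ [s, s]) (y @ [s])"
          using word_eq_append_right[OF y(2), of "[s]"] less.prems by simp
        ultimately have xy: "word_eq W S x (y @ [s])" by (rule word_eq.trans[OF word_eq.sym])
        have "len y \<le> len (y @ [t])"
        proof (rule ccontr)
          assume "\<not> ?thesis"
          then obtain z where z: "z \<in> lists S" "word_eq W S (y @ [t]) z" "length z < len y"
            using red[OF y(1) t] by blast
          have "word_eq W S (x @ [t, s]) (y @ [s, t, s])"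
            using word_eq_append_right[OF xy, of "[t, s]"] t less.prems by simp
          moreover have "word_eq W S (y @ [s, t, s]) (y @ [t, s, t])"
            using word_eq.sym[OF word_eq_append_left[OF braid_letters[OF t less.prems(2) three(1)] y(1)]] .
          moreover have "word_eq W S (y @ [t, s, t]) (z @ [s, t])"
            using word_eq_append_right[OF z(2), of "[s, t]"] t less.prems by simp
          ultimately have "word_eq W S (x @ [t, s]) (z @ [s, t])" by (meson word_eq.trans)
          from bound[OF this] z y len_x len_u len_le[OF word_eq.refl[OF y(1)]] show False by simp
        qed
        then have "foldr r y (\<beta> t) \<in> C"
          using less.hyps[of y t] y t len_x len_u len_le[OF word_eq.refl[OF y(1)]] by simp
        moreover have "foldr r x (\<beta> s + \<beta> t) = foldr r y (\<beta> t)"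
          using act_eq[OF xy, of "\<beta> s + \<beta> t"] less.prems t three r_self
          by (simp add: \<beta>_in X_add r_add)
        ultimately show ?thesis using act_u three by simp
      qed
    qed
  qed
qed

text \<open>If a reduced word x t fixed \<beta>_t, then x would send \<beta>_t to -\<beta>_t; but x
  \<beta>_t lies in the cone by \<open>act_pos\<close>, and -\<beta>_t does not.\<close>

theorem faithful:
  assumes "u \<in> lists S" "\<And>s. s \<in> S \<Longrightarrow> foldr r u (\<beta> s) = \<beta> s"
  shows "word_eq W S u []"
proof -
  obtain v where v: "v \<in> lists S" "word_eq W S u v" "length v = len u"
    by (rule reduced_word[OF assms(1)])
  show ?thesis
  proof (cases v rule: rev_cases)
    case Nil
    with v show ?thesis by simp
  next
    case (snoc x t)
    then have x: "x \<in> lists S" and t: "t \<in> S" using v by auto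
    have "len x \<le> len (x @ [t])"
      using len_cong[OF v(2)] len_le[OF word_eq.refl[OF x]] v snoc by simp
    then have "foldr r x (\<beta> t) \<in> C" using x t by (intro act_pos)
    moreover have neg: "foldr r z (- \<beta> t) = - foldr r z (\<beta> t)" if "z \<in> lists S" for z
      using act_add[OF that, of "- \<beta> t" "\<beta> t"] act_add[OF that, of 0 0]
        X_add[of "\<beta> t" "- \<beta> t"] X_minus \<beta>_in t
      by (simp add: eq_neg_iff_add_eq_0)
    have "\<beta> t = foldr r x (- \<beta> t)"
      using assms(2)[OF t] act_eq[OF v(2), of "\<beta> t"] snoc t \<beta>_in r_self by simp
    with neg[OF x] have "foldr r x (\<beta> t) = - \<beta> t" by (metis minus_minus)
    ultimately show ?thesis using \<beta>_not_neg[OF t] by simp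
  qed
qed

end

section \<open>Integral spans\<close>

lemma int_span_zero [simp]: "0 \<in> int_span A"
  unfolding int_span_def by (intro CollectI exI[of _ "{}"]) simp

lemma int_span_base: "x \<in> A \<Longrightarrow> x \<in> int_span A"
  unfolding int_span_def by (intro CollectI exI[of _ "{x}"] exI[of _ "\<lambda>_. 1"]) simp

lemma int_span_add:
  assumes "x \<in> int_span A" "y \<in> int_span A"
  shows "x + y \<in> int_span A"
proof -
  from assms obtain F G and c d :: "_ \<Rightarrow> int"
    where F: "finite F" "F \<subseteq> A" "x = (\<Sum>v\<in>F. of_int (c v) *\<^sub>R v)"
      and G: "finite G" "G \<subseteq> A" "y = (\<Sum>v\<in>G. of_int (d v) *\<^sub>R v)"
    by (auto simp: int_span_def)
  define e where "e v = (if v \<in> F then c v else 0) + (if v \<in> G then d v else 0)" for v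
  have "x = (\<Sum>v\<in>F \<union> G. of_int (if v \<in> F then c v else 0) *\<^sub>R v)"
    unfolding F(3) using F G by (intro sum.mono_neutral_cong_left) auto
  moreover have "y = (\<Sum>v\<in>F \<union> G. of_int (if v \<in> G then d v else 0) *\<^sub>R v)"
    unfolding G(3) using F G by (intro sum.mono_neutral_cong_left) auto
  ultimately have "x + y = (\<Sum>v\<in>F \<union> G. of_int (e v) *\<^sub>R v)"
    by (simp add: e_def scaleR_add_left sum.distrib)
  then show ?thesis
    unfolding int_span_def using F G by (intro CollectI exI[of _ "F \<union> G"] exI[of _ e]) auto
qed

lemma int_span_minus:
  assumes "x \<in> int_span A"
  shows "- x \<in> int_span A"
proof -
  from assms obtain F and c :: "_ \<Rightarrow> int"
    where F: "finite F" "F \<subseteq> A" "x = (\<Sum>v\<in>F. of_int (c v) *\<^sub>R v)"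
    by (auto simp: int_span_def)
  then have "- x = (\<Sum>v\<in>F. of_int (- c v) *\<^sub>R v)" by (simp add: sum_negf)
  then show ?thesis
    unfolding int_span_def using F(1,2) by (intro CollectI exI[of _ F] exI[of _ "\<lambda>v. - c v"]) auto
qed

text \<open>Integer multiples are recovered by repeated addition and negation, so additive closure
  replaces an argument about coefficients.\<close>

lemma int_span_induct [consumes 1, case_names zero base add minus]:
  assumes "x \<in> int_span A" "P 0" "\<And>x. x \<in> A \<Longrightarrow> P x"
    and add: "\<And>x y. \<lbrakk>x \<in> int_span A; y \<in> int_span A; P x; P y\<rbrakk> \<Longrightarrow> P (x + y)"
    and minus: "\<And>x. x \<in> int_span A \<Longrightarrow> P x \<Longrightarrow> P (- x)"
  shows "P x"
proof -
  let ?Q = "\<lambda>x. x \<in> int_span A \<and> P x"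
  have Q_add: "?Q (x + y)" if "?Q x" "?Q y" for x y
    using that add int_span_add by blast
  have nat: "?Q (of_nat n *\<^sub>R x)" if "?Q x" for n x
  proof (induction n)
    case (Suc n)
    from Q_add[OF that Suc] show ?case by (simp add: scaleR_add_left)
  qed (use assms in simp)
  have int: "?Q (of_int k *\<^sub>R x)" if "x \<in> A" for k x
  proof (cases k rule: int_cases2)
    case (nonneg n)
    then show ?thesis using nat[of x n] that assms(3) int_span_base by auto
  next
    case (nonpos n)
    then show ?thesis
      using nat[of x n] that assms(3) int_span_base minus[of "of_nat n *\<^sub>R x"] int_span_minus[of "of_nat n *\<^sub>R x" A]
      by auto
  qed
  from assms(1) obtain F and c :: "_ \<Rightarrow> int"
    where F: "finite F" "F \<subseteq> A" "x = (\<Sum>v\<in>F. of_int (c v) *\<^sub>R v)"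
    by (auto simp: int_span_def)
  have "?Q (\<Sum>v\<in>F. of_int (c v) *\<^sub>R v)"
    using F(1,2)
  proof (induction F rule: finite_induct)
    case (insert v F)
    then have "?Q (of_int (c v) *\<^sub>R v)" "?Q (\<Sum>v\<in>F. of_int (c v) *\<^sub>R v)" using int by auto
    from Q_add[OF this] insert show ?case by simp
  qed (use assms in simp)
  then show ?thesis using F by simp
qed

section \<open>Simply laced Coxeter systems\<close>

locale simply_laced_coxeter = coxeter W S for W :: "'g monoid" (structure) and S +
  assumes simply_laced: "simply_laced W S"
begin

lemma ord_pair: "\<lbrakk>s \<in> S; t \<in> S; s \<noteq> t\<rbrakk> \<Longrightarrow> ord (s \<otimes> t) = 2 \<or> ord (s \<otimes> t) = 3"
  using simply_laced by (auto simp: simply_laced_def)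

lemma ord_commute:
  assumes "s \<in> S" "t \<in> S"
  shows "ord (s \<otimes> t) = ord (t \<otimes> s)"
proof -
  have "inv (s \<otimes> t) = t \<otimes> s"
    using assms gens_closed by (simp add: subset_iff inv_mult_group gen_inv)
  then show ?thesis using ord_inv[of "s \<otimes> t"] assms gens_closed by (simp add: subset_iff)
qed

lemma cox_gram_commute: "\<lbrakk>s \<in> S; t \<in> S\<rbrakk> \<Longrightarrow> cox_gram W s t = cox_gram W t s"
  by (auto simp: cox_gram_def coxeter_edge_def ord_commute)

lemma cox_gram_same [simp]: "cox_gram W s s = 2"
  by (simp add: cox_gram_def)

lemma cox_space_eq: "cox_space S = {x. \<forall>s. s \<notin> S \<longrightarrow> x s = 0}"
  unfolding cox_space_def by (rule span_simple_roots[OF gens_finite])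

lemma simple_root_in: "s \<in> S \<Longrightarrow> simple_root s \<in> cox_space S"
  unfolding cox_space_def by (intro span_base) simp

lemma cox_form_simple_roots:
  "\<lbrakk>s \<in> S; t \<in> S\<rbrakk> \<Longrightarrow> cox_form W S (simple_root s) (simple_root t) = cox_gram W s t"
  unfolding cox_form_def by (rule gram_form_simple_root[OF gens_finite])

sublocale cox: form_space "cox_space S" "cox_form W S"
proof
  show "Real_Vector_Spaces.subspace (cox_space S)"
    unfolding cox_space_def by (rule subspace_span)
qed (auto simp: cox_form_def gram_form_add_right gram_form_scale_right
      intro!: gram_form_commute cox_gram_commute)

text \<open>The relations between reflections depend only on the Gram matrix of their roots. Hence
  the geometric representation and the action on every model space come from the same
  argument.\<close>

lemma reflection_hom:
  fixes X :: "'v::real_vector set"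
  assumes "form_space X f" and \<beta>: "\<And>s. s \<in> S \<Longrightarrow> \<beta> s \<in> X"
    and gram: "\<And>s t. s \<in> S \<Longrightarrow> t \<in> S \<Longrightarrow> f (\<beta> s) (\<beta> t) = cox_gram W s t"
  obtains R where "R \<in> hom W (GL X)" "\<And>s. s \<in> S \<Longrightarrow> R s = reflection X f (\<beta> s)"
proof -
  interpret form_space X f by fact
  show thesis
  proof (rule extend_hom[OF GL.is_group, of "\<lambda>s. reflection X f (\<beta> s)"])
    fix s t assume st: "s \<in> S" "t \<in> S"
    show "reflection X f (\<beta> s) \<in> carrier (GL X)"
      using st \<beta> gram by (intro reflection_in_GL) auto
    have norm: "f (\<beta> s) (\<beta> s) = 2" "f (\<beta> t) (\<beta> t) = 2" using st gram by auto
    consider "s = t" | "s \<noteq> t" "ord (s \<otimes> t) = 2" | "s \<noteq> t" "ord (s \<otimes> t) = 3"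
      using ord_pair st by blast
    then show "(reflection X f (\<beta> s) \<otimes>\<^bsub>GL X\<^esub> reflection X f (\<beta> t)) [^]\<^bsub>GL X\<^esub> ord (s \<otimes> t) = \<one>\<^bsub>GL X\<^esub>"
    proof cases
      case 1
      then show ?thesis using st \<beta> norm by (simp add: gen_square reflection_involution)
    next
      case 2
      then show ?thesis using st \<beta> norm gram[of s t] reflections_pow_2[of "\<beta> s" "\<beta> t"]
        by (simp add: cox_gram_def coxeter_edge_def)
    next
      case 3
      then show ?thesis using st \<beta> norm gram[of s t] reflections_pow_3[of "\<beta> s" "\<beta> t"]
        by (simp add: cox_gram_def coxeter_edge_def)
    qed
  qed (use that in blast)
qed

abbreviation \<sigma> :: "'g \<Rightarrow> ('g \<Rightarrow> real) \<Rightarrow> 'g \<Rightarrow> real"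
  where "\<sigma> \<equiv> geometric_rep W S"

lemma geometric_rep:
  shows \<sigma>_hom: "\<sigma> \<in> hom W (GL (cox_space S))"
    and \<sigma>_gen: "s \<in> S \<Longrightarrow> \<sigma> s = reflection (cox_space S) (cox_form W S) (simple_root s)"
proof -
  obtain R where "R \<in> hom W (GL (cox_space S))"
    "\<And>s. s \<in> S \<Longrightarrow> R s = reflection (cox_space S) (cox_form W S) (simple_root s)"
    using reflection_hom[of "cox_space S" "cox_form W S" simple_root, OF cox.form_space_axioms simple_root_in cox_form_simple_roots] by blast
  then have "\<exists>R. R \<in> hom W (GL (cox_space S)) \<and>
      (\<forall>s\<in>S. R s = reflection (cox_space S) (cox_form W S) (simple_root s))" by blast
  from someI_ex[OF this] show "\<sigma> \<in> hom W (GL (cox_space S))"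
    "s \<in> S \<Longrightarrow> \<sigma> s = reflection (cox_space S) (cox_form W S) (simple_root s)"
    unfolding geometric_rep_def by auto
qed

lemma \<sigma>_carrier: "w \<in> carrier W \<Longrightarrow> \<sigma> w \<in> carrier (GL (cox_space S))"
  using \<sigma>_hom by (rule hom_in_carrier)

lemma \<sigma>_closed: "w \<in> carrier W \<Longrightarrow> x \<in> cox_space S \<Longrightarrow> \<sigma> w x \<in> cox_space S"
  by (rule GL_closed[OF \<sigma>_carrier])

lemma \<sigma>_mult:
  "\<lbrakk>w \<in> carrier W; w' \<in> carrier W; x \<in> cox_space S\<rbrakk> \<Longrightarrow> \<sigma> (w \<otimes> w') x = \<sigma> w (\<sigma> w' x)"
  by (simp add: hom_mult[OF \<sigma>_hom] GL_mult \<sigma>_carrier compose_eq)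

lemma \<sigma>_one: "x \<in> cox_space S \<Longrightarrow> \<sigma> \<one> x = x"
  using hom_one[OF \<sigma>_hom is_group cox.GL.is_group] by (simp add: GL_one)

lemma \<sigma>_add: "\<lbrakk>w \<in> carrier W; x \<in> cox_space S; y \<in> cox_space S\<rbrakk> \<Longrightarrow> \<sigma> w (x + y) = \<sigma> w x + \<sigma> w y"
  by (rule GL_add[OF \<sigma>_carrier])

lemma \<sigma>_scale: "\<lbrakk>w \<in> carrier W; x \<in> cox_space S\<rbrakk> \<Longrightarrow> \<sigma> w (c *\<^sub>R x) = c *\<^sub>R \<sigma> w x"
  by (rule GL_scale[OF \<sigma>_carrier])

lemma \<sigma>_minus: "\<lbrakk>w \<in> carrier W; x \<in> cox_space S\<rbrakk> \<Longrightarrow> \<sigma> w (- x) = - \<sigma> w x"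
  using \<sigma>_scale[of w x "-1"] by simp

lemma \<sigma>_inv: "\<lbrakk>w \<in> carrier W; x \<in> cox_space S\<rbrakk> \<Longrightarrow> \<sigma> (inv w) (\<sigma> w x) = x"
  using \<sigma>_mult[of "inv w" w x] by (simp add: \<sigma>_one)

lemma \<sigma>_inv': "\<lbrakk>w \<in> carrier W; x \<in> cox_space S\<rbrakk> \<Longrightarrow> \<sigma> w (\<sigma> (inv w) x) = x"
  using \<sigma>_mult[of w "inv w" x] by (simp add: \<sigma>_one)

lemma \<sigma>_gen_apply:
  "\<lbrakk>s \<in> S; x \<in> cox_space S\<rbrakk> \<Longrightarrow> \<sigma> s x = x - cox_form W S (simple_root s) x *\<^sub>R simple_root s"
  by (simp add: \<sigma>_gen cox.reflection_apply cox_form_simple_roots)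

lemma \<sigma>_gen_simple_root:
  "\<lbrakk>s \<in> S; t \<in> S\<rbrakk> \<Longrightarrow> \<sigma> s (simple_root t) = simple_root t - cox_gram W s t *\<^sub>R simple_root s"
  by (simp add: \<sigma>_gen_apply simple_root_in cox_form_simple_roots)

lemma \<sigma>_word_value:
  assumes "u \<in> lists S" "x \<in> cox_space S"
  shows "\<sigma> (word_value W u) x = foldr \<sigma> u x"
  using assms(1)
proof (induction u)
  case (Cons s u)
  moreover from Cons have "set u \<subseteq> carrier W" "s \<in> carrier W" using gens_closed by auto
  ultimately show ?case using assms(2) by (simp add: \<sigma>_mult)
qed (simp add: \<sigma>_one assms)

text \<open>Tits' theorem, with the vectors of nonnegative coordinates as the cone: the negative of
  a simple root has a coordinate -1.\<close>

lemma geometric_rep_faithful: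
  assumes w: "w \<in> carrier W" and fix_roots: "\<And>s. s \<in> S \<Longrightarrow> \<sigma> w (simple_root s) = simple_root s"
  shows "w = \<one>"
proof -
  interpret simply_laced_action W S "cox_space S" "{x. \<forall>s. 0 \<le> x s}" \<sigma> simple_root
  proof
    fix s t assume st: "s \<in> S" "t \<in> S" "s \<noteq> t"
    show "ord (s \<otimes> t) = 2 \<and> \<sigma> s (simple_root t) = simple_root t \<or>
      ord (s \<otimes> t) = 3 \<and> \<sigma> s (simple_root t) = simple_root s + simple_root t \<and>
      \<sigma> t (simple_root s) = simple_root s + simple_root t"
      using ord_pair[OF st] st ord_commute[of s t]
      by (auto simp: \<sigma>_gen_simple_root cox_gram_def coxeter_edge_def)
  next
    fix u v and x :: "'g \<Rightarrow> real" assume uv: "word_eq W S u v" and x: "x \<in> cox_space S"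
    have "word_value W (map (\<lambda>s. s) u) = word_value W (map (\<lambda>s. s) v)"
      by (rule word_eq_value[OF is_group _ _ uv]) (use gens_closed in \<open>auto simp: subset_iff\<close>)
    then show "foldr \<sigma> u x = foldr \<sigma> v x"
      using \<sigma>_word_value[OF _ x, of u] \<sigma>_word_value[OF _ x, of v] word_eq_lists[OF uv] by simp
  next
    fix s assume s: "s \<in> S"
    then show "- simple_root s \<notin> {x. \<forall>s. 0 \<le> x s}" by (auto intro!: exI[of _ s])
    show "ord (s \<otimes> s) = 1" using s by (simp add: gen_square ord_id[simplified])
    show "\<sigma> s (simple_root s) = - simple_root s" using s by (simp add: \<sigma>_gen_simple_root scaleR_2)
  next
    fix s assume s: "s \<in> S"
    then have "s \<in> carrier W" using gens_closed by blast
    then show "\<sigma> s x \<in> cox_space S" "\<sigma> s (x + y) = \<sigma> s x + \<sigma> s y"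
      if "x \<in> cox_space S" "y \<in> cox_space S" for x y
      using that by (simp_all add: \<sigma>_closed \<sigma>_add)
  qed (auto simp: cox.closed simple_root_in simple_root_apply)
  obtain u where u: "u \<in> lists S" "word_value W u = w" using w by (rule obtain_word)
  have "word_eq W S u []"
    using fix_roots u by (intro faithful) (simp_all add: \<sigma>_word_value[symmetric] simple_root_in del: in_lists_conv_set)
  then have "word_value W (map (\<lambda>s. s) u) = word_value W (map (\<lambda>s. s) [])"
    by (intro word_eq_value[OF is_group]) (use gens_closed in \<open>auto simp: subset_iff\<close>)
  then show ?thesis using u by simp
qed

lemma cox_roots_closed: "\<alpha> \<in> cox_roots W S \<Longrightarrow> w \<in> carrier W \<Longrightarrow> \<sigma> w \<alpha> \<in> cox_roots W S"
  unfolding cox_roots_def by clarify (metis \<sigma>_mult m_closed simple_root_in)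

lemma cox_roots_subset: "cox_roots W S \<subseteq> cox_space S"
  by (auto simp: cox_roots_def \<sigma>_closed simple_root_in)

lemma root_lattice_subset: "x \<in> root_lattice W S \<Longrightarrow> x \<in> cox_space S"
  unfolding root_lattice_def
proof (induction rule: int_span_induct)
  case zero
  show ?case by (rule cox.closed(5))
next
  case (base x)
  then show ?case using cox_roots_subset by blast
next
  case (add x y)
  then show ?case by (intro cox.closed)
next
  case (minus x)
  then show ?case by (intro cox.closed)
qed

lemma root_lattice_\<sigma>:
  assumes "x \<in> root_lattice W S" "w \<in> carrier W"
  shows "\<sigma> w x \<in> root_lattice W S"
  using assms(1) unfolding root_lattice_def
proof (induction rule: int_span_induct)
  case zero
  have "\<sigma> w 0 = 0" using \<sigma>_scale[of w 0 0] assms(2) cox.closed(5) by simp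
  then show ?case by (simp only: int_span_zero)
next
  case (base x)
  then show ?case using cox_roots_closed assms(2) by (intro int_span_base)
next
  case (add x y)
  then show ?case
    using \<sigma>_add[OF assms(2), of x y] root_lattice_subset[unfolded root_lattice_def]
    by (simp only: int_span_add)
next
  case (minus x)
  then show ?case
    using \<sigma>_minus[OF assms(2), of x] root_lattice_subset[unfolded root_lattice_def]
    by (simp only: int_span_minus)
qed

lemma simple_root_in_lattice:
  assumes "s \<in> S"
  shows "simple_root s \<in> root_lattice W S"
proof -
  have "simple_root s = \<sigma> \<one> (simple_root s)" using assms by (simp add: \<sigma>_one simple_root_in)
  then have "simple_root s \<in> cox_roots W S" using assms unfolding cox_roots_def by blast
  then show ?thesis unfolding root_lattice_def by (rule int_span_base)
qed

end

text \<open>\<open>ext_cox_group\<close> is a bare record. Instead of group axioms, closure under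
  products is supplied, which is what pulling a product back through the bijection requires.\<close>

lemma isomorphic_pairs_sym:
  assumes "isomorphic_pairs G A H B" "A \<subseteq> carrier G"
    and closed: "\<And>x y. x \<in> carrier G \<Longrightarrow> y \<in> carrier G \<Longrightarrow> x \<otimes>\<^bsub>G\<^esub> y \<in> carrier G"
  shows "isomorphic_pairs H B G A"
proof -
  from assms(1) obtain \<phi> where \<phi>: "\<phi> \<in> hom G H" "bij_betw \<phi> (carrier G) (carrier H)" "bij_betw \<phi> A B"
    by (auto simp: isomorphic_pairs_def iso_def)
  let ?\<psi> = "inv_into (carrier G) \<phi>"
  have \<psi>: "bij_betw ?\<psi> (carrier H) (carrier G)" using \<phi>(2) by (rule bij_betw_inv_into)
  have "?\<psi> \<in> hom H G"
  proof (rule homI)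
    fix x y assume xy: "x \<in> carrier H" "y \<in> carrier H"
    then have in_G: "?\<psi> x \<in> carrier G" "?\<psi> y \<in> carrier G" using \<psi> by (auto simp: bij_betw_def)
    then show "?\<psi> x \<in> carrier G" by simp
    have "\<phi> (?\<psi> x \<otimes>\<^bsub>G\<^esub> ?\<psi> y) = x \<otimes>\<^bsub>H\<^esub> y"
      using \<phi>(1,2) xy in_G by (simp add: hom_def bij_betw_inv_into_right)
    then show "?\<psi> (x \<otimes>\<^bsub>H\<^esub> y) = ?\<psi> x \<otimes>\<^bsub>G\<^esub> ?\<psi> y"
      using \<phi>(2) closed[OF in_G] by (metis bij_betw_inv_into_left)
  qed
  moreover have "bij_betw ?\<psi> B A"
    using \<phi>(2,3) assms(2) by (auto simp: bij_betw_def inj_on_def image_iff subset_iff inv_into_f_f)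
  ultimately show ?thesis using \<psi> by (auto simp: isomorphic_pairs_def iso_def)
qed

section \<open>Reflection groups with a radical direction\<close>

text \<open>
  With \<open>R w\<close> the action of \<open>w\<close> on \<open>X\<close> and \<open>T \<lambda> v = v - (\<lambda>|v) a\<close>, the map \<open>(w, \<lambda>) \<mapsto> R w T \<lambda>\<close>
  is the isomorphism; the reflection in \<open>\<beta> c + a\<close> is the image of \<open>(c, \<alpha>\<^sub>c)\<close>.
\<close>

locale reflection_model = form_space X f + simply_laced_coxeter W S
  for X :: "'v::real_vector set" and f and W :: "'g monoid" (structure) and S +
  fixes \<beta> :: "'g \<Rightarrow> 'v" and a :: 'v and c :: 'g
  assumes \<beta>_in: "s \<in> S \<Longrightarrow> \<beta> s \<in> X"
    and gram: "\<lbrakk>s \<in> S; t \<in> S\<rbrakk> \<Longrightarrow> f (\<beta> s) (\<beta> t) = cox_gram W s t"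
    and a_in: "a \<in> X" and a_nonzero: "a \<noteq> 0"
    and a_radical: "x \<in> X \<Longrightarrow> f a x = 0"
    and nondegenerate: "\<lbrakk>l \<in> cox_space S; \<And>v. v \<in> X \<Longrightarrow> f (\<Sum>s\<in>S. l s *\<^sub>R \<beta> s) v = 0\<rbrakk> \<Longrightarrow> l = 0"
    and c_in: "c \<in> S"
    and connected: "s \<in> S \<Longrightarrow> (c, s) \<in> {(x, y). x \<in> S \<and> y \<in> S \<and> coxeter_edge W x y}\<^sup>*"
begin

lemma a_radical_right: "x \<in> X \<Longrightarrow> f x a = 0"
  using form_commute[of x a] by (simp add: a_in a_radical)

section \<open>The root space inside the model space\<close>

definition embed :: "('g \<Rightarrow> real) \<Rightarrow> 'v"
  where "embed x = (\<Sum>s\<in>S. x s *\<^sub>R \<beta> s)"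

lemma embed_in: "embed l \<in> X"
  unfolding embed_def by (intro subspace_sum[OF subspace] closed \<beta>_in)

lemma embed_add: "embed (l + m) = embed l + embed m"
  by (simp add: embed_def scaleR_add_left sum.distrib)

lemma embed_scale: "embed (d *\<^sub>R l) = d *\<^sub>R embed l"
  by (simp add: embed_def scaleR_sum_right)

lemma embed_minus: "embed (- l) = - embed l"
  using embed_scale[of "-1" l] by simp

lemma embed_diff: "embed (l - m) = embed l - embed m"
  using embed_add[of l "- m"] by (simp add: embed_minus)

lemma embed_simple_root:
  assumes "s \<in> S"
  shows "embed (simple_root s) = \<beta> s"
proof -
  have "embed (simple_root s) = (\<Sum>t\<in>S. if t = s then \<beta> s else 0)"
    unfolding embed_def by (intro sum.cong) (auto simp: simple_root_def)
  then show ?thesis using assms gens_finite by simp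
qed

lemma form_embed: "f (embed l) (embed l') = cox_form W S l l'"
proof -
  have "f (embed l) (embed l') = (\<Sum>s\<in>S. l s * f (\<beta> s) (embed l'))"
    by (simp add: embed_def[of l] form_sum_left embed_in closed \<beta>_in form_scale_left)
  also have "\<dots> = (\<Sum>s\<in>S. \<Sum>t\<in>S. cox_gram W s t * l s * l' t)"
    by (simp add: embed_def form_sum_right closed \<beta>_in form_scale_right gram sum_distrib_left mult_ac)
  finally show ?thesis by (simp add: cox_form_def gram_form_def)
qed

text \<open>A multiple of \<open>a\<close> pairs to zero with all of \<open>X\<close>, so
  \<open>nondegenerate\<close> makes \<open>embed\<close> injective even modulo the line of
  \<open>a\<close>.\<close>

lemma embed_multiple_radical:
  assumes "x \<in> cox_space S" "embed x = d *\<^sub>R a"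
  shows "x = 0"
proof (rule nondegenerate[OF assms(1)])
  show "f (\<Sum>s\<in>S. x s *\<^sub>R \<beta> s) v = 0" if "v \<in> X" for v
    using assms(2) that by (simp add: embed_def form_scale_left a_in a_radical)
qed

section \<open>The Coxeter group acting on the model space\<close>

definition R :: "'g \<Rightarrow> 'v \<Rightarrow> 'v"
  where "R = (SOME R. R \<in> hom W (GL X) \<and> (\<forall>s\<in>S. R s = reflection X f (\<beta> s)))"

lemma R_hom: "R \<in> hom W (GL X)" and R_gen: "s \<in> S \<Longrightarrow> R s = reflection X f (\<beta> s)"
proof -
  obtain R' where "R' \<in> hom W (GL X)" "\<And>s. s \<in> S \<Longrightarrow> R' s = reflection X f (\<beta> s)"
    using reflection_hom[of X f \<beta>, OF form_space_axioms \<beta>_in gram] by blast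
  then have "\<exists>R. R \<in> hom W (GL X) \<and> (\<forall>s\<in>S. R s = reflection X f (\<beta> s))" by blast
  from someI_ex[OF this] show "R \<in> hom W (GL X)" "s \<in> S \<Longrightarrow> R s = reflection X f (\<beta> s)"
    unfolding R_def by auto
qed

lemma R_carrier [simp]: "w \<in> carrier W \<Longrightarrow> R w \<in> carrier (GL X)"
  using R_hom by (rule hom_in_carrier)

lemma R_closed: "w \<in> carrier W \<Longrightarrow> x \<in> X \<Longrightarrow> R w x \<in> X"
  by (rule GL_closed[OF R_carrier])

lemma R_mult: "\<lbrakk>w \<in> carrier W; w' \<in> carrier W\<rbrakk> \<Longrightarrow> R (w \<otimes> w') = R w \<otimes>\<^bsub>GL X\<^esub> R w'"
  by (rule hom_mult[OF R_hom])

lemma R_mult_apply: "\<lbrakk>w \<in> carrier W; w' \<in> carrier W; x \<in> X\<rbrakk> \<Longrightarrow> R (w \<otimes> w') x = R w (R w' x)"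
  by (simp add: R_mult GL_mult compose_eq)

lemma R_one: "R \<one> = \<one>\<^bsub>GL X\<^esub>"
  using hom_one[OF R_hom is_group GL.is_group] .

lemma R_one_apply: "x \<in> X \<Longrightarrow> R \<one> x = x"
  by (simp add: R_one GL_one)

lemma R_inv: "w \<in> carrier W \<Longrightarrow> R (inv w) = inv\<^bsub>GL X\<^esub> R w"
  using group_hom.hom_inv[of W "GL X" R w] R_hom is_group GL.is_group
  by (simp add: group_hom_def group_hom_axioms_def)

lemma R_gen_apply: "\<lbrakk>s \<in> S; x \<in> X\<rbrakk> \<Longrightarrow> R s x = x - f (\<beta> s) x *\<^sub>R \<beta> s"
  by (simp add: R_gen reflection_apply gram)

lemma R_embed: "\<lbrakk>w \<in> carrier W; x \<in> cox_space S\<rbrakk> \<Longrightarrow> R w (embed x) = embed (\<sigma> w x)"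
proof (induction arbitrary: x rule: generators_induct)
  case one
  then show ?case by (simp add: R_one_apply \<sigma>_one embed_in)
next
  case (gen s w)
  moreover have "R s (embed y) = embed (\<sigma> s y)" if "y \<in> cox_space S" for y
    using gen(1) that form_embed[of "simple_root s" y]
    by (simp add: R_gen_apply \<sigma>_gen_apply embed_in embed_diff embed_scale embed_simple_root)
  ultimately show ?case
    using gens_closed by (simp add: subset_iff R_mult_apply \<sigma>_mult embed_in \<sigma>_closed)
qed

lemma R_isometry: "\<lbrakk>w \<in> carrier W; x \<in> X; y \<in> X\<rbrakk> \<Longrightarrow> f (R w x) (R w y) = f x y"
proof (induction arbitrary: x y rule: generators_induct)
  case (gen s w)
  then show ?case
    using gens_closed by (simp add: subset_iff R_mult_apply R_gen reflection_isometry \<beta>_in gram R_closed)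
qed (simp add: R_one_apply)

lemma R_radical: "w \<in> carrier W \<Longrightarrow> R w a = a"
proof (induction rule: generators_induct)
  case (gen s w)
  then show ?case
    using gens_closed
    by (simp add: subset_iff R_mult_apply a_in R_gen_apply a_radical_right \<beta>_in a_radical)
qed (simp add: R_one_apply a_in)

section \<open>Transvections along the radical vector\<close>

definition T :: "('g \<Rightarrow> real) \<Rightarrow> 'v \<Rightarrow> 'v"
  where "T l = (\<lambda>v\<in>X. v - f (embed l) v *\<^sub>R a)"

lemma T_apply: "v \<in> X \<Longrightarrow> T l v = v - f (embed l) v *\<^sub>R a"
  by (simp add: T_def)

lemma form_embed_radical: "f (embed l) a = 0"
  by (simp add: a_radical_right embed_in)

lemma T_carrier [simp]: "T l \<in> carrier (GL X)"
  by (rule carrier_GLI[where h = "T (- l)"])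
     (auto simp: T_apply closed a_in form_simps embed_in embed_minus form_embed_radical
       algebra_simps T_def)

lemma T_add: "T (l + m) = T l \<otimes>\<^bsub>GL X\<^esub> T m"
proof (rule GL_ext[where X = X])
  fix v assume "v \<in> X"
  then show "T (l + m) v = (T l \<otimes>\<^bsub>GL X\<^esub> T m) v"
    by (simp add: GL_mult compose_eq T_apply closed a_in form_simps embed_in embed_add
       form_embed_radical algebra_simps)
qed auto

lemma T_zero: "T 0 = \<one>\<^bsub>GL X\<^esub>"
  by (auto simp: T_def GL_one embed_def restrict_def fun_eq_iff)

lemma T_minus: "T (- l) = inv\<^bsub>GL X\<^esub> T l"
  by (rule GL.inv_equality[symmetric]) (simp_all add: T_add[symmetric] T_zero)

text \<open>\<open>R w\<close> preserves the form and fixes \<open>a\<close>, so moving it past a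
  transvection only changes the functional. The twist by the inverse of w is the one in the
  multiplication of the semidirect product.\<close>

lemma T_R:
  assumes "w \<in> carrier W" "l \<in> cox_space S"
  shows "T l \<otimes>\<^bsub>GL X\<^esub> R w = R w \<otimes>\<^bsub>GL X\<^esub> T (\<sigma> (inv w) l)"
proof (rule GL_ext[where X = X])
  fix v assume v: "v \<in> X"
  have "f (embed l) (R w v) = f (R w (embed (\<sigma> (inv w) l))) (R w v)"
    using assms by (simp add: R_embed \<sigma>_closed \<sigma>_inv')
  also have "\<dots> = f (embed (\<sigma> (inv w) l)) v"
    using assms v by (simp add: R_isometry embed_in)
  finally have *: "f (embed l) (R w v) = f (embed (\<sigma> (inv w) l)) v" .
  have "R w (v - d *\<^sub>R a) = R w v - d *\<^sub>R a" for d
    using GL_add[OF R_carrier[OF assms(1)], of v "(- d) *\<^sub>R a"] v assms(1)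
      GL_scale[OF R_carrier[OF assms(1)], of a "- d"]
    by (simp add: closed a_in R_radical)
  then show "(T l \<otimes>\<^bsub>GL X\<^esub> R w) v = (R w \<otimes>\<^bsub>GL X\<^esub> T (\<sigma> (inv w) l)) v"
    using assms v * by (simp add: GL_mult compose_eq T_apply R_closed)
qed (use assms in auto)

section \<open>The map from the semidirect product\<close>

definition \<Phi> :: "'g \<times> ('g \<Rightarrow> real) \<Rightarrow> 'v \<Rightarrow> 'v"
  where "\<Phi> = (\<lambda>(w, l). R w \<otimes>\<^bsub>GL X\<^esub> T l)"

lemma \<Phi>_mult:
  assumes "w \<in> carrier W" "w' \<in> carrier W" "l \<in> cox_space S" "l' \<in> cox_space S"
  shows "\<Phi> (w, l) \<otimes>\<^bsub>GL X\<^esub> \<Phi> (w', l') = \<Phi> (w \<otimes> w', \<sigma> (inv w') l + l')"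
proof -
  have "\<Phi> (w, l) \<otimes>\<^bsub>GL X\<^esub> \<Phi> (w', l') = R w \<otimes>\<^bsub>GL X\<^esub> (T l \<otimes>\<^bsub>GL X\<^esub> R w') \<otimes>\<^bsub>GL X\<^esub> T l'"
    using assms by (simp add: \<Phi>_def GL.m_assoc)
  then show ?thesis
    using assms by (simp add: \<Phi>_def T_R T_add R_mult GL.m_assoc)
qed

text \<open>If two images agree, the actions of w and w' differ by multiples of \<open>a\<close>. On
  embedded simple roots these multiples must vanish by \<open>embed_multiple_radical\<close>, so w =
  w' by faithfulness. Then, \<open>a\<close> being nonzero, the functionals of l and l' coincide,
  and \<open>nondegenerate\<close> applies to l - l'.\<close>

lemma \<Phi>_inj: "inj_on \<Phi> (carrier W \<times> cox_space S)"
proof (rule inj_onI, clarify)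
  fix w l w' l'
  assume w: "w \<in> carrier W" "w' \<in> carrier W" and l: "l \<in> cox_space S" "l' \<in> cox_space S"
    and eq: "\<Phi> (w, l) = \<Phi> (w', l')"
  have app: "\<Phi> (w, l) v = R w v - f (embed l) v *\<^sub>R a" if "w \<in> carrier W" "v \<in> X" for w l v
  proof -
    have "R w (v - d *\<^sub>R a) = R w v - d *\<^sub>R a" for d
      using GL_add[OF R_carrier[OF that(1)], of v "(- d) *\<^sub>R a"] that
        GL_scale[OF R_carrier[OF that(1)], of a "- d"]
      by (simp add: closed a_in R_radical)
    then show ?thesis using that by (simp add: \<Phi>_def GL_mult compose_eq T_apply)
  qed
  have eq': "R w v - R w' v = (f (embed l) v - f (embed l') v) *\<^sub>R a" if "v \<in> X" for v
    using app[of w v l] app[of w' v l'] w eq that by (simp add: algebra_simps)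
  have "\<sigma> w (simple_root s) = \<sigma> w' (simple_root s)" if "s \<in> S" for s
  proof -
    have "embed (\<sigma> w (simple_root s) - \<sigma> w' (simple_root s)) =
        (f (embed l) (\<beta> s) - f (embed l') (\<beta> s)) *\<^sub>R a"
      using eq'[of "\<beta> s"] that w R_embed[of _ "simple_root s"]
      by (simp add: embed_diff \<beta>_in simple_root_in embed_simple_root)
    then have "\<sigma> w (simple_root s) - \<sigma> w' (simple_root s) = 0"
      by (rule embed_multiple_radical[rotated]) (use w that in \<open>simp add: cox.closed \<sigma>_closed simple_root_in\<close>)
    then show ?thesis by simp
  qed
  then have "inv w \<otimes> w' = \<one>"
    using w by (intro geometric_rep_faithful) (simp_all add: \<sigma>_mult simple_root_in \<sigma>_inv flip: \<open>\<And>s. s \<in> S \<Longrightarrow> \<sigma> w (simple_root s) = \<sigma> w' (simple_root s)\<close>)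
  then have ww: "w = w'" using w by (metis inv_equality inv_inv inv_closed)
  have "l - l' = 0"
  proof (rule nondegenerate)
    show "l - l' \<in> cox_space S" using l by (simp add: cox.closed)
    show "f (\<Sum>s\<in>S. (l - l') s *\<^sub>R \<beta> s) v = 0" if "v \<in> X" for v
    proof -
      have "f (embed (l - l')) v = 0"
        unfolding embed_diff using eq'[OF that] ww a_nonzero that by (simp add: form_diff_left embed_in)
      then show ?thesis by (simp only: embed_def)
    qed
  qed
  with ww show "w = w' \<and> l = l'" by simp
qed

text \<open>Since \<open>a\<close> is radical, \<beta>_c + a pairs like \<beta>_c. Its reflection
  subtracts (\<beta>_c|v) (\<beta>_c + a): the part along \<beta>_c is \<open>R c\<close> and the
  part along \<open>a\<close> is the transvection.\<close>

lemma \<Phi>_gens: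
  shows "s \<in> S \<Longrightarrow> \<Phi> (s, 0) = reflection X f (\<beta> s)"
    and "\<Phi> (c, simple_root c) = reflection X f (\<beta> c + a)"
proof -
  show "\<Phi> (s, 0) = reflection X f (\<beta> s)" if "s \<in> S"
    using that gens_closed R_carrier[of s] by (simp add: \<Phi>_def T_zero R_gen[symmetric] subset_iff)
  have c: "c \<in> carrier W" using c_in gens_closed by blast
  have norm: "f (\<beta> c + a) (\<beta> c + a) = 2"
    using c_in by (simp add: form_simps closed \<beta>_in a_in a_radical gram a_radical_right)
  show "\<Phi> (c, simple_root c) = reflection X f (\<beta> c + a)"
  proof (rule GL_ext[where X = X])
    show "\<Phi> (c, simple_root c) \<in> carrier (GL X)" using c by (simp add: \<Phi>_def)
    show "reflection X f (\<beta> c + a) \<in> carrier (GL X)"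
      using norm c_in by (intro reflection_in_GL) (auto simp: closed \<beta>_in a_in)
    fix v assume v: "v \<in> X"
    then show "\<Phi> (c, simple_root c) v = reflection X f (\<beta> c + a) v"
      using c c_in norm
      by (simp add: \<Phi>_def GL_mult compose_eq T_apply R_gen_apply reflection_apply closed a_in \<beta>_in
          embed_simple_root form_simps a_radical a_radical_right algebra_simps)
  qed
qed

section \<open>The image is the group generated by the reflections\<close>

definition gens :: "('v \<Rightarrow> 'v) set"
  where "gens = (\<lambda>s. reflection X f (\<beta> s)) ` S \<union> {reflection X f (\<beta> c + a)}"

lemma image_gens: "\<Phi> ` ext_cox_gens S c = gens"
  by (auto simp: ext_cox_gens_def gens_def \<Phi>_gens image_iff)

lemma ext_gens_subset: "ext_cox_gens S c \<subseteq> carrier W \<times> root_lattice W S"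
  using gens_closed c_in simple_root_in_lattice
  by (auto simp: ext_cox_gens_def root_lattice_def)

lemma \<Phi>_carrier: "w \<in> carrier W \<Longrightarrow> \<Phi> (w, l) \<in> carrier (GL X)"
  by (simp add: \<Phi>_def)

lemma gens_carrier: "gens \<subseteq> carrier (GL X)"
  using ext_gens_subset \<Phi>_carrier unfolding image_gens[symmetric] by auto

lemma image_subgroup: "subgroup (\<Phi> ` (carrier W \<times> root_lattice W S)) (GL X)"
proof (rule GL.subgroupI)
  show "\<Phi> ` (carrier W \<times> root_lattice W S) \<subseteq> carrier (GL X)" using \<Phi>_carrier by auto
  show "\<Phi> ` (carrier W \<times> root_lattice W S) \<noteq> {}"
    by (auto simp: root_lattice_def intro: int_span_zero)
next
  fix g assume "g \<in> \<Phi> ` (carrier W \<times> root_lattice W S)"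
  then obtain w l where w: "w \<in> carrier W" and l: "l \<in> root_lattice W S" and g: "g = \<Phi> (w, l)" by auto
  \<comment> \<open>In the semidirect product the inverse of (w, l) is (w^-1, -w l).\<close>
  have "\<Phi> (inv w, - \<sigma> w l) \<otimes>\<^bsub>GL X\<^esub> g = \<Phi> (\<one>, 0)"
    unfolding g using w l
    by (subst \<Phi>_mult) (auto simp: root_lattice_subset \<sigma>_closed cox.closed \<sigma>_minus \<sigma>_inv)
  then have "inv\<^bsub>GL X\<^esub> g = \<Phi> (inv w, - \<sigma> w l)"
    using w g by (intro GL.inv_equality) (auto simp: \<Phi>_carrier, auto simp: \<Phi>_def R_one T_zero)
  moreover have "- \<sigma> w l \<in> root_lattice W S"
    using root_lattice_\<sigma>[OF l w] unfolding root_lattice_def by (rule int_span_minus)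
  ultimately show "inv\<^bsub>GL X\<^esub> g \<in> \<Phi> ` (carrier W \<times> root_lattice W S)" using w by auto
next
  fix g g' assume "g \<in> \<Phi> ` (carrier W \<times> root_lattice W S)" "g' \<in> \<Phi> ` (carrier W \<times> root_lattice W S)"
  then obtain w l w' l' where w: "w \<in> carrier W" "w' \<in> carrier W"
    and l: "l \<in> root_lattice W S" "l' \<in> root_lattice W S" and g: "g = \<Phi> (w, l)" "g' = \<Phi> (w', l')" by auto
  have "\<sigma> (inv w') l + l' \<in> root_lattice W S"
    using root_lattice_\<sigma>[OF l(1), of "inv w'"] w l unfolding root_lattice_def by (auto intro: int_span_add)
  moreover have "g \<otimes>\<^bsub>GL X\<^esub> g' = \<Phi> (w \<otimes> w', \<sigma> (inv w') l + l')"
    unfolding g using w l by (intro \<Phi>_mult root_lattice_subset)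
  ultimately show "g \<otimes>\<^bsub>GL X\<^esub> g' \<in> \<Phi> ` (carrier W \<times> root_lattice W S)" using w by auto
qed

lemma R_generate: "w \<in> carrier W \<Longrightarrow> R w \<in> generate (GL X) gens"
proof (induction rule: generators_induct)
  case (gen s w)
  have "R s \<in> generate (GL X) gens" using gen by (intro generate.incl) (simp add: R_gen gens_def)
  moreover have "s \<in> carrier W" using gen gens_closed by blast
  ultimately show ?case using gen by (simp add: R_mult generate.eng)
qed (simp add: R_one generate.one)

lemma T_generate_conj:
  assumes "T l \<in> generate (GL X) gens" "w \<in> carrier W" "l \<in> cox_space S"
  shows "T (\<sigma> w l) \<in> generate (GL X) gens"
proof -
  have "T l \<otimes>\<^bsub>GL X\<^esub> R (inv w) = R (inv w) \<otimes>\<^bsub>GL X\<^esub> T (\<sigma> w l)"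
    using T_R[of "inv w" l] assms by simp
  then have "T (\<sigma> w l) = R w \<otimes>\<^bsub>GL X\<^esub> (T l \<otimes>\<^bsub>GL X\<^esub> R (inv w))"
    using assms by (simp add: GL.m_assoc[symmetric] R_mult[symmetric] R_one)
  then show ?thesis using assms by (auto intro!: generate.eng R_generate)
qed

text \<open>The two reflections attached to \<open>c\<close> differ by the transvection of its
  simple root. Conjugation by the group carries it from a vertex to each neighbour, and the diagram
  is connected.\<close>

lemma T_simple_generate: "s \<in> S \<Longrightarrow> T (simple_root s) \<in> generate (GL X) gens"
proof -
  assume "s \<in> S"
  then have "(c, s) \<in> {(x, y). x \<in> S \<and> y \<in> S \<and> coxeter_edge W x y}\<^sup>*" by (rule connected)
  then show ?thesis
  proof induction
    case base
    have c: "c \<in> carrier W" using c_in gens_closed by blast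
    have "T (simple_root c) = R (inv c) \<otimes>\<^bsub>GL X\<^esub> \<Phi> (c, simple_root c)"
      using c by (simp add: \<Phi>_def R_inv GL.m_assoc[symmetric])
    moreover have "\<Phi> (c, simple_root c) \<in> generate (GL X) gens"
      by (intro generate.incl) (simp add: \<Phi>_gens gens_def)
    ultimately show ?case using c by (simp only: generate.eng R_generate inv_closed)
  next
    case (step s t)
    then have st: "s \<in> S" "t \<in> S" "coxeter_edge W s t" by auto
    then have st': "cox_gram W s t = -1" "cox_gram W t s = -1"
      using cox_gram_commute[of t s] by (auto simp: cox_gram_def coxeter_edge_def)
    have car: "s \<in> carrier W" "t \<in> carrier W" using st gens_closed by auto
    \<comment> \<open>For adjacent vertices, t sends \<alpha>_s to \<alpha>_s + \<alpha>_t, and s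
      sends this to \<alpha>_t.\<close>
    have "\<sigma> (s \<otimes> t) (simple_root s) = simple_root t"
      using st st' car
      by (simp add: \<sigma>_mult simple_root_in \<sigma>_gen_simple_root \<sigma>_add scaleR_2)
    then show ?case using T_generate_conj[OF step.IH, of "s \<otimes> t"] car st by (simp add: simple_root_in)
  qed
qed

lemma T_generate: "l \<in> root_lattice W S \<Longrightarrow> T l \<in> generate (GL X) gens"
  unfolding root_lattice_def
proof (induction rule: int_span_induct)
  case zero
  show ?case unfolding T_zero by (rule generate.one)
next
  case (base x)
  then obtain w s where "w \<in> carrier W" "s \<in> S" "x = \<sigma> w (simple_root s)"
    by (auto simp: cox_roots_def)
  then show ?case using T_generate_conj[OF T_simple_generate] simple_root_in by simp
next
  case (add x y)
  then show ?case unfolding T_add by (intro generate.eng)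
next
  case (minus x)
  then show ?case unfolding T_minus by (intro GL.generate_m_inv_closed[OF gens_carrier])
qed

lemma image_\<Phi>: "\<Phi> ` (carrier W \<times> root_lattice W S) = generate (GL X) gens"
proof
  show "generate (GL X) gens \<subseteq> \<Phi> ` (carrier W \<times> root_lattice W S)"
    unfolding image_gens[symmetric]
    by (intro GL.generate_subgroup_incl image_subgroup image_mono ext_gens_subset)
  show "\<Phi> ` (carrier W \<times> root_lattice W S) \<subseteq> generate (GL X) gens"
    by (auto simp: \<Phi>_def intro!: generate.eng R_generate T_generate)
qed

theorem ext_cox_isomorphic:
  "isomorphic_pairs (ext_cox_group W S) (ext_cox_gens S c) (generated_subgroup (GL X) gens) gens"
proof -
  have inj: "inj_on \<Phi> (carrier W \<times> root_lattice W S)"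
    by (rule inj_on_subset[OF \<Phi>_inj]) (auto simp: root_lattice_subset)
  have "\<Phi> \<in> iso (ext_cox_group W S) (generated_subgroup (GL X) gens)"
  proof (rule isoI)
    show "\<Phi> \<in> hom (ext_cox_group W S) (generated_subgroup (GL X) gens)"
    proof (rule homI)
      fix x assume x: "x \<in> carrier (ext_cox_group W S)"
      then show "\<Phi> x \<in> carrier (generated_subgroup (GL X) gens)"
        using image_\<Phi> by (auto simp: ext_cox_group_def generated_subgroup_def)
      fix y assume "y \<in> carrier (ext_cox_group W S)"
      with x show "\<Phi> (x \<otimes>\<^bsub>ext_cox_group W S\<^esub> y) = \<Phi> x \<otimes>\<^bsub>generated_subgroup (GL X) gens\<^esub> \<Phi> y"
        using \<Phi>_mult root_lattice_subset by (auto simp: ext_cox_group_def generated_subgroup_def)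
    qed
    show "bij_betw \<Phi> (carrier (ext_cox_group W S)) (carrier (generated_subgroup (GL X) gens))"
      using inj image_\<Phi> by (simp add: bij_betw_def ext_cox_group_def generated_subgroup_def)
  qed
  moreover have "bij_betw \<Phi> (ext_cox_gens S c) gens"
    using inj_on_subset[OF inj ext_gens_subset] image_gens by (simp add: bij_betw_def)
  ultimately show ?thesis unfolding isomorphic_pairs_def by blast
qed

theorem ext_cox_isomorphic':
  "isomorphic_pairs (generated_subgroup (GL X) gens) gens (ext_cox_group W S) (ext_cox_gens S c)"
proof (rule isomorphic_pairs_sym[OF ext_cox_isomorphic])
  show "ext_cox_gens S c \<subseteq> carrier (ext_cox_group W S)"
    using ext_gens_subset by (simp add: ext_cox_group_def)
  fix x y assume "x \<in> carrier (ext_cox_group W S)" "y \<in> carrier (ext_cox_group W S)"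
  then obtain w l w' l' where w: "w \<in> carrier W" "w' \<in> carrier W"
    and l: "l \<in> root_lattice W S" "l' \<in> root_lattice W S" and xy: "x = (w, l)" "y = (w', l')"
    by (auto simp: ext_cox_group_def)
  have "\<sigma> (inv w') l + l' \<in> root_lattice W S"
    using root_lattice_\<sigma>[OF l(1), of "inv w'"] w l unfolding root_lattice_def by (auto intro: int_span_add)
  then show "x \<otimes>\<^bsub>ext_cox_group W S\<^esub> y \<in> carrier (ext_cox_group W S)"
    using w xy by (simp add: ext_cox_group_def)
qed

end

section \<open>Orthogonal spanning sets\<close>

context form_space
begin

lemma orthogonal_coefficients:
  assumes "finite E" "E \<subseteq> X" "\<And>e e'. e \<in> E \<Longrightarrow> e' \<in> E \<Longrightarrow> e \<noteq> e' \<Longrightarrow> f e e' = 0" and "x \<in> span E"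
  obtains k where "x = (\<Sum>e\<in>E. k e *\<^sub>R e)" "\<And>e. e \<in> E \<Longrightarrow> f x e = k e * f e e"
proof -
  from assms(1,4) obtain k where k: "x = (\<Sum>e\<in>E. k e *\<^sub>R e)" by (auto simp: span_finite)
  have "f x e = k e * f e e" if "e \<in> E" for e
  proof -
    have "f x e = (\<Sum>d\<in>E. k d * f d e)"
      unfolding k using that assms(2) by (simp add: form_sum_left closed subset_iff form_scale_left)
    also have "\<dots> = (\<Sum>d\<in>E. if d = e then k e * f e e else 0)"
      using assms(3) that by (intro sum.cong) auto
    finally show ?thesis using assms(1) that by simp
  qed
  with k show thesis by (rule that)
qed

text \<open>Pairing with e isolates the coefficient of e times its norm, so only vectors of norm 0
  can keep a nonzero coefficient.\<close>

lemma orthogonal_radical: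
  assumes "finite E" "E \<subseteq> X" "\<And>e e'. e \<in> E \<Longrightarrow> e' \<in> E \<Longrightarrow> e \<noteq> e' \<Longrightarrow> f e e' = 0" and "x \<in> span E"
    and "\<And>e. e \<in> E \<Longrightarrow> f x e = 0"
  shows "x \<in> span {e \<in> E. f e e = 0}"
proof -
  obtain k where k: "x = (\<Sum>e\<in>E. k e *\<^sub>R e)" "\<And>e. e \<in> E \<Longrightarrow> f x e = k e * f e e"
    using orthogonal_coefficients[OF assms(1-4)] by blast
  have "x = (\<Sum>e\<in>{e \<in> E. f e e = 0}. k e *\<^sub>R e)"
    unfolding k(1) using assms(1,5) k(2) by (intro sum.mono_neutral_right) fastforce+
  also have "\<dots> \<in> span {e \<in> E. f e e = 0}" by (intro span_sum span_scale span_base)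
  finally show ?thesis .
qed

text \<open>The norm of x is the sum of the squared coefficients weighted by the norms of the basis
  vectors; with nonnegative weights it vanishes only termwise.\<close>

lemma orthogonal_semidefinite:
  assumes "finite E" "E \<subseteq> X" "\<And>e e'. e \<in> E \<Longrightarrow> e' \<in> E \<Longrightarrow> e \<noteq> e' \<Longrightarrow> f e e' = 0" and "x \<in> span E"
    and nonneg: "\<And>e. e \<in> E \<Longrightarrow> f e e \<ge> 0"
  shows "f x x \<ge> 0" and "f x x = 0 \<Longrightarrow> x \<in> span {e \<in> E. f e e = 0}"
proof -
  obtain k where k: "x = (\<Sum>e\<in>E. k e *\<^sub>R e)" "\<And>e. e \<in> E \<Longrightarrow> f x e = k e * f e e"
    using orthogonal_coefficients[OF assms(1-4)] by blast
  have x: "x \<in> X" unfolding k(1) using assms(2) by (intro subspace_sum[OF subspace]) (auto simp: closed)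
  have "f x x = (\<Sum>e\<in>E. k e * f x e)"
    using assms(2) x by (subst (2) k(1)) (simp add: form_sum_right closed subset_iff form_scale_right)
  then have xx: "f x x = (\<Sum>e\<in>E. (k e)\<^sup>2 * f e e)" by (simp add: k(2) power2_eq_square mult_ac)
  then show "f x x \<ge> 0" using nonneg by (simp add: sum_nonneg)
  assume "f x x = 0"
  then have "(k e)\<^sup>2 * f e e = 0" if "e \<in> E" for e
    using xx that assms(1) nonneg by (metis (mono_tags, lifting) sum_nonneg_eq_0_iff mult_nonneg_nonneg zero_le_power2)
  then show "x \<in> span {e \<in> E. f e e = 0}"
    using k(2) assms(1-4) by (intro orthogonal_radical) auto
qed

end

text \<open>A counting argument: a family with at most |B| members whose span contains the
  independent set B can neither repeat nor be dependent. For \<open>ortho_vec\<close> it then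
  suffices to express the simple roots.\<close>

lemma spanning_family_independent:
  fixes F :: "'i \<Rightarrow> 'v::real_vector"
  assumes "finite I" "finite B" "independent B" "B \<subseteq> span (F ` I)" "card I \<le> card B"
  shows "inj_on F I" "independent (F ` I)"
proof -
  have "card B \<le> card (F ` I)"
    using independent_span_bound[OF _ assms(3,4)] assms(1) by simp
  moreover have "card (F ` I) \<le> card I" using assms(1) by (rule card_image_le)
  ultimately have eq: "card (F ` I) = card I" "card (F ` I) = card B" using assms(5) by auto
  show "inj_on F I" using eq(1) assms(1) by (simp add: eq_card_imp_inj_on)
  show "independent (F ` I)"
  proof (rule ccontr)
    assume "\<not> ?thesis"
    then obtain a where a: "a \<in> F ` I" "a \<in> span (F ` I - {a})" by (auto simp: dependent_def)
    then have "span (F ` I - {a}) = span (F ` I)" by (metis insert_Diff span_redundant)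
    then have "card B \<le> card (F ` I - {a})"
      using independent_span_bound[OF _ assms(3), of "F ` I - {a}"] assms(1,4) by simp
    also have "\<dots> < card (F ` I)" using a assms(1) by (intro card_Diff1_less) auto
    finally show False using eq by simp
  qed
qed

section \<open>The form of an extended Weyl system\<close>

abbreviation star_vertices :: "nat list \<Rightarrow> vertex set"
  where "star_vertices p \<equiv> vertices p - {CenterStar}"

lemma vertices_simps [simp]:
  "Center \<in> vertices p" "CenterStar \<in> vertices p"
  "Arm i j \<in> vertices p \<longleftrightarrow> i < length p \<and> 1 \<le> j \<and> j \<le> p ! i"
  by (auto simp: vertices_def)

lemma finite_vertices: "finite (vertices p)"
proof -
  have "vertices p \<subseteq> {Center, CenterStar} \<union> (\<lambda>(i, j). Arm i j) ` (SIGMA i:{..<length p}. {..p ! i})"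
    by (force simp: vertices_def)
  then show ?thesis by (rule finite_subset) auto
qed

lemma weyl_space_eq: "weyl_space p = {x. \<forall>v. v \<notin> vertices p \<longrightarrow> x v = 0}"
  unfolding weyl_space_def weyl_basis_def by (rule span_simple_roots[OF finite_vertices])

lemma simple_root_in_weyl_space: "v \<in> vertices p \<Longrightarrow> simple_root v \<in> weyl_space p"
  unfolding weyl_space_def weyl_basis_def by (intro span_base) simp

lemma card_weyl_basis: "card (weyl_basis p) = card (vertices p)"
  unfolding weyl_basis_def by (rule card_image[OF inj_simple_root])

lemma single_edge_commute: "single_edge u v \<longleftrightarrow> single_edge v u"
  by (simp add: single_edge_def insert_commute)

lemma single_edge_simps [simp]:
  "\<not> single_edge Center Center" "\<not> single_edge Center CenterStar"
  "\<not> single_edge CenterStar Center" "\<not> single_edge CenterStar CenterStar"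
  "single_edge Center (Arm i j) \<longleftrightarrow> j = 1" "single_edge (Arm i j) Center \<longleftrightarrow> j = 1"
  "single_edge CenterStar (Arm i j) \<longleftrightarrow> j = 1" "single_edge (Arm i j) CenterStar \<longleftrightarrow> j = 1"
  "single_edge (Arm i j) (Arm k l) \<longleftrightarrow> i = k \<and> (l = Suc j \<or> j = Suc l)"
  by (auto simp: single_edge_def doubleton_eq_iff)

lemma weyl_gram_commute: "weyl_gram u v = weyl_gram v u"
  by (auto simp: weyl_gram_def single_edge_commute insert_commute)

lemma weyl_gram_simps [simp]:
  "weyl_gram v v = 2" "weyl_gram Center CenterStar = 2" "weyl_gram CenterStar Center = 2"
  "weyl_gram Center (Arm i j) = (if j = 1 then -1 else 0)"
  "weyl_gram CenterStar (Arm i j) = (if j = 1 then -1 else 0)"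
  "weyl_gram (Arm i j) Center = (if j = 1 then -1 else 0)"
  "weyl_gram (Arm i j) CenterStar = (if j = 1 then -1 else 0)"
  by (auto simp: weyl_gram_def doubleton_eq_iff)

lemma weyl_gram_Arm_Arm:
  "weyl_gram (Arm i j) (Arm k l) =
    (if i = k \<and> j = l then 2 else if i = k \<and> (l = Suc j \<or> j = Suc l) then -1 else 0)"
  by (auto simp: weyl_gram_def doubleton_eq_iff)

lemma form_space_weyl: "form_space (weyl_space p) (weyl_form p)"
proof
  show "subspace (weyl_space p)" unfolding weyl_space_def by (rule subspace_span)
qed (auto simp: weyl_form_def gram_form_add_right gram_form_scale_right
      intro!: gram_form_commute weyl_gram_commute)

lemma weyl_form_expand:
  "weyl_form p x y = (\<Sum>v\<in>vertices p. x v * weyl_form p (simple_root v) y)"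
proof -
  have "weyl_form p x y = (\<Sum>v\<in>vertices p. x v * (\<Sum>u\<in>vertices p. weyl_gram v u * y u))"
    by (simp add: weyl_form_def gram_form_def sum_distrib_left mult_ac)
  also have "\<dots> = (\<Sum>v\<in>vertices p. x v * weyl_form p (simple_root v) y)"
    by (simp add: weyl_form_def gram_form_simple_root_left[OF finite_vertices] cong: sum.cong)
  finally show ?thesis .
qed

lemma weyl_form_simple_roots:
  "\<lbrakk>u \<in> vertices p; v \<in> vertices p\<rbrakk> \<Longrightarrow> weyl_form p (simple_root u) (simple_root v) = weyl_gram u v"
  unfolding weyl_form_def by (rule gram_form_simple_root[OF finite_vertices])

text \<open>\<open>N\<close> may contain indices outside the vertex set, where x vanishes. This
  spares a case distinction at the ends of the arms, whose formal successor is no vertex.\<close>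

lemma weyl_form_local:
  assumes "v \<in> vertices p" "x \<in> weyl_space p" "finite N" "\<And>u. u \<in> vertices p - N \<Longrightarrow> weyl_gram v u = 0"
  shows "weyl_form p (simple_root v) x = (\<Sum>u\<in>N. weyl_gram v u * x u)"
  unfolding weyl_form_def gram_form_simple_root_left[OF finite_vertices assms(1)]
  using assms finite_vertices by (intro sum.mono_neutral_cong) (auto simp: weyl_space_eq)

lemma weyl_form_Arm:
  assumes "Arm i j \<in> vertices p" "x \<in> weyl_space p"
  shows "weyl_form p (simple_root (Arm i j)) x =
    2 * x (Arm i j) - x (Arm i (Suc j)) - (if j = 1 then x Center + x CenterStar else x (Arm i (j - 1)))"
proof -
  let ?N = "{Arm i j, Arm i (Suc j)} \<union> (if j = 1 then {Center, CenterStar} else {Arm i (j - 1)})"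
  have "weyl_form p (simple_root (Arm i j)) x = (\<Sum>u\<in>?N. weyl_gram (Arm i j) u * x u)"
  proof (rule weyl_form_local[OF assms])
    fix u assume "u \<in> vertices p - ?N"
    then show "weyl_gram (Arm i j) u = 0" by (cases u) (auto simp: weyl_gram_Arm_Arm split: if_splits)
  qed auto
  also have "\<dots> = 2 * x (Arm i j) - x (Arm i (Suc j)) -
      (if j = 1 then x Center + x CenterStar else x (Arm i (j - 1)))"
  proof (cases "j = 1")
    case False
    then obtain n where "j = Suc (Suc n)" using assms(1)
      by (intro that[of "j - 2"]) auto
    then show ?thesis by (simp add: weyl_gram_Arm_Arm)
  qed (simp add: weyl_gram_Arm_Arm)
  finally show ?thesis .
qed

lemma weyl_form_center:
  assumes "v = Center \<or> v = CenterStar" "x \<in> weyl_space p"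
  shows "weyl_form p (simple_root v) x = 2 * x Center + 2 * x CenterStar - (\<Sum>i<length p. x (Arm i 1))"
proof -
  let ?A = "(\<lambda>i. Arm i 1) ` {..<length p}"
  have "weyl_form p (simple_root v) x = (\<Sum>u\<in>{Center, CenterStar} \<union> ?A. weyl_gram v u * x u)"
  proof (rule weyl_form_local)
    fix u assume "u \<in> vertices p - ({Center, CenterStar} \<union> ?A)"
    then show "weyl_gram v u = 0" using assms(1) by (cases u) auto
  qed (use assms in auto)
  also have "\<dots> = (\<Sum>u\<in>{Center, CenterStar}. weyl_gram v u * x u) + (\<Sum>u\<in>?A. weyl_gram v u * x u)"
    by (intro sum.union_disjoint) auto
  also have "(\<Sum>u\<in>?A. weyl_gram v u * x u) = - (\<Sum>i<length p. x (Arm i 1))"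
    using assms(1) by (subst sum.reindex) (auto simp: inj_on_def sum_negf)
  finally show ?thesis using assms(1) by auto
qed

lemma vec_a_simps [simp]: "vec_a Center = -1" "vec_a CenterStar = 1" "vec_a (Arm i j) = 0"
  by (simp_all add: vec_a_def)

lemma vec_a_in: "vec_a \<in> weyl_space p"
  by (auto simp: weyl_space_eq vec_a_def simple_root_def)

lemma vec_a_nonzero: "vec_a \<noteq> 0"
  using vec_a_simps(2) by (metis zero_fun_apply zero_neq_one)

lemma weyl_form_vec_a: "weyl_form p x vec_a = 0"
proof -
  have "weyl_form p (simple_root v) vec_a = 0" if "v \<in> vertices p" for v
  proof (cases v)
    case (Arm i j)
    then show ?thesis using that by (simp add: weyl_form_Arm vec_a_in)
  qed (simp_all add: weyl_form_center vec_a_in)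
  then show ?thesis by (subst weyl_form_expand) simp
qed

lemma weyl_form_commute: "weyl_form p x y = weyl_form p y x"
  unfolding weyl_form_def by (intro gram_form_commute weyl_gram_commute)

section \<open>An orthogonal basis\<close>

text \<open>
  On an arm of length \<open>m\<close>, the functions \<open>l \<mapsto> m + 1 - l\<close> are annihilated by the Cartan matrix of
  the arm, so truncating them at the vertices gives orthogonal vectors; \<open>delta\<close> joins them at the center.
\<close>

definition arm_vec :: "nat list \<Rightarrow> nat \<Rightarrow> nat \<Rightarrow> vertex \<Rightarrow> real"
  where "arm_vec p i j v = (case v of Arm k l \<Rightarrow>
    if k = i \<and> j \<le> l \<and> l \<le> p ! i then (real (p ! i) + 1 - real l) / (real (p ! i) + 1 - real j) else 0 | _ \<Rightarrow> 0)"

definition delta :: "nat list \<Rightarrow> vertex \<Rightarrow> real"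
  where "delta p v = (case v of Center \<Rightarrow> 1 | CenterStar \<Rightarrow> 0 | Arm k l \<Rightarrow>
    if k < length p \<and> 1 \<le> l \<and> l \<le> p ! k then (real (p ! k) + 1 - real l) / (real (p ! k) + 1) else 0)"

definition ortho_vec :: "nat list \<Rightarrow> vertex \<Rightarrow> vertex \<Rightarrow> real"
  where "ortho_vec p v = (case v of Center \<Rightarrow> delta p | CenterStar \<Rightarrow> vec_a | Arm i j \<Rightarrow> arm_vec p i j)"

definition delta_norm :: "nat list \<Rightarrow> real"
  where "delta_norm p = 2 - (\<Sum>i<length p. real (p ! i) / (real (p ! i) + 1))"

lemma arm_vec_in: "Arm i j \<in> vertices p \<Longrightarrow> arm_vec p i j \<in> weyl_space p"
  by (auto simp: weyl_space_eq arm_vec_def split: vertex.splits)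

lemma delta_in: "delta p \<in> weyl_space p"
  by (auto simp: weyl_space_eq delta_def split: vertex.splits)

lemma ortho_vec_in: "v \<in> vertices p \<Longrightarrow> ortho_vec p v \<in> weyl_space p"
  by (cases v) (auto simp: ortho_vec_def delta_in vec_a_in arm_vec_in)

text \<open>After its first vertex the function is affine in l and reaches 0 one step past the arm,
  so second differences vanish. At the first vertex the missing left neighbour leaves 1 + 1 / (m -
  j). The third assumption excludes the vertex just before the support, where the pairing is
  -1.\<close>

lemma weyl_form_simple_arm_vec:
  assumes "Arm i j \<in> vertices p" "Arm k l \<in> vertices p" "k \<noteq> i \<or> j \<le> l"
  shows "weyl_form p (simple_root (Arm k l)) (arm_vec p i j) =
    (if k = i \<and> l = j then 1 + 1 / (real (p ! i) + 1 - real j) else 0)"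
proof (cases "k = i")
  case True
  define m where "m = real (p ! i) + 1"
  have m: "m - real j > 0" using assms(1) by (simp add: m_def)
  \<comment> \<open>The formula remains valid one step past the end of the arm, where its numerator
    is 0.\<close>
  have val: "arm_vec p i j (Arm i n) = (if j \<le> n then (m - real n) / (m - real j) else 0)" if "n \<le> Suc (p ! i)" for n
    using that by (cases "n = Suc (p ! i)") (auto simp: arm_vec_def m_def)
  have l: "1 \<le> l" "l \<le> p ! i" "j \<le> l" "1 \<le> j" using assms True by auto
  have "weyl_form p (simple_root (Arm k l)) (arm_vec p i j) =
      2 * ((m - real l) / (m - real j)) - (m - real (Suc l)) / (m - real j) -
      (if l = j then 0 else (m - real (l - 1)) / (m - real j))"
    using l True val[of l] val[of "Suc l"] val[of "l - 1"]
    by (subst weyl_form_Arm[OF assms(2) arm_vec_in[OF assms(1)]]) (auto simp: arm_vec_def)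
  moreover have "2 * ((m - real l) / (m - real j)) - (m - real (Suc l)) / (m - real j) -
      (m - real (l - 1)) / (m - real j) = 0"
    using l(1) by (simp add: diff_divide_distrib[symmetric] of_nat_diff)
  moreover have "2 * ((m - real j) / (m - real j)) - (m - real (Suc j)) / (m - real j) = 1 + 1 / (m - real j)"
    using m by (simp add: field_simps)
  ultimately show ?thesis
    using True by (cases "l = j") (simp_all only: if_True if_False m_def simp_thms diff_zero)
next
  case False
  then show ?thesis
    by (subst weyl_form_Arm[OF assms(2) arm_vec_in[OF assms(1)]]) (auto simp: arm_vec_def)
qed

text \<open>Along each arm \<open>delta\<close> decreases linearly from 1 at the center to 0 one
  step past the end, so it is annihilated at all arm vertices. The two central simple roots have
  equal rows in the Gram matrix and see the same defect.\<close>

lemma weyl_form_simple_delta: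
  assumes "v \<in> vertices p"
  shows "weyl_form p (simple_root v) (delta p) = (if v = Center \<or> v = CenterStar then delta_norm p else 0)"
proof (cases v)
  case (Arm i j)
  define m where "m = real (p ! i) + 1"
  have m: "m > 0" by (simp add: m_def)
  have ij: "i < length p" "1 \<le> j" "j \<le> p ! i" using assms Arm by auto
  have val: "delta p (Arm i n) = (m - real n) / m" if "1 \<le> n" "n \<le> Suc (p ! i)" for n
    using that ij by (cases "n = Suc (p ! i)") (auto simp: delta_def m_def)
  show ?thesis
  proof (cases "j = 1")
    case True
    have "weyl_form p (simple_root v) (delta p) = 2 * ((m - 1) / m) - (m - 2) / m - 1"
      using Arm assms True ij val[of 1] val[of 2]
      by (simp add: weyl_form_Arm delta_in numeral_2_eq_2) (simp add: delta_def)
    then show ?thesis using Arm m by (simp add: field_simps)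
  next
    case False
    have "weyl_form p (simple_root v) (delta p) =
        2 * ((m - real j) / m) - (m - real (Suc j)) / m - (m - real (j - 1)) / m"
      using Arm assms False ij val[of j] val[of "Suc j"] val[of "j - 1"]
      by (simp add: weyl_form_Arm delta_in)
    then show ?thesis using Arm m False ij by (simp add: field_simps of_nat_diff)
  qed
next
  have "delta p (Arm i 1) = real (p ! i) / (real (p ! i) + 1)" if "i < length p" for i
    using that by (auto simp: delta_def)
  then have "(\<Sum>i<length p. delta p (Arm i 1)) = (\<Sum>i<length p. real (p ! i) / (real (p ! i) + 1))"
    by simp
  moreover have "delta p Center = 1" "delta p CenterStar = 0" by (simp_all add: delta_def)
  moreover case Center
  ultimately show ?thesis by (simp add: weyl_form_center delta_in delta_norm_def)
next
  have "delta p (Arm i 1) = real (p ! i) / (real (p ! i) + 1)" if "i < length p" for i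
    using that by (auto simp: delta_def)
  then have "(\<Sum>i<length p. delta p (Arm i 1)) = (\<Sum>i<length p. real (p ! i) / (real (p ! i) + 1))"
    by simp
  moreover have "delta p Center = 1" "delta p CenterStar = 0" by (simp_all add: delta_def)
  moreover case CenterStar
  ultimately show ?thesis by (simp add: weyl_form_center delta_in delta_norm_def)
qed

lemma weyl_form_delta: "weyl_form p x (delta p) = (x Center + x CenterStar) * delta_norm p"
proof -
  have "weyl_form p x (delta p) =
      (\<Sum>v\<in>vertices p. if v = Center \<or> v = CenterStar then x v * delta_norm p else 0)"
    by (subst weyl_form_expand) (auto intro!: sum.cong simp: weyl_form_simple_delta)
  also have "\<dots> = (\<Sum>v\<in>{Center, CenterStar}. x v * delta_norm p)"
    by (intro sum.mono_neutral_cong_right) (auto simp: finite_vertices)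
  finally show ?thesis by (simp add: distrib_right)
qed

text \<open>Expand the vector that starts further out: the simple roots in its support are
  orthogonal to the other vector, except at a common first vertex. Symmetry gives the remaining
  order.\<close>

lemma weyl_form_arm_vecs:
  assumes "Arm i j \<in> vertices p" "Arm k l \<in> vertices p"
  shows "weyl_form p (arm_vec p i j) (arm_vec p k l) =
    (if i = k \<and> j = l then 1 + 1 / (real (p ! i) + 1 - real j) else 0)"
proof -
  have *: "weyl_form p (arm_vec p i j) (arm_vec p k l) =
      (if i = k \<and> j = l then 1 + 1 / (real (p ! i) + 1 - real j) else 0)"
    if "Arm i j \<in> vertices p" "Arm k l \<in> vertices p" "i \<noteq> k \<or> l \<le> j" for i j k l
  proof -
    have "weyl_form p (arm_vec p i j) (arm_vec p k l) =
        (\<Sum>v\<in>vertices p. if v = Arm i j then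
          (if i = k \<and> j = l then 1 + 1 / (real (p ! i) + 1 - real j) else 0) else 0)"
    proof (subst weyl_form_expand, rule sum.cong)
      fix v assume v: "v \<in> vertices p"
      show "arm_vec p i j v * weyl_form p (simple_root v) (arm_vec p k l) =
        (if v = Arm i j then (if i = k \<and> j = l then 1 + 1 / (real (p ! i) + 1 - real j) else 0) else 0)"
      proof (cases v)
        case (Arm i' j')
        show ?thesis
        proof (cases "i' = i \<and> j \<le> j'")
          case True
          then have "weyl_form p (simple_root v) (arm_vec p k l) =
              (if i = k \<and> j' = l then 1 + 1 / (real (p ! i) + 1 - real j') else 0)"
            using weyl_form_simple_arm_vec[OF that(2), of i j'] that v Arm by auto
          moreover have "arm_vec p i j (Arm i j) = 1" using that(1) by (simp add: arm_vec_def)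
          ultimately show ?thesis using True Arm that by auto
        next
          case False
          then show ?thesis using Arm by (auto simp: arm_vec_def)
        qed
      qed (simp_all add: arm_vec_def)
    qed simp
    then show ?thesis using that(1) by (simp add: finite_vertices)
  qed
  show ?thesis
  proof (cases "i \<noteq> k \<or> l \<le> j")
    case True
    then show ?thesis by (rule *[OF assms])
  next
    case False
    then have "weyl_form p (arm_vec p k l) (arm_vec p i j) = 0" using *[of k l i j] assms by auto
    with False show ?thesis by (subst weyl_form_commute) auto
  qed
qed

lemma ortho_vec_orthogonal:
  assumes "u \<in> vertices p" "v \<in> vertices p" "u \<noteq> v"
  shows "weyl_form p (ortho_vec p u) (ortho_vec p v) = 0"
proof -
  have *: "weyl_form p (ortho_vec p u) (ortho_vec p v) = 0"
    if "u \<in> vertices p" "v \<in> vertices p" "u \<noteq> v" "v = Center \<or> v = CenterStar \<or> (\<exists>i j. u = Arm i j)" for u v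
  proof (cases v)
    case Center
    then show ?thesis using that
      by (cases u) (auto simp: ortho_vec_def weyl_form_delta arm_vec_def)
  next
    case (Arm i j)
    then show ?thesis using that by (auto simp: ortho_vec_def weyl_form_arm_vecs split: if_splits)
  qed (simp add: ortho_vec_def weyl_form_vec_a)
  show ?thesis
  proof (cases "v = Center \<or> v = CenterStar \<or> (\<exists>i j. u = Arm i j)")
    case True
    then show ?thesis using *[OF assms] by blast
  next
    case False
    then have "u = Center \<or> u = CenterStar" by (cases u) auto
    then have "weyl_form p (ortho_vec p v) (ortho_vec p u) = 0" using *[of v u] assms by blast
    then show ?thesis by (subst weyl_form_commute)
  qed
qed

lemma ortho_vec_norm:
  assumes "v \<in> vertices p"
  shows "weyl_form p (ortho_vec p v) (ortho_vec p v) =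
    (case v of Center \<Rightarrow> delta_norm p | CenterStar \<Rightarrow> 0
      | Arm i j \<Rightarrow> 1 + 1 / (real (p ! i) + 1 - real j))"
  using assms
  by (cases v) (auto simp: ortho_vec_def weyl_form_vec_a weyl_form_delta weyl_form_arm_vecs delta_def)

lemma ortho_vec_norm_Arm:
  assumes "Arm i j \<in> vertices p"
  shows "weyl_form p (ortho_vec p (Arm i j)) (ortho_vec p (Arm i j)) > 0"
proof -
  have "real j \<le> real (p ! i)" using assms by simp
  then have "1 / (real (p ! i) + 1 - real j) \<ge> 0" by simp
  then show ?thesis using ortho_vec_norm[OF assms] by (simp add: add_pos_nonneg)
qed

lemma simple_root_in_span_ortho:
  assumes "v \<in> vertices p"
  shows "simple_root v \<in> span (ortho_vec p ` vertices p)"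
proof -
  have in_span: "ortho_vec p u \<in> span (ortho_vec p ` vertices p)" if "u \<in> vertices p" for u
    using that by (intro span_base) simp
  have arm: "simple_root (Arm i j) \<in> span (ortho_vec p ` vertices p)" if "Arm i j \<in> vertices p" for i j
  proof (cases "j = p ! i")
    case True
    then have "simple_root (Arm i j) = ortho_vec p (Arm i j)"
      by (auto simp: ortho_vec_def arm_vec_def simple_root_def split: vertex.splits)
    then show ?thesis using in_span[OF that] by simp
  next
    case False
    define m where "m = real (p ! i) + 1"
    have m: "m - real j > 1" using that False by (simp add: m_def)
    have succ: "Arm i (Suc j) \<in> vertices p" using that False by auto
    \<comment> \<open>Beyond vertex j, \<open>arm_vec p i j\<close> is this multiple of the vector
      starting at j + 1, and at j it has the value 1.\<close>
    have "simple_root (Arm i j) v = (ortho_vec p (Arm i j) -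
        ((m - real (Suc j)) / (m - real j)) *\<^sub>R ortho_vec p (Arm i (Suc j))) v" for v
      using m that False
      by (cases v) (auto simp: ortho_vec_def arm_vec_def m_def[symmetric] simple_root_def)
    then have "simple_root (Arm i j) = ortho_vec p (Arm i j) -
        ((m - real (Suc j)) / (m - real j)) *\<^sub>R ortho_vec p (Arm i (Suc j))" by blast
    then show ?thesis using in_span[OF that] in_span[OF succ] by (simp only: span_diff span_scale)
  qed
  let ?I = "vertices p - {Center, CenterStar}"
  have "delta p = simple_root Center + (\<Sum>v\<in>?I. delta p v *\<^sub>R simple_root v)"
  proof -
    have "delta p = (\<Sum>v\<in>insert Center ?I. delta p v *\<^sub>R simple_root v)"
      by (rule expand_simple_roots) (auto simp: finite_vertices delta_def split: vertex.splits)
    moreover have "delta p Center = 1" by (simp add: delta_def)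
    ultimately show ?thesis by (simp add: finite_vertices)
  qed
  then have "simple_root Center = ortho_vec p Center - (\<Sum>v\<in>?I. delta p v *\<^sub>R simple_root v)"
    by (simp add: ortho_vec_def algebra_simps)
  moreover have "simple_root u \<in> span (ortho_vec p ` vertices p)" if "u \<in> ?I" for u
    using that arm by (cases u) auto
  then have "(\<Sum>v\<in>?I. delta p v *\<^sub>R simple_root v) \<in> span (ortho_vec p ` vertices p)"
    by (intro span_sum span_scale)
  ultimately have center: "simple_root Center \<in> span (ortho_vec p ` vertices p)"
    using in_span[of Center] by (simp only: span_diff vertices_simps)
  have "simple_root CenterStar = ortho_vec p CenterStar + simple_root Center"
    by (simp add: ortho_vec_def vec_a_def)
  then have "simple_root CenterStar \<in> span (ortho_vec p ` vertices p)"
    using in_span[of CenterStar] center by (simp only: span_add vertices_simps)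
  with arm center assms show ?thesis by (cases v) auto
qed

lemma ortho_vec_basis:
  shows "inj_on (ortho_vec p) (vertices p)" "independent (ortho_vec p ` vertices p)"
    and "span (ortho_vec p ` vertices p) = weyl_space p"
proof -
  have sub: "weyl_basis p \<subseteq> span (ortho_vec p ` vertices p)"
    using simple_root_in_span_ortho by (auto simp: weyl_basis_def)
  show "inj_on (ortho_vec p) (vertices p)" "independent (ortho_vec p ` vertices p)"
    using spanning_family_independent[OF finite_vertices _ _ sub] card_weyl_basis[of p]
      independent_simple_roots[OF finite_vertices, of p] finite_vertices
    by (auto simp: weyl_basis_def)
  show "span (ortho_vec p ` vertices p) = weyl_space p"
  proof
    show "span (ortho_vec p ` vertices p) \<subseteq> weyl_space p"
      unfolding weyl_space_def
      by (rule span_minimal) (use ortho_vec_in in \<open>auto simp: subspace_span weyl_space_def\<close>)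
    show "weyl_space p \<subseteq> span (ortho_vec p ` vertices p)"
      unfolding weyl_space_def by (rule span_minimal[OF sub subspace_span])
  qed
qed

section \<open>Signature and radical\<close>

lemma weyl_signature:
  assumes "pos = card {v \<in> vertices p. weyl_form p (ortho_vec p v) (ortho_vec p v) > 0}"
    "neg = card {v \<in> vertices p. weyl_form p (ortho_vec p v) (ortho_vec p v) < 0}"
    "null = card {v \<in> vertices p. weyl_form p (ortho_vec p v) (ortho_vec p v) = 0}"
  shows "has_signature (weyl_space p) (weyl_form p) (pos, neg, null)"
proof -
  let ?E = "ortho_vec p ` vertices p"
  have card: "card {x \<in> ?E. P x} = card {v \<in> vertices p. P (ortho_vec p v)}" for P
  proof -
    have "{x \<in> ?E. P x} = ortho_vec p ` {v \<in> vertices p. P (ortho_vec p v)}" by auto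
    then show ?thesis
      using ortho_vec_basis(1)[of p] by (simp add: card_image inj_on_subset)
  qed
  show ?thesis
    unfolding has_signature_def assms
    using ortho_vec_basis(2,3)[of p] finite_vertices[of p] ortho_vec_orthogonal[of _ p]
      card[of "\<lambda>x. weyl_form p x x > 0"] card[of "\<lambda>x. weyl_form p x x < 0"] card[of "\<lambda>x. weyl_form p x x = 0"]
    by (intro exI[of _ ?E]) auto
qed

lemma vertices_sign_cases:
  assumes "A \<subseteq> {Center, CenterStar}"
    and "\<And>v. v = Center \<or> v = CenterStar \<Longrightarrow> v \<notin> A \<longleftrightarrow> weyl_form p (ortho_vec p v) (ortho_vec p v) > 0"
  shows "card {v \<in> vertices p. weyl_form p (ortho_vec p v) (ortho_vec p v) > 0} = card (weyl_basis p) - card A"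
proof -
  have "{v \<in> vertices p. weyl_form p (ortho_vec p v) (ortho_vec p v) > 0} = vertices p - A" (is "?L = _")
  proof (rule Set.set_eqI)
    fix v
    show "v \<in> ?L \<longleftrightarrow> v \<in> vertices p - A"
    proof (cases v)
      case (Arm i j)
      then show ?thesis using assms(1) ortho_vec_norm_Arm[of i j p] by auto
    qed (use assms in auto)
  qed
  moreover have "A \<subseteq> vertices p" using assms(1) by auto
  ultimately show ?thesis
    using card_Diff_subset[of A "vertices p"] finite_subset[OF _ finite_vertices] by (simp add: card_weyl_basis)
qed

text \<open>Arm vectors always have positive norm and \<open>vec_a\<close> always has norm 0, so the
  sign of the norm of \<open>delta\<close> alone decides the type.\<close>

lemma delta_norm_type:
  shows domesticI: "delta_norm p > 0 \<Longrightarrow> domestic p"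
    and wildI: "delta_norm p < 0 \<Longrightarrow> wild p"
    and tubularI: "delta_norm p = 0 \<Longrightarrow> tubular p"
proof -
  let ?q = "\<lambda>v. weyl_form p (ortho_vec p v) (ortho_vec p v)"
  have center: "?q Center = delta_norm p" "?q CenterStar = 0"
    using ortho_vec_norm[of Center p] ortho_vec_norm[of CenterStar p] by auto
  have neg: "{v \<in> vertices p. ?q v < 0} = (if delta_norm p < 0 then {Center} else {})" (is "?L = ?R")
  proof (rule Set.set_eqI)
    fix v
    show "v \<in> ?L \<longleftrightarrow> v \<in> ?R"
    proof (cases v)
      case (Arm i j)
      then show ?thesis using ortho_vec_norm_Arm[of i j p] by auto
    qed (use center in auto)
  qed
  have null: "{v \<in> vertices p. ?q v = 0} = (if delta_norm p = 0 then {Center, CenterStar} else {CenterStar})"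
    (is "?L = ?R")
  proof (rule Set.set_eqI)
    fix v
    show "v \<in> ?L \<longleftrightarrow> v \<in> ?R"
    proof (cases v)
      case (Arm i j)
      then show ?thesis using ortho_vec_norm_Arm[of i j p] by auto
    qed (use center in auto)
  qed
  have pos: "card {v \<in> vertices p. ?q v > 0} =
      card (weyl_basis p) - card (if delta_norm p > 0 then {CenterStar} else {Center, CenterStar})"
    by (rule vertices_sign_cases) (use center in auto)
  have "has_signature (weyl_space p) (weyl_form p)
      (card {v \<in> vertices p. ?q v > 0}, card {v \<in> vertices p. ?q v < 0}, card {v \<in> vertices p. ?q v = 0})"
    by (rule weyl_signature[OF HOL.refl HOL.refl HOL.refl])
  note * = this[unfolded pos neg null]
  show "domestic p" if "delta_norm p > 0" unfolding domestic_def using * that by simp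
  show "wild p" if "delta_norm p < 0" unfolding wild_def using * that by (simp add: numeral_2_eq_2)
  show "tubular p" if "delta_norm p = 0" unfolding tubular_def using * that by (simp add: numeral_2_eq_2)
qed

text \<open>The type provides some orthogonal basis with exactly one null vector e, and every
  radical vector is a multiple of e. Since \<open>vec_a\<close> is radical and nonzero, it spans the
  same line.\<close>

lemma domestic_wild_radical:
  assumes "domestic p \<or> wild p" "x \<in> weyl_space p" "\<And>y. y \<in> weyl_space p \<Longrightarrow> weyl_form p x y = 0"
  shows "\<exists>d. x = d *\<^sub>R vec_a"
proof -
  interpret form_space "weyl_space p" "weyl_form p" by (rule form_space_weyl)
  obtain E where E: "finite E" "span E = weyl_space p"
    "\<And>e e'. e \<in> E \<Longrightarrow> e' \<in> E \<Longrightarrow> e \<noteq> e' \<Longrightarrow> weyl_form p e e' = 0"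
    "card {e \<in> E. weyl_form p e e = 0} = 1"
    using assms(1) unfolding domestic_def wild_def has_signature_def by auto
  then obtain e where e: "{e \<in> E. weyl_form p e e = 0} = {e}" by (auto simp: card_1_singleton_iff)
  have radical: "\<exists>d. y = d *\<^sub>R e" if "y \<in> weyl_space p" "\<And>z. z \<in> weyl_space p \<Longrightarrow> weyl_form p y z = 0" for y
  proof -
    have "E \<subseteq> weyl_space p" using E(2) span_superset by blast
    then have "y \<in> span {e}"
      using orthogonal_radical[of E y] E that unfolding e[symmetric] by blast
    then show ?thesis by (auto simp: span_singleton)
  qed
  obtain d where d: "x = d *\<^sub>R e" using radical assms by blast
  obtain d' where d': "vec_a = d' *\<^sub>R e"
    using radical[OF vec_a_in] weyl_form_vec_a weyl_form_commute by metis
  have "d' \<noteq> 0" using d' vec_a_nonzero by auto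
  then have "x = (d / d') *\<^sub>R vec_a" unfolding d d' by simp
  then show ?thesis by blast
qed

text \<open>Here the basis \<open>ortho_vec\<close> has no vector of negative norm, and only
  \<open>delta\<close> and \<open>vec_a\<close> have norm 0.\<close>

lemma tubular_semidefinite:
  assumes "delta_norm p = 0" "x \<in> weyl_space p"
  shows "weyl_form p x x \<ge> 0"
    and "weyl_form p x x = 0 \<Longrightarrow> \<exists>c d. x = c *\<^sub>R delta p + d *\<^sub>R vec_a"
    and "(\<And>y. y \<in> weyl_space p \<Longrightarrow> weyl_form p x y = 0) \<Longrightarrow> \<exists>c d. x = c *\<^sub>R delta p + d *\<^sub>R vec_a"
proof -
  interpret form_space "weyl_space p" "weyl_form p" by (rule form_space_weyl)
  let ?E = "ortho_vec p ` vertices p"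
  have E: "finite ?E" "?E \<subseteq> weyl_space p" "x \<in> span ?E"
    using finite_vertices ortho_vec_in assms(2) ortho_vec_basis(3) by auto
  have orth: "weyl_form p e e' = 0" if "e \<in> ?E" "e' \<in> ?E" "e \<noteq> e'" for e e'
    using that ortho_vec_orthogonal[of _ p] by auto
  have center: "weyl_form p (ortho_vec p Center) (ortho_vec p Center) = 0"
    "weyl_form p (ortho_vec p CenterStar) (ortho_vec p CenterStar) = 0"
    using ortho_vec_norm[of Center p] ortho_vec_norm[of CenterStar p] assms by auto
  have nonneg: "weyl_form p e e \<ge> 0" if "e \<in> ?E" for e
  proof -
    from that obtain v where v: "v \<in> vertices p" "e = ortho_vec p v" by blast
    show ?thesis
    proof (cases v)
      case (Arm i j)
      then show ?thesis using v ortho_vec_norm_Arm[of i j p] by simp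
    qed (use v center in auto)
  qed
  show "weyl_form p x x \<ge> 0"
    using orthogonal_semidefinite(1)[OF E(1,2) orth E(3) nonneg] .
  have "{e \<in> ?E. weyl_form p e e = 0} \<subseteq> {delta p, vec_a}"
  proof
    fix e assume "e \<in> {e \<in> ?E. weyl_form p e e = 0}"
    then obtain v where v: "v \<in> vertices p" "e = ortho_vec p v" "weyl_form p e e = 0" by blast
    show "e \<in> {delta p, vec_a}"
    proof (cases v)
      case (Arm i j)
      then show ?thesis using ortho_vec_norm_Arm[of i j p] v by simp
    qed (use v in \<open>auto simp: ortho_vec_def\<close>)
  qed
  then have span: "\<exists>c d. x = c *\<^sub>R delta p + d *\<^sub>R vec_a" if "x \<in> span {e \<in> ?E. weyl_form p e e = 0}"
  proof -
    have "x \<in> span {delta p, vec_a}"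
      using that span_mono[OF \<open>{e \<in> ?E. weyl_form p e e = 0} \<subseteq> {delta p, vec_a}\<close>] by blast
    then obtain c d where "x - c *\<^sub>R delta p = d *\<^sub>R vec_a"
      by (auto simp: span_breakdown_eq[of x "delta p"] span_singleton)
    then have "x = c *\<^sub>R delta p + d *\<^sub>R vec_a" by (simp add: diff_eq_eq add.commute)
    then show ?thesis by blast
  qed
  show "\<exists>c d. x = c *\<^sub>R delta p + d *\<^sub>R vec_a" if "weyl_form p x x = 0"
    using orthogonal_semidefinite(2)[OF E(1,2) orth E(3) nonneg that] by (rule span)
  show "\<exists>c d. x = c *\<^sub>R delta p + d *\<^sub>R vec_a" if "\<And>y. y \<in> weyl_space p \<Longrightarrow> weyl_form p x y = 0"
    using orthogonal_radical[OF E(1,2) orth E(3)] that E(2) by (intro span) blast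
qed

section \<open>Stars\<close>

text \<open>Simple paths rather than mere reachability: closing one up through a further vertex must
  produce a list that satisfies \<open>is_cycle\<close>.\<close>

definition path_connected_in :: "'a set \<Rightarrow> ('a \<Rightarrow> 'a \<Rightarrow> bool) \<Rightarrow> bool"
  where "path_connected_in B E \<longleftrightarrow> (\<forall>x\<in>B. \<forall>y\<in>B. \<exists>xs. xs \<noteq> [] \<and> hd xs = x \<and> last xs = y \<and>
    distinct xs \<and> set xs \<subseteq> B \<and> successively E xs)"

lemma path_connected_insert:
  assumes "path_connected_in B E" "u \<in> B" "v \<notin> B" "E u v" "E v u"
  shows "path_connected_in (insert v B) E"
  unfolding path_connected_in_def
proof (intro ballI)
  fix x y assume xy: "x \<in> insert v B" "y \<in> insert v B"
  have path: "\<exists>xs. xs \<noteq> [] \<and> hd xs = x \<and> last xs = y \<and> distinct xs \<and> set xs \<subseteq> B \<and> successively E xs"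
    if "x \<in> B" "y \<in> B" for x y
    using assms(1) that by (auto simp: path_connected_in_def)
  consider "x = v" "y = v" | "x \<in> B" "y \<in> B" | "x \<in> B" "y = v" | "x = v" "y \<in> B"
    using xy by auto
  then show "\<exists>xs. xs \<noteq> [] \<and> hd xs = x \<and> last xs = y \<and> distinct xs \<and> set xs \<subseteq> insert v B \<and> successively E xs"
  proof cases
    case 1
    then show ?thesis by (intro exI[of _ "[v]"]) simp
  next
    case 2
    from path[OF this] show ?thesis by blast
  next
    case 3
    with path[of x u] assms(2) obtain xs where
      "xs \<noteq> []" "hd xs = x" "last xs = u" "distinct xs" "set xs \<subseteq> B" "successively E xs" by blast
    with 3 assms show ?thesis
      by (intro exI[of _ "xs @ [v]"]) (auto simp: successively_append_iff)
  next
    case 4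
    with path[of u y] assms(2) obtain xs where
      "xs \<noteq> []" "hd xs = u" "last xs = y" "distinct xs" "set xs \<subseteq> B" "successively E xs" by blast
    with 4 assms show ?thesis
      by (intro exI[of _ "v # xs"]) (auto simp: successively_Cons)
  qed
qed

text \<open>A simple path in \<open>B\<close> between two different neighbours of v would close up
  through v to a cycle with at least three vertices.\<close>

lemma unique_neighbour:
  assumes "path_connected_in B E" "B \<subseteq> A" "\<nexists>xs. is_cycle A E xs"
    and "v \<in> A - B" "u \<in> B" "u' \<in> B" "E v u" "E u' v"
  shows "u = u'"
proof (rule ccontr)
  assume "u \<noteq> u'"
  obtain xs where xs: "xs \<noteq> []" "hd xs = u" "last xs = u'" "distinct xs" "set xs \<subseteq> B" "successively E xs"
    using assms(1,5,6) unfolding path_connected_in_def by blast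
  have len: "length xs \<ge> 2"
    using xs \<open>u \<noteq> u'\<close> by (cases xs rule: list.exhaust; cases "tl xs") auto
  have "is_cycle A E (v # xs)"
    unfolding is_cycle_def
  proof (intro conjI allI impI)
    fix i assume i: "i < length (v # xs)"
    show "E ((v # xs) ! i) ((v # xs) ! (Suc i mod length (v # xs)))"
    proof (cases "i = length xs")
      case True
      then show ?thesis using xs assms(8) by (auto simp: last_conv_nth nth_Cons split: nat.splits)
    next
      case False
      have succ: "successively E (v # xs)" using xs assms(7) by (simp add: successively_Cons)
      show ?thesis using successively_nth[OF succ, of i] False i by simp
    qed
  qed (use len xs assms in auto)
  then show False using assms(3) by blast
qed

lemma crossing_edge:
  assumes "(x, y) \<in> r\<^sup>*" "x \<in> B" "y \<notin> B"
  obtains u v where "(u, v) \<in> r" "u \<in> B" "v \<notin> B"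
  using assms by (induction rule: rtrancl_induct) auto

section \<open>Labelling a star by its arms\<close>

definition star_labelling ::
    "'a set \<Rightarrow> ('a \<Rightarrow> 'a \<Rightarrow> bool) \<Rightarrow> 'a \<Rightarrow> nat list \<Rightarrow> ('a \<Rightarrow> vertex) \<Rightarrow> bool"
  where "star_labelling A E c p f \<longleftrightarrow> arm_lengths p \<and> bij_betw f A (star_vertices p) \<and>
    f c = Center \<and> (\<forall>x\<in>A. \<forall>y\<in>A. E x y \<longleftrightarrow> single_edge (f x) (f y))"

text \<open>Attaching a leaf. It serves both for opening a new arm at the center and for lengthening
  an arm: either way the model gains one vertex \<open>a\<close> with a single neighbour.\<close>

lemma star_labelling_insert:
  assumes f: "star_labelling B E c p f" and v: "v \<notin> B" and c: "c \<in> B" and q: "arm_lengths q"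
    and a: "vertices q = insert a (vertices p)" "a \<notin> vertices p"
    and E: "\<And>x. x \<in> B \<Longrightarrow> E v x \<longleftrightarrow> x = u" "\<And>x. x \<in> B \<Longrightarrow> E x v \<longleftrightarrow> x = u" "\<not> E v v" and u: "u \<in> B"
    and edge: "\<And>w. w \<in> star_vertices p \<Longrightarrow> single_edge w a \<longleftrightarrow> w = f u" "\<not> single_edge a a"
  shows "star_labelling (insert v B) E c q (f(v := a))"
proof -
  have bij: "bij_betw f B (star_vertices p)" and fc: "f c = Center"
    and fE: "\<And>x y. x \<in> B \<Longrightarrow> y \<in> B \<Longrightarrow> E x y \<longleftrightarrow> single_edge (f x) (f y)"
    using f by (auto simp: star_labelling_def)
  have aC: "a \<noteq> CenterStar" using a by auto
  have "bij_betw (f(v := a)) B (star_vertices p)"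
    using bij v by (subst bij_betw_cong[where g = f]) auto
  then have "bij_betw (f(v := a)) (insert v B) (insert a (star_vertices p))"
    using notIn_Un_bij_betw[of v B "f(v := a)" "star_vertices p"] v a by auto
  moreover have "insert a (star_vertices p) = star_vertices q" using a aC by auto
  moreover have "E x v \<longleftrightarrow> single_edge (f x) a" "E v x \<longleftrightarrow> single_edge a (f x)" if "x \<in> B" for x
  proof -
    have "f x \<in> star_vertices p" using bij that by (auto simp: bij_betw_def)
    then have "single_edge (f x) a \<longleftrightarrow> x = u"
      using edge(1) bij that u by (auto simp: bij_betw_def inj_on_def)
    then show "E x v \<longleftrightarrow> single_edge (f x) a" "E v x \<longleftrightarrow> single_edge a (f x)"
      using E that by (auto simp: single_edge_commute)
  qed
  ultimately show ?thesis
    unfolding star_labelling_def using q fc fE E(3) edge(2) v c by auto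
qed

text \<open>The labelled part grows from \<open>c\<close> one vertex at a time. As the diagram has
  no cycle, a new vertex is joined to exactly one labelled vertex u. If u = c a new arm starts;
  otherwise the degree bound forces u to be the end of its arm.\<close>

lemma star_labelling_exists:
  assumes tree: "is_tree A E" and c: "c \<in> A"
    and sym: "\<And>x y. x \<in> A \<Longrightarrow> y \<in> A \<Longrightarrow> E x y \<Longrightarrow> E y x" and irrefl: "\<And>x. x \<in> A \<Longrightarrow> \<not> E x x"
    and deg: "\<And>v. v \<in> A \<Longrightarrow> v \<noteq> c \<Longrightarrow> degree_in A E v \<le> 2"
  shows "\<exists>p f. star_labelling A E c p f"
proof -
  have fin: "finite A" and acyclic: "\<nexists>xs. is_cycle A E xs"
    and conn: "\<And>x y. x \<in> A \<Longrightarrow> y \<in> A \<Longrightarrow> (x, y) \<in> {(x, y). x \<in> A \<and> y \<in> A \<and> E x y}\<^sup>*"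
    using tree by (auto simp: is_tree_def)
  have "\<exists>B p f. B \<subseteq> A \<and> card B = Suc n \<and> c \<in> B \<and> path_connected_in B E \<and> star_labelling B E c p f"
    if "Suc n \<le> card A" for n
    using that
  proof (induction n)
    case 0
    have "vertices [] = {Center, CenterStar}" by (auto simp: vertices_def)
    then have "star_labelling {c} E c [] (\<lambda>_. Center)"
      using c irrefl by (auto simp: star_labelling_def arm_lengths_def bij_betw_def)
    moreover have "path_connected_in {c} E"
      by (auto simp: path_connected_in_def intro!: exI[of _ "[c]"])
    ultimately show ?case using c by (intro exI[of _ "{c}"]) auto
  next
    case (Suc n)
    then obtain B p f where B: "B \<subseteq> A" "card B = Suc n" "c \<in> B" "path_connected_in B E"
      and f: "star_labelling B E c p f" by auto
    have bij: "bij_betw f B (star_vertices p)" and fc: "f c = Center"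
      and p: "arm_lengths p"
      and fE: "\<And>x y. x \<in> B \<Longrightarrow> y \<in> B \<Longrightarrow> E x y \<longleftrightarrow> single_edge (f x) (f y)"
      using f by (auto simp: star_labelling_def)
    have finB: "finite B" using B(1) fin finite_subset by blast
    have "B \<noteq> A" using B(2) Suc.prems by auto
    then obtain y where y: "y \<in> A" "y \<notin> B" using B(1) by blast
    obtain u v where uv: "(u, v) \<in> {(x, y). x \<in> A \<and> y \<in> A \<and> E x y}" "u \<in> B" "v \<notin> B"
      by (rule crossing_edge[OF conn[OF c y(1)] B(3) y(2)])
    then have v: "v \<in> A - B" "E u v" "E v u" using sym by auto
    have nb: "E v x \<longleftrightarrow> x = u" "E x v \<longleftrightarrow> x = u" if "x \<in> B" for x
      using unique_neighbour[OF B(4,1) acyclic v(1) uv(2) that v(3)] v sym[of v x] sym[of x v] that B(1) by auto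
    have insert_ok: "insert v B \<subseteq> A" "card (insert v B) = Suc (Suc n)" "c \<in> insert v B"
      "path_connected_in (insert v B) E"
      using B v uv finB path_connected_insert[OF B(4) uv(2,3) v(2,3)] by auto
    have labelling: "\<exists>q g. star_labelling (insert v B) E c q g"
    proof (cases "u = c")
      case True
      let ?a = "Arm (length p) 1"
      have "vertices (p @ [1]) = insert ?a (vertices p)"
        by (auto simp: vertices_def nth_append less_Suc_eq split: if_splits)
      moreover have "single_edge w ?a \<longleftrightarrow> w = f u" if "w \<in> star_vertices p" for w
        using that True fc by (cases w) auto
      moreover have "arm_lengths (p @ [1])" using p by (simp add: arm_lengths_def)
      ultimately have "star_labelling (insert v B) E c (p @ [1]) (f(v := ?a))"
        using f uv B(3) nb irrefl v(1) by (intro star_labelling_insert) auto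
      then show ?thesis by blast
    next
      case False
      have fu: "f u \<in> star_vertices p" using bij uv(2) by (auto simp: bij_betw_def)
      moreover have "f u \<noteq> Center" using False bij fc uv(2) B(3) by (auto simp: bij_betw_def inj_on_def)
      ultimately obtain i j where ij: "f u = Arm i j" "i < length p" "1 \<le> j" "j \<le> p ! i"
        by (cases "f u") auto
      \<comment> \<open>Before the end of its arm, u would have both its labelled neighbours and the
        new vertex v, hence degree at least 3.\<close>
      have "j = p ! i"
      proof (rule ccontr)
        assume "j \<noteq> p ! i"
        define prev where "prev = (if j = 1 then Center else Arm i (j - 1))"
        have "Arm i (Suc j) \<in> star_vertices p" "prev \<in> star_vertices p"
          using ij \<open>j \<noteq> p ! i\<close> by (auto simp: prev_def)
        then obtain x y where x: "x \<in> B" "f x = Arm i (Suc j)" and y: "y \<in> B" "f y = prev"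
          using bij unfolding bij_betw_def by (metis imageE)
        have "E u x" "E u y" using fE[OF uv(2)] x y ij by (auto simp: prev_def)
        moreover have "x \<noteq> y" using x y ij by (auto simp: prev_def split: if_splits)
        moreover have "x \<noteq> v" "y \<noteq> v" using x y v by auto
        ultimately have "{x, y, v} \<subseteq> {w \<in> A. E u w}" "card {x, y, v} = 3" using x y v B(1) by auto
        then have "3 \<le> degree_in A E u"
          unfolding degree_in_def using card_mono[of "{w \<in> A. E u w}" "{x, y, v}"] fin by simp
        with deg[of u] False uv(2) B(1) show False by auto
      qed
      let ?a = "Arm i (Suc (p ! i))"
      have "vertices (p[i := Suc (p ! i)]) = insert ?a (vertices p)"
        using ij by (auto simp: vertices_def nth_list_update le_Suc_eq split: if_splits)
      moreover have "single_edge w ?a \<longleftrightarrow> w = f u" if "w \<in> star_vertices p" for w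
        using that ij \<open>j = p ! i\<close> by (cases w) auto
      moreover have "arm_lengths (p[i := Suc (p ! i)])"
        using p set_update_subset_insert[of p i "Suc (p ! i)"] by (auto simp: arm_lengths_def)
      ultimately have "star_labelling (insert v B) E c (p[i := Suc (p ! i)]) (f(v := ?a))"
        using f uv B(3) nb irrefl v(1) by (intro star_labelling_insert) auto
      then show ?thesis by blast
    qed
    with insert_ok show ?case by blast
  qed
  moreover have "Suc (card A - 1) = card A" using c fin card_gt_0_iff[of A] by auto
  ultimately obtain B p f where "B \<subseteq> A" "card B = card A" "star_labelling B E c p f"
    by (metis le_refl)
  then show ?thesis using card_subset_eq[OF fin] by blast
qed

text \<open>Renumbering the arms does not change the diagram, so the arm lengths may be taken sorted
  in the numerical classification.\<close>

lemma star_labelling_permute: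
  assumes "star_labelling A E c p f" "mset p = mset q"
  shows "\<exists>g. star_labelling A E c q g"
proof -
  from assms(2) obtain \<pi> where \<pi>: "\<pi> permutes {..<length q}" "permute_list \<pi> q = p"
    by (rule mset_eq_permutation)
  have len: "length p = length q" using assms(2) by (rule mset_eq_length)
  have nth: "p ! i = q ! \<pi> i" if "i < length q" for i
    using \<pi> that permute_list_nth[OF \<pi>(1), of i] by simp
  have \<pi>_lt: "\<pi> i < length q \<longleftrightarrow> i < length q" for i
    using permutes_in_image[OF \<pi>(1), of i] by simp
  have inj: "inj \<pi>" using \<pi>(1) by (rule permutes_inj)
  define h where "h v = (case v of Arm i j \<Rightarrow> Arm (\<pi> i) j | _ \<Rightarrow> v)" for v
  have "h u = h v \<Longrightarrow> u = v" for u v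
    by (cases u; cases v) (auto simp: h_def dest: injD[OF inj])
  then have inj_h: "inj_on h X" for X by (simp add: inj_on_def)
  have "h ` (star_vertices p) = star_vertices q"
  proof (intro equalityI subsetI)
    fix v assume "v \<in> h ` (star_vertices p)"
    then show "v \<in> star_vertices q"
      using nth \<pi>_lt len by (auto simp: h_def split: vertex.splits)
  next
    fix v assume v: "v \<in> star_vertices q"
    show "v \<in> h ` (star_vertices p)"
    proof (cases v)
      case Center
      then show ?thesis by (intro image_eqI[of _ _ Center]) (auto simp: h_def)
    next
      case (Arm i j)
      obtain i' where "i = \<pi> i'" using permutes_surj[OF \<pi>(1)] by (metis surjD)
      with Arm v show ?thesis
        using nth \<pi>_lt len by (intro image_eqI[of _ _ "Arm i' j"]) (auto simp: h_def)
    qed (use v in auto)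
  qed
  then have bij: "bij_betw h (star_vertices p) (star_vertices q)"
    using inj_h by (simp add: bij_betw_def)
  have edge: "single_edge (h u) (h v) \<longleftrightarrow> single_edge u v" for u v
    by (cases u; cases v) (auto simp: h_def inj_eq[OF inj])
  have "arm_lengths q" using assms by (auto simp: star_labelling_def arm_lengths_def dest: mset_eq_setD)
  then have "star_labelling A E c q (h \<circ> f)"
    using assms(1) bij edge by (auto simp: star_labelling_def h_def intro: bij_betw_trans)
  then show ?thesis by blast
qed

section \<open>Affine diagrams\<close>

lemma isomorphic_diagrams_sym:
  assumes "isomorphic_diagrams A E B F"
  shows "isomorphic_diagrams B F A E"
proof -
  from assms obtain f where f: "bij_betw f A B" "\<And>x y. x \<in> A \<Longrightarrow> y \<in> A \<Longrightarrow> E x y \<longleftrightarrow> F (f x) (f y)"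
    by (auto simp: isomorphic_diagrams_def)
  have "inv_into A f x \<in> A" "f (inv_into A f x) = x" if "x \<in> B" for x
    using f(1) that by (auto simp: bij_betw_def inv_into_into f_inv_into_f)
  then show ?thesis
    unfolding isomorphic_diagrams_def using f bij_betw_inv_into[OF f(1)]
    by (intro exI[of _ "inv_into A f"]) auto
qed

lemma isomorphic_diagrams_trans:
  assumes "isomorphic_diagrams A E B F" "isomorphic_diagrams B F C G"
  shows "isomorphic_diagrams A E C G"
proof -
  from assms obtain f g where f: "bij_betw f A B" "\<And>x y. x \<in> A \<Longrightarrow> y \<in> A \<Longrightarrow> E x y \<longleftrightarrow> F (f x) (f y)"
    and g: "bij_betw g B C" "\<And>x y. x \<in> B \<Longrightarrow> y \<in> B \<Longrightarrow> F x y \<longleftrightarrow> G (g x) (g y)"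
    by (auto simp: isomorphic_diagrams_def)
  have "f x \<in> B" if "x \<in> A" for x using f(1) that by (auto simp: bij_betw_def)
  then show ?thesis
    unfolding isomorphic_diagrams_def using f g bij_betw_trans[OF f(1) g(1)]
    by (intro exI[of _ "g \<circ> f"]) auto
qed

lemma affine_diagram_iso:
  assumes "isomorphic_diagrams A E B F" "affine_diagram B F"
  shows "affine_diagram A E"
proof -
  note tr = isomorphic_diagrams_trans[OF assms(1)]
  have "\<exists>n\<ge>2. isomorphic_diagrams A E {0..n} (affine_A_edge n)"
    if "\<exists>n\<ge>2. isomorphic_diagrams B F {0..n} (affine_A_edge n)"
    using that by (elim exE conjE) (intro exI conjI tr)
  moreover have "\<exists>n\<ge>4. isomorphic_diagrams A E {0..n} (affine_D_edge n)"
    if "\<exists>n\<ge>4. isomorphic_diagrams B F {0..n} (affine_D_edge n)"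
    using that by (elim exE conjE) (intro exI conjI tr)
  moreover have "\<exists>p\<in>Q. isomorphic_diagrams A E (star_vertices p) single_edge"
    if "\<exists>p\<in>Q. isomorphic_diagrams B F (star_vertices p) single_edge" for Q
    using that by (elim bexE) (intro bexI tr)
  ultimately show ?thesis using assms(2) unfolding affine_diagram_def by (elim disjE) (simp_all only: simp_thms)
qed

text \<open>A nonzero kernel vector of the Cartan matrix 2 - (adjacency matrix). It is invariant
  under isomorphism and tells the affine stars from all others.\<close>

definition null_vector :: "'a set \<Rightarrow> ('a \<Rightarrow> 'a \<Rightarrow> bool) \<Rightarrow> ('a \<Rightarrow> real) \<Rightarrow> bool"
  where "null_vector A E y \<longleftrightarrow> (\<exists>v\<in>A. y v \<noteq> 0) \<and> (\<forall>v\<in>A. (\<Sum>w\<in>{w \<in> A. E v w}. y w) = 2 * y v)"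

lemma null_vector_iso:
  assumes "isomorphic_diagrams A E B F" "null_vector B F y"
  shows "\<exists>y. null_vector A E y"
proof -
  from assms(1) obtain f where f: "bij_betw f A B" "\<And>x y. x \<in> A \<Longrightarrow> y \<in> A \<Longrightarrow> E x y \<longleftrightarrow> F (f x) (f y)"
    by (auto simp: isomorphic_diagrams_def)
  have "(\<Sum>w\<in>{w \<in> A. E v w}. y (f w)) = 2 * y (f v)" if v: "v \<in> A" for v
  proof -
    have "bij_betw f {w \<in> A. E v w} {w \<in> B. F (f v) w}"
      using f v by (force simp: bij_betw_def inj_on_def)
    then have "(\<Sum>w\<in>{w \<in> A. E v w}. y (f w)) = (\<Sum>w\<in>{w \<in> B. F (f v) w}. y w)"
      by (rule sum.reindex_bij_betw)
    moreover have "f v \<in> B" using f(1) v by (auto simp: bij_betw_def)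
    ultimately show ?thesis using assms(2) by (simp add: null_vector_def)
  qed
  moreover have "\<exists>v\<in>A. y (f v) \<noteq> 0"
    using assms(2) f(1) by (auto simp: null_vector_def bij_betw_def)
  ultimately show ?thesis unfolding null_vector_def by (intro exI[of _ "y \<circ> f"]) auto
qed

lemma affine_A_edge_iff:
  "affine_A_edge n x y \<longleftrightarrow> x < n \<and> y = Suc x \<or> y < n \<and> x = Suc y \<or> x = 0 \<and> y = n \<or> x = n \<and> y = 0"
  unfolding affine_A_edge_def doubleton_eq_iff by auto

lemma affine_D_edge_iff:
  "affine_D_edge n x y \<longleftrightarrow> 1 \<le> x \<and> x < n - 1 \<and> y = Suc x \<or> 1 \<le> y \<and> y < n - 1 \<and> x = Suc y \<or>
    x = 0 \<and> y = 2 \<or> x = 2 \<and> y = 0 \<or> x = n - 2 \<and> y = n \<or> x = n \<and> y = n - 2"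
  unfolding affine_D_edge_def doubleton_eq_iff by auto

text \<open>Cycles are treated like the other affine diagrams: a star isomorphic to a cycle would
  inherit this vector.\<close>

lemma null_vector_affine_A:
  assumes "n \<ge> 2"
  shows "null_vector {0..n} (affine_A_edge n) (\<lambda>_. 1)"
  unfolding null_vector_def
proof (intro conjI ballI)
  fix v assume v: "v \<in> {0..n}"
  have "{w \<in> {0..n}. affine_A_edge n v w} = {if v = 0 then n else v - 1, if v = n then 0 else Suc v}"
    using v assms unfolding affine_A_edge_iff by (auto split: if_splits)
  moreover have "(if v = 0 then n else v - 1) \<noteq> (if v = n then 0 else Suc v)" using v assms by auto
  ultimately show "(\<Sum>w\<in>{w \<in> {0..n}. affine_A_edge n v w}. 1) = 2 * (1::real)" by simp
qed auto

text \<open>The values are the marks of the affine diagram: 1 at the four end vertices and 2 along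
  the spine.\<close>

lemma null_vector_affine_D:
  assumes "n \<ge> 4"
  shows "null_vector {0..n} (affine_D_edge n) (\<lambda>i. if i \<in> {0, 1, n - 1, n} then 1 else 2)"
    (is "null_vector _ _ ?y")
  unfolding null_vector_def
proof (intro conjI ballI)
  fix v assume v: "v \<in> {0..n}"
  let ?N = "{w \<in> {0..n}. affine_D_edge n v w}"
  \<comment> \<open>For n = 4 the two branch vertices 2 and n - 2 coincide, and the common vertex
    has four neighbours.\<close>
  consider "v = 0" | "v = 1" | "v = n - 1" | "v = n" | "v = 2" "n = 4" | "v = 2" "n > 4"
    | "v = n - 2" "n > 4" | "2 < v" "v < n - 2" using v by force
  then show "(\<Sum>w\<in>?N. ?y w) = 2 * ?y v"
  proof cases
    case 1
    then have "?N = {2}" using assms unfolding affine_D_edge_iff by auto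
    with 1 assms show ?thesis by auto
  next
    case 2
    then have "?N = {2}" using assms unfolding affine_D_edge_iff by auto
    with 2 assms show ?thesis by auto
  next
    case 3
    then have "?N = {n - 2}" using assms unfolding affine_D_edge_iff by auto
    with 3 assms show ?thesis by auto
  next
    case 4
    then have "?N = {n - 2}" using assms unfolding affine_D_edge_iff by auto
    with 4 assms show ?thesis by auto
  next
    case 5
    then have "?N = {0, 1, 3, 4}" unfolding affine_D_edge_iff by auto
    with 5 show ?thesis by auto
  next
    case 6
    then have "?N = {0, 1, 3}" unfolding affine_D_edge_iff by auto
    with 6 show ?thesis by auto
  next
    case 7
    then have "?N = {n - 3, n - 1, n}" unfolding affine_D_edge_iff by auto
    moreover obtain m where "n = m + 5" using 7 less_imp_Suc_add[of 4 n] by auto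
    ultimately show ?thesis using 7 by simp
  next
    case 8
    then have "?N = {v - 1, Suc v}" unfolding affine_D_edge_iff by auto
    moreover have "?y (v - 1) = 2" "?y (Suc v) = 2" "?y v = 2" "v - 1 \<noteq> Suc v" using 8 by auto
    ultimately show ?thesis by simp
  qed
qed auto

section \<open>Affine stars and the norm of \<open>delta\<close>\<close>

lemma weyl_form_neighbours:
  assumes "v \<in> star_vertices p" "x \<in> weyl_space p" "x CenterStar = 0"
  shows "weyl_form p (simple_root v) x =
    2 * x v - (\<Sum>w\<in>{w \<in> star_vertices p. single_edge v w}. x w)"
proof -
  let ?I = "star_vertices p"
  have v: "v \<in> vertices p" "v \<noteq> CenterStar" using assms(1) by auto
  have "weyl_form p (simple_root v) x = (\<Sum>w\<in>vertices p. weyl_gram v w * x w)"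
    unfolding weyl_form_def by (rule gram_form_simple_root_left[OF finite_vertices v(1)])
  also have "\<dots> = (\<Sum>w\<in>?I. weyl_gram v w * x w)"
    using assms(3) by (intro sum.mono_neutral_right) (auto simp: finite_vertices)
  also have "\<dots> = (\<Sum>w\<in>?I. (if w = v then 2 * x v else 0) - (if single_edge v w then x w else 0))"
    using v(2) by (intro sum.cong) (auto simp: weyl_gram_def doubleton_eq_iff single_edge_def)
  also have "\<dots> = 2 * x v - (\<Sum>w\<in>?I. if single_edge v w then x w else 0)"
    using v finite_vertices[of p] by (simp add: sum_subtractf)
  also have "(\<Sum>w\<in>?I. if single_edge v w then x w else 0) = (\<Sum>w\<in>{w \<in> ?I. single_edge v w}. x w)"
    by (simp only: sum.inter_filter finite_vertices finite_Diff)
  finally show ?thesis .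
qed

text \<open>If the norm is 0, \<open>delta\<close> itself is a null vector. Conversely, a null
  vector extended by 0 to \<open>CenterStar\<close> is radical, because the rows of
  \<open>Center\<close> and \<open>CenterStar\<close> agree. For nonzero norm the radical is the
  line of \<open>vec_a\<close>, whose coordinate at \<open>CenterStar\<close> is 1, so the vector
  would vanish.\<close>

lemma delta_norm_null_vector:
  "delta_norm p = 0 \<longleftrightarrow> (\<exists>y. null_vector (star_vertices p) single_edge y)"
proof
  assume "delta_norm p = 0"
  then have "2 * delta p v - (\<Sum>w\<in>{w \<in> star_vertices p. single_edge v w}. delta p w) = 0"
    if "v \<in> star_vertices p" for v
    using weyl_form_neighbours[OF that delta_in] weyl_form_simple_delta[of v p] that
    by (auto simp: delta_def)
  moreover have "delta p Center \<noteq> 0" by (simp add: delta_def)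
  ultimately have "null_vector (star_vertices p) single_edge (delta p)"
    unfolding null_vector_def by (auto intro!: bexI[of _ Center])
  then show "\<exists>y. null_vector (star_vertices p) single_edge y" by blast
next
  assume "\<exists>y. null_vector (star_vertices p) single_edge y"
  then obtain y where y: "null_vector (star_vertices p) single_edge y" by blast
  define x where "x v = (if v \<in> star_vertices p then y v else 0)" for v
  have x: "x \<in> weyl_space p" "x CenterStar = 0" by (auto simp: weyl_space_eq x_def)
  have zero: "weyl_form p (simple_root v) x = 0" if "v \<in> star_vertices p" for v
  proof -
    have "(\<Sum>w\<in>{w \<in> star_vertices p. single_edge v w}. x w) =
        (\<Sum>w\<in>{w \<in> star_vertices p. single_edge v w}. y w)"
      by (intro sum.cong) (auto simp: x_def)
    then show ?thesis
      using y that weyl_form_neighbours[OF that x] unfolding null_vector_def by (simp add: x_def[of v])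
  qed
  moreover have "weyl_form p (simple_root CenterStar) x = 0"
    using zero[of Center] x by (simp add: weyl_form_center)
  ultimately have "weyl_form p (simple_root v) x = 0" if "v \<in> vertices p" for v
    using that by blast
  then have "weyl_form p z x = 0" for z by (subst weyl_form_expand) simp
  then have "weyl_form p x z = 0" for z by (subst weyl_form_commute)
  then have "\<exists>d. x = d *\<^sub>R vec_a" if "delta_norm p \<noteq> 0"
    using domestic_wild_radical[OF _ x(1)] domesticI[of p] wildI[of p] that by force
  moreover have "x \<noteq> d *\<^sub>R vec_a" for d
  proof
    assume *: "x = d *\<^sub>R vec_a"
    then have "x CenterStar = d" by simp
    then have "x = 0" using * x(2) by simp
    moreover obtain v where "v \<in> star_vertices p" "y v \<noteq> 0"
      using y by (auto simp: null_vector_def)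
    then have "x v \<noteq> 0" by (simp add: x_def)
    ultimately show False by simp
  qed
  ultimately show "delta_norm p = 0" by blast
qed

lemma delta_norm_list: "delta_norm p = 2 - (\<Sum>k\<leftarrow>p. real k / (real k + 1))"
  by (simp add: delta_norm_def sum_list_sum_nth atLeast0LessThan)

text \<open>Each arm contributes a number in [1/2, 1) and the total is 2, so there are three or four
  arms. Four arms must all contribute 1/2; three arms lead to a sum of three unit fractions equal to
  1.\<close>

lemma affine_arm_lengths:
  assumes "arm_lengths p" "sorted p" "delta_norm p = 0"
  shows "p \<in> {[1,1,1,1], [2,2,2], [1,3,3], [1,2,5]}"
proof -
  define t where "t k = real k / (real k + 1)" for k
  have t: "1 / 2 \<le> t k" "t k < 1" if "k \<in> set p" for k
    using assms(1) that by (auto simp: t_def arm_lengths_def field_simps)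
  have total: "(\<Sum>k\<leftarrow>p. t k) = 2" using assms(3) by (simp add: delta_norm_list t_def)
  have "(\<Sum>k\<leftarrow>p. 1 / 2) \<le> (\<Sum>k\<leftarrow>p. t k)" by (intro sum_list_mono t)
  then have "length p \<le> 4" using total by (simp add: sum_list_triv)
  moreover have "length p \<ge> 3"
  proof (rule ccontr)
    assume "\<not> ?thesis"
    then have "p = [] \<or> (\<exists>x. p = [x]) \<or> (\<exists>x y. p = [x, y])"
      by (cases p rule: list.exhaust; cases "tl p"; cases "tl (tl p)") auto
    then show False
    proof (elim disjE exE)
      fix x assume "p = [x]"
      then show False using t(2)[of x] total by simp
    next
      fix x y assume "p = [x, y]"
      then show False using t(2)[of x] t(2)[of y] total by simp
    qed (use total in simp)
  qed
  ultimately have "length p = 3 \<or> length p = 4" by arith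
  then show ?thesis
  proof
    assume "length p = 4"
    then obtain a b c d where p: "p = [a, b, c, d]" by (auto simp: length_Suc_conv numeral_eq_Suc)
    have half: "k = 1" if "t k = 1 / 2" for k using that by (simp add: t_def field_simps)
    have "t a = 1 / 2" "t b = 1 / 2" "t c = 1 / 2" "t d = 1 / 2"
      using total t(1)[of a] t(1)[of b] t(1)[of c] t(1)[of d] unfolding p by auto
    then show ?thesis using half p by auto
  next
    assume "length p = 3"
    then obtain a b c where p: "p = [a, b, c]" by (auto simp: length_Suc_conv numeral_eq_Suc)
    \<comment> \<open>An arm of length k contributes 1 - 1 / (k + 1), so the denominators are the
      lengths plus one.\<close>
    define A B C where ABC_def: "A = Suc a" "B = Suc b" "C = Suc c"
    have A: "2 \<le> A" "A \<le> B" "B \<le> C" using assms(1,2) p by (auto simp: ABC_def arm_lengths_def)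
    have t': "t k = 1 - 1 / real (Suc k)" for k by (simp add: t_def field_simps)
    have "1 / real A + 1 / real B + 1 / real C = 1"
      using total unfolding p by (simp add: t' ABC_def)
    then have "real (B * C + A * C + A * B) = real (A * B * C)"
      using A by (simp add: field_simps)
    then have eq: "B * C + A * C + A * B = A * B * C" by (simp only: of_nat_eq_iff)
    \<comment> \<open>A is the least of the three, so the left side of \<open>eq\<close> is at most
      3 B C, whereas A \<ge> 4 makes the right side at least 4 B C.\<close>
    have "A \<le> 3"
    proof (rule ccontr)
      assume "\<not> A \<le> 3"
      then have "4 * (B * C) \<le> A * (B * C)" by (intro mult_le_mono1) simp
      moreover have "A * C \<le> B * C" "A * B \<le> B * C" "0 < B * C" using A by (auto intro: mult_le_mono simp: mult.commute[of B])
      ultimately show False using eq unfolding mult.assoc by linarith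
    qed
    then have "A = 2 \<or> A = 3" using A by auto
    then show ?thesis
    proof
      assume "A = 2"
      then have eq2: "2 * C + 2 * B = B * C" using eq by simp
      \<comment> \<open>From B \<le> C the left side of \<open>eq2\<close> is at most 4 C.\<close>
      have "B \<le> 4"
      proof (rule ccontr)
        assume "\<not> B \<le> 4"
        then have "5 * C \<le> B * C" by (intro mult_le_mono1) simp
        then show False using eq2 A by linarith
      qed
      then have "B = 2 \<or> B = 3 \<or> B = 4" using A by auto
      then show ?thesis using eq2 \<open>A = 2\<close> A p by (auto simp: ABC_def)
    next
      assume "A = 3"
      then have eq3: "3 * C + 3 * B = 2 * (B * C)" using eq by simp
      have "B \<le> 3"
      proof (rule ccontr)
        assume "\<not> B \<le> 3"
        then have "4 * C \<le> B * C" by (intro mult_le_mono1) simp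
        then show False using eq3 A by linarith
      qed
      then have "B = 3" using A \<open>A = 3\<close> by auto
      then show ?thesis using eq3 \<open>A = 3\<close> A p by (auto simp: ABC_def)
    qed
  qed
qed

lemma star_labelling_isomorphic:
  "star_labelling A E c p f \<Longrightarrow> isomorphic_diagrams A E (star_vertices p) single_edge"
  unfolding star_labelling_def isomorphic_diagrams_def by blast

text \<open>Every listed diagram has a null vector, and an isomorphism transports it to the star.
  Conversely the arm lengths form one of four lists, of which \<open>[1,1,1,1]\<close> belongs to
  type D with n = 4.\<close>

lemma affine_diagram_iff:
  assumes "arm_lengths p" "sorted p"
  shows "affine_diagram (star_vertices p) single_edge \<longleftrightarrow> delta_norm p = 0"
proof
  assume "affine_diagram (star_vertices p) single_edge"
  then consider n where "n \<ge> 2" "isomorphic_diagrams (star_vertices p) single_edge {0..n} (affine_A_edge n)"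
    | n where "n \<ge> 4" "isomorphic_diagrams (star_vertices p) single_edge {0..n} (affine_D_edge n)"
    | q where "q \<in> {[2,2,2], [1,3,3], [1,2,5]}"
      "isomorphic_diagrams (star_vertices p) single_edge (star_vertices q) single_edge"
    by (auto simp: affine_diagram_def)
  then have "\<exists>y. null_vector (star_vertices p) single_edge y"
  proof cases
    case 1
    then show ?thesis using null_vector_iso null_vector_affine_A by blast
  next
    case 2
    then show ?thesis using null_vector_iso null_vector_affine_D by blast
  next
    case 3
    then have "delta_norm q = 0" by (auto simp: delta_norm_list)
    then show ?thesis using 3 null_vector_iso delta_norm_null_vector by blast
  qed
  then show "delta_norm p = 0" by (simp add: delta_norm_null_vector)
next
  assume "delta_norm p = 0"
  then have p: "p \<in> {[1,1,1,1], [2,2,2], [1,3,3], [1,2,5]}" using affine_arm_lengths assms by blast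
  have refl: "isomorphic_diagrams A E A E" for A and E :: "vertex \<Rightarrow> vertex \<Rightarrow> bool"
    unfolding isomorphic_diagrams_def by (intro exI[of _ "\<lambda>x. x"]) (auto simp: bij_betw_def)
  show "affine_diagram (star_vertices p) single_edge"
  proof (cases "p = [1,1,1,1]")
    case True
    have V: "star_vertices p = {Center, Arm 0 1, Arm 1 1, Arm 2 1, Arm 3 1}" (is "_ = ?V")
      unfolding True by (force simp: vertices_def less_Suc_eq numeral_eq_Suc)
    \<comment> \<open>The center goes to the branch vertex 2, and the four arms go to the end
      vertices 0, 1, 3, 4.\<close>
    define g where "g v = (case v of Arm i _ \<Rightarrow> [0, 1, 3, 4] ! i | _ \<Rightarrow> (2::nat))" for v
    have "bij_betw g ?V {0..4}"
      unfolding bij_betw_def by (auto simp: g_def inj_on_def numeral_eq_Suc atLeastAtMost_insertL[symmetric] le_Suc_eq)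
    moreover have "\<forall>x\<in>?V. \<forall>y\<in>?V. single_edge x y \<longleftrightarrow> affine_D_edge 4 (g x) (g y)"
      unfolding affine_D_edge_iff by (auto simp: g_def)
    ultimately have "isomorphic_diagrams (star_vertices p) single_edge {0..4} (affine_D_edge 4)"
      unfolding V isomorphic_diagrams_def by blast
    then show ?thesis unfolding affine_diagram_def by blast
  next
    case False
    then have "p \<in> {[2,2,2], [1,3,3], [1,2,5]}" using p by blast
    then show ?thesis unfolding affine_diagram_def using refl by blast
  qed
qed

section \<open>The highest root\<close>

text \<open>
  In the affine cases, \<open>null_root\<close> is the multiple of \<open>delta\<close> with coefficient \<open>1\<close> at the affine
  node; it equals \<open>b\<close>.
\<close>

locale affine_star =
  fixes p :: "nat list" and k :: nat
  assumes delta_norm: "delta_norm p = 0"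
    and arms: "arm_lengths p"
    and k: "k < length p"
    and dvd: "\<And>i. i < length p \<Longrightarrow> Suc (p ! i) dvd Suc (p ! k)"
begin

sublocale form_space "weyl_space p" "weyl_form p"
  by (rule form_space_weyl)

abbreviation affine_node :: vertex
  where "affine_node \<equiv> Arm k (p ! k)"

lemma affine_node_in: "affine_node \<in> vertices p"
  using arms k by (auto simp: arm_lengths_def)

definition null_root :: "vertex \<Rightarrow> real"
  where "null_root = real (Suc (p ! k)) *\<^sub>R delta p"

lemma null_root_in: "null_root \<in> weyl_space p"
  unfolding null_root_def by (intro closed delta_in)

lemma null_root_radical: "weyl_form p x null_root = 0"
  using weyl_form_delta[of p x] delta_norm
  by (simp add: null_root_def weyl_form_def gram_form_scale_right)

lemma null_root_radical_left: "weyl_form p null_root x = 0"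
  using null_root_radical by (subst weyl_form_commute)

lemma null_root_star: "null_root CenterStar = 0"
  by (simp add: null_root_def delta_def)

lemma null_root_affine_node: "null_root affine_node = 1"
  using affine_node_in by (simp add: null_root_def delta_def)

lemma null_root_pos: "v \<in> vertices p \<Longrightarrow> v \<noteq> CenterStar \<Longrightarrow> null_root v > 0"
  by (cases v) (auto simp: null_root_def delta_def)

lemma null_root_outside: "v \<notin> vertices p \<Longrightarrow> null_root v = 0"
  using null_root_in by (simp add: weyl_space_eq)

lemma null_root_nonneg: "null_root v \<ge> 0"
  using null_root_pos[of v] null_root_outside[of v] null_root_star by (cases "v = CenterStar"; cases "v \<in> vertices p") auto

text \<open>On arm i the coordinates are integers times (p_k + 1) / (p_i + 1), which is integral by
  \<open>dvd\<close>.\<close>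

lemma null_root_integral: "null_root v \<in> \<int>"
proof (cases v)
  case (Arm i j)
  show ?thesis
  proof (cases "v \<in> vertices p")
    case True
    then obtain d where d: "Suc (p ! k) = Suc (p ! i) * d" using dvd[of i] Arm by (auto elim: dvdE)
    have "null_root v = real (Suc (p ! i) * d) * ((real (p ! i) + 1 - real j) / (real (p ! i) + 1))"
      using True Arm unfolding null_root_def d by (simp add: delta_def)
    also have "\<dots> = real d * (real (p ! i) + 1 - real j)" by (simp add: field_simps)
    finally show ?thesis by simp
  qed (simp add: null_root_outside)
qed (simp_all add: null_root_def delta_def)

text \<open>A vector of norm 0 is a combination of \<open>delta\<close> and \<open>vec_a\<close>.
  The coordinate at \<open>CenterStar\<close> removes \<open>vec_a\<close>, and the affine node,
  where the null root is 1, reads off the multiple.\<close>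

lemma radical_multiple:
  assumes "x \<in> weyl_space p" "x CenterStar = 0" "weyl_form p x x = 0"
  shows "x = x affine_node *\<^sub>R null_root"
proof -
  obtain c d where x: "x = c *\<^sub>R delta p + d *\<^sub>R vec_a"
    using tubular_semidefinite(2)[OF delta_norm assms(1,3)] by blast
  have "d = 0" using assms(2) unfolding x by (simp add: delta_def)
  then have "x = (c / real (Suc (p ! k))) *\<^sub>R null_root"
    using x by (simp add: null_root_def del: of_nat_Suc)
  moreover from this have "x affine_node = c / real (Suc (p ! k))"
    by (simp only: scaleR_fun_apply null_root_affine_node real_scaleR_def mult_1_right)
  ultimately show ?thesis by simp
qed

section \<open>The finite part, away from the affine node\<close>

definition fin_vertices :: "vertex set"
  where "fin_vertices = vertices p - {CenterStar, affine_node}"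

lemma fin_simple_eq: "fin_simple p k = simple_root ` fin_vertices"
  by (auto simp: fin_simple_def fin_vertices_def weyl_basis_def affine_root_def)

lemma finite_fin_vertices: "finite fin_vertices"
  by (simp add: fin_vertices_def finite_vertices)

lemma fin_space_eq: "fin_space p k = {x. \<forall>v. v \<notin> fin_vertices \<longrightarrow> x v = 0}"
  unfolding fin_space_def fin_simple_eq by (rule span_simple_roots[OF finite_fin_vertices])

lemma fin_space_iff: "x \<in> fin_space p k \<longleftrightarrow> x \<in> weyl_space p \<and> x CenterStar = 0 \<and> x affine_node = 0"
  by (auto simp: fin_space_eq weyl_space_eq fin_vertices_def)

lemma fin_space_subset: "x \<in> fin_space p k \<Longrightarrow> x \<in> weyl_space p"
  by (simp add: fin_space_iff)

sublocale fin: form_space "fin_space p k" "weyl_form p"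
proof
  show "subspace (fin_space p k)" unfolding fin_space_def by (rule subspace_span)
qed (simp_all add: form_add_right form_scale_right fin_space_subset form_commute)

lemma fin_simple_in: "\<alpha> \<in> fin_simple p k \<Longrightarrow> \<alpha> \<in> fin_space p k"
  unfolding fin_space_def by (rule span_base)

lemma fin_simple_norm: "\<alpha> \<in> fin_simple p k \<Longrightarrow> weyl_form p \<alpha> \<alpha> = 2"
  by (auto simp: fin_simple_eq fin_vertices_def weyl_form_simple_roots)

text \<open>Vectors of the finite part vanish at the affine node, so they cannot be nonzero
  multiples of the null root; semidefiniteness becomes definiteness.\<close>

lemma fin_definite:
  assumes "x \<in> fin_space p k" "weyl_form p x x \<le> 0"
  shows "x = 0"
proof -
  have x: "x \<in> weyl_space p" "x CenterStar = 0" "x affine_node = 0" using assms(1) by (auto simp: fin_space_iff)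
  have "weyl_form p x x = 0" using tubular_semidefinite(1)[OF delta_norm x(1)] assms(2) by simp
  from radical_multiple[OF x(1,2) this] show ?thesis using x(3) by simp
qed

lemma weyl_gram_integral: "weyl_gram u v \<in> \<int>"
  by (simp add: weyl_gram_def)

lemma weyl_form_simple_integral:
  assumes "v \<in> vertices p" "\<And>u. x u \<in> \<int>"
  shows "weyl_form p (simple_root v) x \<in> \<int>"
  unfolding weyl_form_def gram_form_simple_root_left[OF finite_vertices assms(1)]
  by (intro Ints_sum Ints_mult weyl_gram_integral assms(2))

text \<open>The lattice is even: diagonal Gram entries are 2, and every off-diagonal entry is
  counted twice.\<close>

lemma weyl_form_even:
  assumes "x \<in> weyl_space p" "\<And>u. x u \<in> \<int>"
  shows "\<exists>n::int. weyl_form p x x = 2 * of_int n"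
proof -
  have "\<exists>n::int. weyl_form p (\<Sum>v\<in>I. x v *\<^sub>R simple_root v) (\<Sum>v\<in>I. x v *\<^sub>R simple_root v) = 2 * of_int n"
    if "I \<subseteq> vertices p" for I
    using finite_subset[OF that finite_vertices] that
  proof (induction I rule: finite_induct)
    case empty
    then show ?case by (intro exI[of _ 0]) (simp add: weyl_form_def gram_form_def)
  next
    case (insert v I)
    let ?y = "\<Sum>v\<in>I. x v *\<^sub>R simple_root v"
    obtain n :: int where n: "weyl_form p ?y ?y = 2 * of_int n"
      using insert.IH insert.prems by blast
    obtain c :: int where c: "x v = of_int c" using assms(2) by (metis Ints_cases)
    have y: "?y \<in> weyl_space p" "simple_root v \<in> weyl_space p"
      using insert.prems by (auto intro!: subspace_sum[OF subspace] closed simple_root_in_weyl_space)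
    have "?y u \<in> \<int>" for u
      unfolding sum_fun_apply by (intro Ints_sum) (simp add: assms(2) simple_root_def)
    then obtain d :: int where d: "weyl_form p (simple_root v) ?y = of_int d"
      using weyl_form_simple_integral[of v ?y] insert.prems by (auto elim!: Ints_cases)
    have "weyl_form p (x v *\<^sub>R simple_root v + ?y) (x v *\<^sub>R simple_root v + ?y) =
        x v * x v * 2 + 2 * x v * weyl_form p (simple_root v) ?y + weyl_form p ?y ?y"
      using y insert.prems weyl_form_commute[of p ?y "simple_root v"]
      by (simp add: form_simps closed weyl_form_simple_roots algebra_simps)
    also have "\<dots> = 2 * of_int (c * c + c * d + n)" by (simp add: n c d algebra_simps)
    finally show ?case unfolding sum.insert[OF insert.hyps] by (rule exI)
  qed
  from this[of "vertices p"] show ?thesis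
    using expand_simple_roots[OF finite_vertices, of p x] assms(1) by (simp add: weyl_space_eq)
qed

text \<open>
  Splitting a vector of norm \<open>2\<close> into its positive and negative parts, which pair nonpositively, one
  of the two has norm \<open>0\<close> and is a multiple of the null root, which has full support.
\<close>

lemma norm_2_nonneg:
  assumes x: "x \<in> weyl_space p" "x CenterStar = 0" "\<And>u. x u \<in> \<int>" "weyl_form p x x = 2"
    and pos: "x affine_node > 0"
  shows "x v \<ge> 0"
proof -
  define y where "y u = max (x u) 0" for u
  define z where "z u = max (- x u) 0" for u
  have y: "y \<in> weyl_space p" "y CenterStar = 0" and z: "z \<in> weyl_space p" "z CenterStar = 0"
    using x by (auto simp: weyl_space_eq y_def z_def)
  have yz: "x = y - z" by (auto simp: y_def z_def fun_eq_iff)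
  have int: "y u \<in> \<int>" "z u \<in> \<int>" for u using x(3)[of u] by (auto simp: y_def z_def max_def)
  \<comment> \<open>Positive Gram entries occur only on the diagonal, where y or z vanishes, and
    between the two central vertices, where both vectors vanish at
    \<open>CenterStar\<close>.\<close>
  have "weyl_gram u v * y u * z v \<le> 0" if "u \<in> vertices p" "v \<in> vertices p" for u v
  proof (cases "u = v \<or> {u, v} = {Center, CenterStar}")
    case True
    then consider "u = v" | "u = CenterStar" | "v = CenterStar" by (auto simp: doubleton_eq_iff)
    then have "y u * z v = 0"
    proof cases
      case 1
      then show ?thesis by (simp add: y_def z_def max_def)
    qed (use y z in simp_all)
    then show ?thesis by (auto simp: mult.assoc)
  next
    case False
    then have "weyl_gram u v \<le> 0" by (auto simp: weyl_gram_def)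
    then show ?thesis by (simp add: mult_nonpos_nonneg y_def z_def)
  qed
  then have "weyl_form p y z \<le> 0" unfolding weyl_form_def gram_form_def by (intro sum_nonpos)
  moreover have "weyl_form p x x = weyl_form p y y + weyl_form p z z - 2 * weyl_form p y z"
    unfolding yz using y z weyl_form_commute[of p z y] by (simp add: form_simps closed)
  ultimately have le: "weyl_form p y y + weyl_form p z z \<le> 2" using x(4) by simp
  \<comment> \<open>Two even nonnegative norms with sum at most 2 cannot both be positive.\<close>
  obtain m n :: int where mn: "weyl_form p y y = 2 * of_int m" "weyl_form p z z = 2 * of_int n"
    using weyl_form_even[OF y(1) int(1)] weyl_form_even[OF z(1) int(2)] by blast
  have "0 \<le> weyl_form p y y" "0 \<le> weyl_form p z z"
    using tubular_semidefinite(1)[OF delta_norm] y z by auto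
  then have "m = 0 \<or> n = 0" using le mn by auto
  \<comment> \<open>The coefficient of z along the null root is its value at the affine node, which
    is 0 since x is positive there.\<close>
  moreover have "z = 0" if "n = 0"
    using radical_multiple[OF z] mn that pos by (simp add: z_def[of affine_node])
  \<comment> \<open>Here y is a positive multiple of the null root, hence positive at every star
    vertex, which leaves no room for z.\<close>
  moreover have "z = 0" if "m = 0"
  proof
    fix u
    have "y = y affine_node *\<^sub>R null_root" using radical_multiple[OF y] mn that by simp
    then have "y u = y affine_node * null_root u" by (metis real_scaleR_def scaleR_fun_apply)
    then have "y u > 0" if "u \<in> vertices p" "u \<noteq> CenterStar"
      using null_root_pos[OF that] pos by (simp add: y_def[of affine_node])
    then show "z u = 0 u"
      using z by (cases "u \<in> vertices p \<and> u \<noteq> CenterStar") (auto simp: weyl_space_eq y_def z_def max_def split: if_splits)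
  qed
  ultimately have "z v = 0" by auto
  then show ?thesis by (simp add: z_def max_def split: if_splits)
qed

section \<open>Finite roots as integral vectors of norm 2\<close>

abbreviation fin_reflections :: "((vertex \<Rightarrow> real) \<Rightarrow> (vertex \<Rightarrow> real)) set"
  where "fin_reflections \<equiv> reflection (fin_space p k) (weyl_form p) ` fin_simple p k"

lemma fin_reflections_carrier: "fin_reflections \<subseteq> carrier (GL (fin_space p k))"
  using fin.reflection_in_GL fin_simple_in fin_simple_norm by blast

lemma fin_reflection_integral:
  assumes "\<alpha> \<in> fin_simple p k" "x \<in> fin_space p k" "\<And>u. x u \<in> \<int>"
  shows "reflection (fin_space p k) (weyl_form p) \<alpha> x u \<in> \<int>"
proof -
  obtain v where v: "v \<in> vertices p" "\<alpha> = simple_root v"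
    using assms(1) by (auto simp: fin_simple_eq fin_vertices_def)
  have "weyl_form p \<alpha> x * \<alpha> u \<in> \<int>"
    using weyl_form_simple_integral[OF v(1) assms(3)] v(2) by (simp add: simple_root_def)
  then show ?thesis
    using assms(1,2,3) by (simp add: fin.reflection_apply fin_simple_norm)
qed

lemma fin_group_invariants:
  assumes "w \<in> generate (GL (fin_space p k)) fin_reflections" "x \<in> fin_space p k" "\<And>u. x u \<in> \<int>"
  shows "w x \<in> fin_space p k \<and> (\<forall>u. w x u \<in> \<int>) \<and> weyl_form p (w x) (w x) = weyl_form p x x"
  using assms
proof (induction arbitrary: x)
  case one
  then show ?case by (simp add: GL_one)
next
  case (incl h)
  then show ?case
    using fin_reflection_integral fin.reflection_isometry fin_simple_in fin_simple_norm
      GL_closed[of h] fin_reflections_carrier by auto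
next
  case (inv h)
  then obtain \<alpha> where \<alpha>: "\<alpha> \<in> fin_simple p k" "h = reflection (fin_space p k) (weyl_form p) \<alpha>" by auto
  then have "inv\<^bsub>GL (fin_space p k)\<^esub> h = h"
    using fin.reflection_involution[OF fin_simple_in fin_simple_norm] fin_reflections_carrier
    by (intro fin.GL.inv_equality) auto
  with inv show ?case
    using fin_reflection_integral fin.reflection_isometry fin_simple_in fin_simple_norm
      GL_closed[of h] fin_reflections_carrier by auto
next
  case (eng g h)
  then have "g \<in> carrier (GL (fin_space p k))" "h \<in> carrier (GL (fin_space p k))"
    using fin.GL.generate_in_carrier[OF fin_reflections_carrier] by auto
  with eng show ?case by (simp add: GL_mult compose_eq)
qed

lemma fin_roots_properties:
  assumes "\<beta> \<in> fin_roots p k"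
  shows "\<beta> \<in> fin_space p k" "\<beta> u \<in> \<int>" "weyl_form p \<beta> \<beta> = 2"
proof -
  obtain w \<alpha> where w: "w \<in> generate (GL (fin_space p k)) fin_reflections" "\<alpha> \<in> fin_simple p k" "\<beta> = w \<alpha>"
    using assms by (auto simp: fin_roots_def)
  have "\<alpha> u \<in> \<int>" for u using w(2) by (auto simp: fin_simple_eq simple_root_def)
  from fin_group_invariants[OF w(1) fin_simple_in[OF w(2)] this]
  show "\<beta> \<in> fin_space p k" "\<beta> u \<in> \<int>" "weyl_form p \<beta> \<beta> = 2"
    using w fin_simple_norm by auto
qed

lemma fin_roots_reflection:
  assumes "\<beta> \<in> fin_roots p k" "\<alpha> \<in> fin_simple p k"
  shows "reflection (fin_space p k) (weyl_form p) \<alpha> \<beta> \<in> fin_roots p k"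
proof -
  let ?G = "GL (fin_space p k)" and ?r = "reflection (fin_space p k) (weyl_form p) \<alpha>"
  obtain w \<gamma> where w: "w \<in> generate ?G fin_reflections" "\<gamma> \<in> fin_simple p k" "\<beta> = w \<gamma>"
    using assms(1) by (auto simp: fin_roots_def)
  have "?r \<otimes>\<^bsub>?G\<^esub> w \<in> generate ?G fin_reflections"
    using assms(2) by (intro generate.eng[OF generate.incl w(1)]) auto
  moreover have "(?r \<otimes>\<^bsub>?G\<^esub> w) \<gamma> = ?r \<beta>"
    using w assms(2) fin.GL.generate_in_carrier[OF fin_reflections_carrier w(1)] fin_reflections_carrier
    by (subst GL_mult) (auto simp: compose_eq fin_simple_in)
  ultimately have "\<exists>w' \<gamma>. ?r \<beta> = w' \<gamma> \<and> \<gamma> \<in> fin_simple p k \<and> w' \<in> generate ?G fin_reflections"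
    using w(2) by (intro exI[of _ "?r \<otimes>\<^bsub>?G\<^esub> w"] exI[of _ \<gamma>]) simp
  then show ?thesis by (simp add: fin_roots_def)
qed

lemma fin_simple_root: "\<alpha> \<in> fin_simple p k \<Longrightarrow> \<alpha> \<in> fin_roots p k"
  unfolding fin_roots_def
  by (intro CollectI exI[of _ "\<one>\<^bsub>GL (fin_space p k)\<^esub>"] exI[of _ \<alpha>] conjI generate.one)
     (auto simp: GL_one fin_simple_in)

text \<open>Descent on the sum of the coordinates. As the norm is positive, some simple root with
  positive coefficient has a positive integral pairing n with \<beta>. Subtracting it gives norm 4 -
  2 n: for n \<ge> 2 definiteness forces \<beta> to be that simple root, and for n = 1 the
  difference is the reflected vector, smaller and still nonnegative.\<close>

lemma norm_2_fin_root:
  assumes "\<beta> \<in> fin_space p k" "\<And>v. \<beta> v \<in> \<int>" "\<And>v. \<beta> v \<ge> 0" "weyl_form p \<beta> \<beta> = 2"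
  shows "\<beta> \<in> fin_roots p k"
  using assms
proof (induction "nat \<lfloor>\<Sum>v\<in>vertices p. \<beta> v\<rfloor>" arbitrary: \<beta> rule: less_induct)
  case (less \<beta>)
  have \<beta>: "\<beta> \<in> weyl_space p" using less.prems(1) by (rule fin_space_subset)
  have "\<exists>v\<in>vertices p. \<beta> v * weyl_form p (simple_root v) \<beta> > 0"
  proof (rule ccontr)
    assume "\<not> ?thesis"
    then have "weyl_form p \<beta> \<beta> \<le> 0"
      by (subst weyl_form_expand) (auto intro!: sum_nonpos simp: not_less)
    with less.prems show False by simp
  qed
  then obtain v where v: "v \<in> vertices p" "\<beta> v * weyl_form p (simple_root v) \<beta> > 0" by blast
  then have \<beta>v: "\<beta> v > 0" and form_pos: "weyl_form p (simple_root v) \<beta> > 0"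
    using less.prems(3)[of v] by (auto simp: zero_less_mult_iff)
  have "v \<in> fin_vertices" using \<beta>v less.prems(1) by (force simp: fin_space_eq)
  then have \<alpha>: "simple_root v \<in> fin_simple p k" by (simp add: fin_simple_eq)
  have \<alpha>_in: "simple_root v \<in> fin_space p k" "simple_root v \<in> weyl_space p"
    using \<alpha> fin_simple_in fin_space_subset by auto
  have \<alpha>_norm: "weyl_form p (simple_root v) (simple_root v) = 2" using \<alpha> by (rule fin_simple_norm)
  have "weyl_form p (simple_root v) \<beta> \<in> \<int>"
    using less.prems(2) by (intro weyl_form_simple_integral v(1))
  then obtain n :: int where n: "weyl_form p (simple_root v) \<beta> = of_int n"
    by (rule Ints_cases)
  have norm: "weyl_form p (\<beta> - simple_root v) (\<beta> - simple_root v) = 4 - 2 * of_int n"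
    using \<beta> \<alpha>_in less.prems(4) \<alpha>_norm n weyl_form_commute[of p \<beta> "simple_root v"]
    by (simp add: form_simps closed)
  show ?case
  proof (cases "n \<ge> 2")
    case True
    then have "\<beta> - simple_root v = 0"
      using norm less.prems(1) \<alpha>_in by (intro fin_definite) (auto simp: fin.closed)
    then show ?thesis using fin_simple_root[OF \<alpha>] by simp
  next
    case False
    then have "n = 1" using form_pos n by simp
    let ?\<gamma> = "\<beta> - simple_root v"
    have "\<beta> v \<ge> 1" using \<beta>v less.prems(2)[of v] by (auto elim!: Ints_cases)
    then have nonneg: "?\<gamma> u \<ge> 0" for u using less.prems(3)[of u] by (auto simp: simple_root_def)
    have "(\<Sum>u\<in>vertices p. ?\<gamma> u) = (\<Sum>u\<in>vertices p. \<beta> u) - 1"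
      using v(1) finite_vertices[of p] by (simp add: sum_subtractf simple_root_def)
    moreover have "(\<Sum>u\<in>vertices p. ?\<gamma> u) \<ge> 0" using nonneg by (intro sum_nonneg)
    ultimately have "nat \<lfloor>\<Sum>u\<in>vertices p. ?\<gamma> u\<rfloor> < nat \<lfloor>\<Sum>u\<in>vertices p. \<beta> u\<rfloor>" by linarith
    moreover have "?\<gamma> u \<in> \<int>" for u using less.prems(2)[of u] by (simp add: simple_root_def)
    ultimately have "?\<gamma> \<in> fin_roots p k"
      using less.hyps[of ?\<gamma>] nonneg norm \<open>n = 1\<close> less.prems(1) \<alpha>_in by (simp add: fin.closed)
    moreover have "reflection (fin_space p k) (weyl_form p) (simple_root v) ?\<gamma> = \<beta>"
      using \<alpha>_norm \<alpha>_in less.prems(1) \<beta> n \<open>n = 1\<close>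
      by (simp add: fin.reflection_apply fin.closed form_simps)
    ultimately show ?thesis using fin_roots_reflection[OF _ \<alpha>] by metis
  qed
qed

text \<open>Subtracting a simple root from the radical null root leaves norm 2, so the candidate is
  a root by \<open>norm_2_fin_root\<close>.\<close>

lemma highest_root_eq: "highest_root p k = null_root - simple_root affine_node"
proof -
  let ?\<theta> = "null_root - simple_root affine_node"
  have \<alpha>: "simple_root affine_node \<in> weyl_space p"
    "weyl_form p (simple_root affine_node) (simple_root affine_node) = 2"
    using affine_node_in by (auto simp: simple_root_in_weyl_space weyl_form_simple_roots)
  have \<theta>_root: "?\<theta> \<in> fin_roots p k"
  proof (rule norm_2_fin_root)
    show "?\<theta> \<in> fin_space p k"
      using \<alpha> null_root_in null_root_star null_root_affine_node by (simp add: fin_space_iff closed)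
    show "weyl_form p ?\<theta> ?\<theta> = 2"
      using \<alpha> null_root_in by (simp add: form_simps closed null_root_radical null_root_radical_left)
    show "?\<theta> v \<in> \<int>" "?\<theta> v \<ge> 0" for v
      using null_root_integral[of v] null_root_nonneg[of v] null_root_affine_node by (auto simp: simple_root_def)
  qed
  \<comment> \<open>The vector \<open>null_root\<close> - \<beta> has norm 2 and value 1 at the
    affine node, so \<open>norm_2_nonneg\<close> bounds \<beta> by the null root. The candidate
    differs from that only at the affine node, where both it and \<beta> are 0.\<close>
  have max: "\<beta> v \<le> ?\<theta> v" if \<beta>: "\<beta> \<in> fin_roots p k" for \<beta> v
  proof -
    note b = fin_roots_properties[OF \<beta>]
    have b': "\<beta> \<in> weyl_space p" "\<beta> CenterStar = 0" "\<beta> affine_node = 0"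
      using b(1) by (auto simp: fin_space_iff)
    have "(null_root - \<beta>) v \<ge> 0"
    proof (rule norm_2_nonneg)
      show "null_root - \<beta> \<in> weyl_space p" using b' null_root_in by (simp add: closed)
      show "weyl_form p (null_root - \<beta>) (null_root - \<beta>) = 2"
        using b b' null_root_in by (simp add: form_simps closed null_root_radical null_root_radical_left)
      show "(null_root - \<beta>) u \<in> \<int>" for u using b(2)[of u] null_root_integral[of u] by simp
    qed (use b' null_root_star null_root_affine_node in auto)
    then show ?thesis using b' null_root_affine_node by (simp add: simple_root_def)
  qed
  show ?thesis
    unfolding highest_root_def
  proof (rule the_equality)
    show "?\<theta> \<in> fin_roots p k \<and> (\<forall>\<beta>\<in>fin_roots p k. \<forall>v. \<beta> v \<le> ?\<theta> v)" using \<theta>_root max by blast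
    show "\<theta> = ?\<theta>" if "\<theta> \<in> fin_roots p k \<and> (\<forall>\<beta>\<in>fin_roots p k. \<forall>v. \<beta> v \<le> \<theta> v)" for \<theta>
      using that \<theta>_root max by (intro ext antisym) blast+
  qed
qed

lemma vec_b_eq: "vec_b p k = null_root"
  by (simp add: vec_b_def affine_root_def highest_root_eq)

text \<open>The finite part and \<open>vec_a\<close> vanish at the affine node and b takes the value
  1 there, so the coefficient of b is simply that coordinate.\<close>

lemma b_coeff_eq:
  assumes "x \<in> weyl_space p"
  shows "b_coeff p k x = x affine_node"
  unfolding b_coeff_def vec_b_eq
proof (rule the_equality)
  let ?u = "x - x CenterStar *\<^sub>R vec_a - x affine_node *\<^sub>R null_root"
  have "?u \<in> fin_space p k"
    using assms vec_a_in null_root_in null_root_star null_root_affine_node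
    by (simp add: fin_space_iff closed)
  then show "\<exists>u\<in>fin_space p k. \<exists>d. x = u + d *\<^sub>R vec_a + x affine_node *\<^sub>R null_root"
    by (intro bexI[of _ ?u] exI[of _ "x CenterStar"]) auto
next
  fix c assume "\<exists>u\<in>fin_space p k. \<exists>d. x = u + d *\<^sub>R vec_a + c *\<^sub>R null_root"
  then show "c = x affine_node" using null_root_affine_node by (auto simp: fin_space_iff)
qed

section \<open>The form of the hyperbolic cover\<close>

lemma cover_form_space: "form_space (cover_space p) (cover_form p k)"
proof
  show "Real_Vector_Spaces.subspace (cover_space p)"
    using closed by (auto simp: Real_Vector_Spaces.subspace_def cover_space_def zero_prod_def)
  fix x y z :: "(vertex \<Rightarrow> real) \<times> real" and c :: real
  assume x: "x \<in> cover_space p" and y: "y \<in> cover_space p"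
  then have xy: "fst x \<in> weyl_space p" "fst y \<in> weyl_space p" by (auto simp: cover_space_def)
  show "cover_form p k x (c *\<^sub>R y) = c * cover_form p k x y"
    using xy by (simp add: cover_form_def b_coeff_eq closed form_simps algebra_simps)
  show "cover_form p k x y = cover_form p k y x"
    using weyl_form_commute[of p "fst x" "fst y"] by (simp add: cover_form_def)
  assume "z \<in> cover_space p"
  then have z: "fst z \<in> weyl_space p" by (auto simp: cover_space_def)
  show "cover_form p k x (y + z) = cover_form p k x y + cover_form p k x z"
    using xy z by (simp add: cover_form_def b_coeff_eq closed form_simps algebra_simps)
qed

text \<open>Two test vectors suffice: x itself shows that its norm is 0, so that it is a multiple of
  the null root, and b' = (0, 1) reads off the coefficient of that multiple.\<close>

lemma cover_radical:
  assumes x: "x \<in> weyl_space p" "x CenterStar = 0"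
    and zero: "\<And>y. y \<in> cover_space p \<Longrightarrow> cover_form p k (x, 0) y = 0"
  shows "x = 0"
proof -
  have "weyl_form p x x = 0"
    using zero[of "(x, 0)"] x by (simp add: cover_space_def cover_form_def)
  moreover have "x affine_node = 0"
    using zero[of "(0, 1)"] x closed by (simp add: cover_space_def cover_form_def b_coeff_eq)
  ultimately show ?thesis using radical_multiple[OF x] by simp
qed

end

section \<open>The diagram of an extended Weyl system\<close>

text \<open>At a vertex of the cycle lying deepest in its arm, both cyclic neighbours would have to
  be no deeper, but a vertex of a star has at most one such neighbour.\<close>

lemma star_acyclic: "\<not> is_cycle (star_vertices p) single_edge xs"
proof
  assume "is_cycle (star_vertices p) single_edge xs"
  then have len: "length xs \<ge> 3" and dist: "distinct xs" and sub: "set xs \<subseteq> star_vertices p"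
    and edge: "\<And>i. i < length xs \<Longrightarrow> single_edge (xs ! i) (xs ! (Suc i mod length xs))"
    by (auto simp: is_cycle_def)
  define depth where "depth v = (case v of Arm i j \<Rightarrow> j | _ \<Rightarrow> 0)" for v
  have "set xs \<noteq> {}" using len by auto
  then have "Max (depth ` set xs) \<in> depth ` set xs" by (intro Max_in) auto
  then obtain x where x: "x \<in> set xs" "Max (depth ` set xs) = depth x" by auto
  then have max: "depth y \<le> depth x" if "y \<in> set xs" for y
    using that Max_ge[of "depth ` set xs" "depth y"] by simp
  from x(1) obtain i where i: "i < length xs" "xs ! i = x" by (auto simp: in_set_conv_nth)
  define m n where "m = Suc i mod length xs" and "n = (if i = 0 then length xs - 1 else i - 1)"
  have mn: "m < length xs" "n < length xs" "m \<noteq> n"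
    using i len by (auto simp: m_def n_def mod_Suc)
  have "Suc n mod length xs = i" using i len by (auto simp: n_def)
  then have "single_edge x (xs ! m)" "single_edge x (xs ! n)"
    using edge[OF i(1)] edge[OF mn(2)] i by (auto simp: m_def single_edge_commute)
  moreover have "depth (xs ! m) \<le> depth x" "depth (xs ! n) \<le> depth x"
    using mn by (auto intro!: max)
  moreover have "xs ! m \<in> star_vertices p" "xs ! n \<in> star_vertices p"
    using nth_mem[OF mn(1)] nth_mem[OF mn(2)] sub by (simp_all only: subset_iff)
  ultimately have "xs ! m = xs ! n"
    by (cases x; cases "xs ! m"; cases "xs ! n") (auto simp: depth_def)
  then show False using mn dist by (simp add: nth_eq_iff_index_eq)
qed

lemma star_connected:
  assumes "v \<in> star_vertices p"
  shows "(Center, v) \<in> {(x, y). x \<in> star_vertices p \<and> y \<in> star_vertices p \<and> single_edge x y}\<^sup>*"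
    (is "_ \<in> ?R\<^sup>*")
proof (cases v)
  case (Arm i j)
  have "Arm i j \<in> vertices p \<Longrightarrow> (Center, Arm i j) \<in> ?R\<^sup>*" for j
  proof (induction j)
    case (Suc j)
    show ?case
    proof (cases "j = 0")
      case True
      then show ?thesis using Suc.prems by (intro r_into_rtrancl) auto
    next
      case False
      then have "Arm i j \<in> vertices p" using Suc.prems by auto
      moreover from this have "(Arm i j, Arm i (Suc j)) \<in> ?R" using Suc.prems by auto
      ultimately show ?thesis using Suc.IH by (meson rtrancl.rtrancl_into_rtrancl)
    qed
  qed simp
  then show ?thesis using Arm assms by blast
qed (use assms in auto)

lemma star_is_tree: "is_tree (star_vertices p) single_edge"
proof -
  let ?R = "{(x, y). x \<in> star_vertices p \<and> y \<in> star_vertices p \<and> single_edge x y}"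
  have "sym ?R" by (auto simp: sym_def single_edge_commute)
  then have to_center: "(u, Center) \<in> ?R\<^sup>*" if "u \<in> star_vertices p" for u
    using symD[OF sym_rtrancl star_connected[OF that]] by blast
  have "(u, v) \<in> ?R\<^sup>*" if "u \<in> star_vertices p" "v \<in> star_vertices p" for u v
    by (rule rtrancl_trans[OF to_center[OF that(1)] star_connected[OF that(2)]])
  moreover have "star_vertices p \<noteq> {}" using vertices_simps(1) by blast
  ultimately show ?thesis
    unfolding is_tree_def by (simp add: star_acyclic finite_vertices)
qed

lemma star_degree_Arm:
  "degree_in (star_vertices p) single_edge (Arm i j) \<le> 2"
proof -
  have "{w \<in> star_vertices p. single_edge (Arm i j) w} \<subseteq>
      {Arm i (Suc j), if j = 1 then Center else Arm i (j - 1)}"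
  proof
    fix w assume "w \<in> {w \<in> star_vertices p. single_edge (Arm i j) w}"
    then show "w \<in> {Arm i (Suc j), if j = 1 then Center else Arm i (j - 1)}" by (cases w) auto
  qed
  from card_mono[OF _ this] show ?thesis
    unfolding degree_in_def by (rule order_trans) (auto intro: card_insert_le_m1)
qed

lemma star_degree_Center:
  assumes "arm_lengths p"
  shows "degree_in (star_vertices p) single_edge Center = length p"
proof -
  have "{w \<in> star_vertices p. single_edge Center w} = (\<lambda>i. Arm i 1) ` {..<length p}" (is "?L = ?R")
  proof (rule Set.set_eqI)
    show "w \<in> ?L \<longleftrightarrow> w \<in> ?R" for w
      using assms by (cases w) (auto simp: arm_lengths_def)
  qed
  then show ?thesis by (simp add: degree_in_def card_image inj_on_def)
qed

lemma degree_in_iso: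
  assumes "bij_betw f A B" "\<And>x y. x \<in> A \<Longrightarrow> y \<in> A \<Longrightarrow> E x y \<longleftrightarrow> F (f x) (f y)" "v \<in> A"
  shows "degree_in A E v = degree_in B F (f v)"
proof -
  have "bij_betw f {w \<in> A. E v w} {w \<in> B. F (f v) w}"
    using assms by (force simp: bij_betw_def inj_on_def)
  then show ?thesis unfolding degree_in_def by (rule bij_betw_same_card)
qed

lemma is_tree_iso:
  assumes f: "bij_betw f A B" "\<And>x y. x \<in> A \<Longrightarrow> y \<in> A \<Longrightarrow> E x y \<longleftrightarrow> F (f x) (f y)" and tree: "is_tree B F"
  shows "is_tree A E"
  unfolding is_tree_def
proof (intro conjI ballI notI)
  let ?g = "inv_into A f"
  have g: "?g x \<in> A" "f (?g x) = x" if "x \<in> B" for x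
    using f(1) that by (auto simp: bij_betw_def inv_into_into f_inv_into_f)
  have fA: "f x \<in> B" "?g (f x) = x" if "x \<in> A" for x
    using f(1) that by (auto simp: bij_betw_def)
  show "finite A" using tree f(1) by (simp add: is_tree_def bij_betw_finite)
  show "A = {} \<Longrightarrow> False" using tree f(1) by (auto simp: is_tree_def bij_betw_def)
  fix u v assume uv: "u \<in> A" "v \<in> A"
  have pull: "(x, y) \<in> {(x, y). x \<in> B \<and> y \<in> B \<and> F x y}\<^sup>* \<Longrightarrow>
      (?g x, ?g y) \<in> {(x, y). x \<in> A \<and> y \<in> A \<and> E x y}\<^sup>*" for x y
  proof (induction rule: rtrancl_induct)
    case (step y z)
    then have "(?g y, ?g z) \<in> {(x, y). x \<in> A \<and> y \<in> A \<and> E x y}" using g f(2) by auto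
    with step.IH show ?case by (rule rtrancl_into_rtrancl)
  qed simp
  have "(f u, f v) \<in> {(x, y). x \<in> B \<and> y \<in> B \<and> F x y}\<^sup>*"
    using tree fA uv by (auto simp: is_tree_def)
  from pull[OF this] show "(u, v) \<in> {(x, y). x \<in> A \<and> y \<in> A \<and> E x y}\<^sup>*"
    by (simp only: fA uv)
next
  assume "\<exists>xs. is_cycle A E xs"
  then obtain xs where xs: "is_cycle A E xs" by blast
  then have sub: "set xs \<subseteq> A" and "length xs > 0" by (auto simp: is_cycle_def)
  then have mem: "xs ! i \<in> A" "xs ! (Suc i mod length xs) \<in> A" if "i < length xs" for i
    using that by auto
  have "distinct (map f xs)"
    using xs f(1) sub by (auto simp: is_cycle_def distinct_map bij_betw_def intro: inj_on_subset)
  then have "is_cycle B F (map f xs)"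
    using xs f(1) mem f(2)[OF mem] sub \<open>length xs > 0\<close> by (auto simp: is_cycle_def bij_betw_def)
  then show False using tree by (auto simp: is_tree_def)
qed

section \<open>Reflection groups as Coxeter systems\<close>

text \<open>The source of the Coxeter system in part (a): a reflection group on the span of its
  simple roots, for a form that may be indefinite or degenerate.\<close>

locale simply_laced_gram = form_space X f for X :: "('i \<Rightarrow> real) set" and f +
  fixes I :: "'i set"
  assumes finite_index: "finite I" and X_span: "X = span (simple_root ` I)"
    and gram_diag: "i \<in> I \<Longrightarrow> f (simple_root i) (simple_root i) = 2"
    and gram_off: "\<lbrakk>i \<in> I; j \<in> I; i \<noteq> j\<rbrakk> \<Longrightarrow> f (simple_root i) (simple_root j) \<in> {0, -1}"
begin

definition r :: "'i \<Rightarrow> ('i \<Rightarrow> real) \<Rightarrow> 'i \<Rightarrow> real"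
  where "r i = reflection X f (simple_root i)"

abbreviation refl_gens :: "(('i \<Rightarrow> real) \<Rightarrow> 'i \<Rightarrow> real) set"
  where "refl_gens \<equiv> r ` I"

definition refl_group :: "(('i \<Rightarrow> real) \<Rightarrow> 'i \<Rightarrow> real) monoid"
  where "refl_group = generated_subgroup (GL X) refl_gens"

lemma root_in: "i \<in> I \<Longrightarrow> simple_root i \<in> X"
  unfolding X_span by (intro span_base) simp

lemma r_carrier: "i \<in> I \<Longrightarrow> r i \<in> carrier (GL X)"
  unfolding r_def by (intro reflection_in_GL root_in gram_diag)

lemma r_apply: "i \<in> I \<Longrightarrow> x \<in> X \<Longrightarrow> r i x = x - f (simple_root i) x *\<^sub>R simple_root i"
  by (simp add: r_def reflection_apply gram_diag)

lemma r_inj: "inj_on r I"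
proof (rule inj_onI, rule ccontr)
  fix i j assume "i \<in> I" "j \<in> I" "r i = r j" "i \<noteq> j"
  then show False
    using reflection_neq[of "simple_root i" "simple_root j"] root_in gram_diag gram_off by (simp add: r_def)
qed

lemma gens_carrier: "refl_gens \<subseteq> carrier (GL X)"
  using r_carrier by auto

lemma subgroup_refl_group: "subgroup (generate (GL X) refl_gens) (GL X)"
  by (rule GL.generate_is_subgroup[OF gens_carrier])

sublocale W: group refl_group
  unfolding refl_group_def generated_subgroup_def
  by (rule GL.subgroup_imp_group[OF subgroup_refl_group])

lemma refl_group_simps [simp]:
  "carrier refl_group = generate (GL X) refl_gens"
  "x \<otimes>\<^bsub>refl_group\<^esub> y = x \<otimes>\<^bsub>GL X\<^esub> y" "\<one>\<^bsub>refl_group\<^esub> = \<one>\<^bsub>GL X\<^esub>"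
  by (simp_all add: refl_group_def generated_subgroup_def)

lemma refl_group_pow: "x [^]\<^bsub>refl_group\<^esub> (n::nat) = x [^]\<^bsub>GL X\<^esub> n"
  by (simp add: refl_group_def generated_subgroup_def GL.nat_pow_consistent[symmetric])

lemma gen_in: "i \<in> I \<Longrightarrow> r i \<in> carrier refl_group"
  by (simp add: generate.incl)

lemma r_square: "i \<in> I \<Longrightarrow> r i \<otimes>\<^bsub>GL X\<^esub> r i = \<one>\<^bsub>GL X\<^esub>"
  unfolding r_def by (intro reflection_involution root_in gram_diag)

text \<open>Both exponents are prime, so a nontrivial element killed by one of them has exactly that
  order.\<close>

lemma ord_2_or_3:
  assumes "x \<in> carrier refl_group" "x [^]\<^bsub>GL X\<^esub> d = \<one>\<^bsub>GL X\<^esub>" "d = 2 \<or> d = 3" "x \<noteq> \<one>\<^bsub>GL X\<^esub>"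
  shows "W.ord x = d"
proof -
  have "W.ord x dvd d" using W.pow_eq_id[OF assms(1), of d] assms(2) by (simp add: refl_group_pow)
  moreover have "W.ord x \<noteq> 1" using W.ord_eq_1[OF assms(1)] assms(4) by simp
  moreover from \<open>W.ord x dvd d\<close> have "W.ord x \<le> 3" using assms(3) by (auto dest: dvd_imp_le)
  then have "W.ord x \<in> {0, 1, 2, 3}" by auto
  ultimately show ?thesis using assms(3) by auto
qed

lemma ord_r_r:
  assumes "i \<in> I" "j \<in> I" "i \<noteq> j"
  shows "W.ord (r i \<otimes>\<^bsub>GL X\<^esub> r j) = (if f (simple_root i) (simple_root j) = 0 then 2 else 3)"
proof -
  have in_W: "r i \<otimes>\<^bsub>GL X\<^esub> r j \<in> carrier refl_group"
    using W.m_closed[OF gen_in gen_in] assms by simp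
  have "r i \<otimes>\<^bsub>GL X\<^esub> r j \<noteq> \<one>\<^bsub>GL X\<^esub>"
  proof
    assume "r i \<otimes>\<^bsub>GL X\<^esub> r j = \<one>\<^bsub>GL X\<^esub>"
    then have "r i \<otimes>\<^bsub>GL X\<^esub> r j = r j \<otimes>\<^bsub>GL X\<^esub> r j" using assms by (simp add: r_square)
    then have "r i = r j" using assms r_carrier by simp
    then show False using assms r_inj by (auto simp: inj_on_def)
  qed
  moreover have "(r i \<otimes>\<^bsub>GL X\<^esub> r j) [^]\<^bsub>GL X\<^esub> (2::nat) = \<one>\<^bsub>GL X\<^esub>" if "f (simple_root i) (simple_root j) = 0"
    unfolding r_def by (intro reflections_pow_2) (use assms root_in gram_diag that in auto)
  moreover have "(r i \<otimes>\<^bsub>GL X\<^esub> r j) [^]\<^bsub>GL X\<^esub> (3::nat) = \<one>\<^bsub>GL X\<^esub>" if "f (simple_root i) (simple_root j) \<noteq> 0"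
    unfolding r_def by (intro reflections_pow_3) (use assms root_in gram_diag gram_off that in auto)
  ultimately show ?thesis using in_W ord_2_or_3[of _ 2] ord_2_or_3[of _ 3] by auto
qed

lemma ord_r: assumes "i \<in> I" shows "W.ord (r i) = 2"
proof (rule ord_2_or_3)
  show "r i [^]\<^bsub>GL X\<^esub> (2::nat) = \<one>\<^bsub>GL X\<^esub>" using assms r_square r_carrier by (simp add: numeral_2_eq_2)
  show "r i \<noteq> \<one>\<^bsub>GL X\<^esub>"
  proof
    assume "r i = \<one>\<^bsub>GL X\<^esub>"
    then have "r i (simple_root i) = simple_root i" using assms root_in by (simp add: GL_one)
    moreover have "r i (simple_root i) i = -1" using assms by (simp add: r_apply root_in gram_diag)
    ultimately show False by simp
  qed
qed (use assms gen_in in auto)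

lemma word_value_apply:
  "u \<in> lists refl_gens \<Longrightarrow> x \<in> X \<Longrightarrow>
    word_value refl_group u \<in> carrier (GL X) \<and> word_value refl_group u x = foldr (\<lambda>s. s) u x"
proof (induction u)
  case (Cons s u)
  then have "s \<in> carrier (GL X)" using gens_carrier by auto
  with Cons show ?case by (simp add: GL_mult compose_eq) (metis GL.m_closed GL_mult)
qed (simp add: GL_one[symmetric], simp add: GL_one)

text \<open>Completeness of the relations: a word with trivial value fixes all simple roots, and
  Tits' argument, run on words of the presented group, reduces it to the empty word.\<close>

lemma refl_word_eq:
  assumes "u \<in> lists refl_gens" "word_value refl_group u = \<one>\<^bsub>GL X\<^esub>"
  shows "word_eq refl_group refl_gens u []"
proof -
  \<comment> \<open>The letters are the reflections themselves and act by application; since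
    \<open>r\<close> is injective, each letter determines its root.\<close>
  let ?\<beta> = "\<lambda>s. simple_root (inv_into I r s)"
  have \<beta>: "?\<beta> (r i) = simple_root i" if "i \<in> I" for i
    using that r_inj by simp
  interpret simply_laced_action refl_group refl_gens X "{x. \<forall>i. 0 \<le> x i}" "\<lambda>s. s" ?\<beta>
  proof
    fix s t assume "s \<in> refl_gens" "t \<in> refl_gens" "s \<noteq> t"
    then obtain i j where ij: "i \<in> I" "j \<in> I" "i \<noteq> j" "s = r i" "t = r j" by auto
    show "W.ord (s \<otimes>\<^bsub>refl_group\<^esub> t) = 2 \<and> s (?\<beta> t) = ?\<beta> t \<or>
      W.ord (s \<otimes>\<^bsub>refl_group\<^esub> t) = 3 \<and> s (?\<beta> t) = ?\<beta> s + ?\<beta> t \<and> t (?\<beta> s) = ?\<beta> s + ?\<beta> t"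
      using gram_off[OF ij(1-3)] form_commute[of "simple_root j" "simple_root i"] ij root_in
      by (auto simp: ord_r_r \<beta> r_apply)
  next
    fix u v x assume uv: "word_eq refl_group refl_gens u v" and x: "x \<in> X"
    have "word_value refl_group (map (\<lambda>s. s) u) = word_value refl_group (map (\<lambda>s. s) v)"
      by (rule word_eq_value[OF W.is_group _ _ uv]) (auto simp: gen_in generate.eng generate.incl W.pow_ord_eq_1)
    then show "foldr (\<lambda>s. s) u x = foldr (\<lambda>s. s) v x"
      using word_value_apply[OF _ x, of u] word_value_apply[OF _ x, of v] word_eq_lists[OF uv] by simp
  next
    fix s assume "s \<in> refl_gens"
    then obtain i where i: "i \<in> I" "s = r i" by auto
    show "W.ord (s \<otimes>\<^bsub>refl_group\<^esub> s) = 1" 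
      using i W.ord_eq_1[OF W.one_closed] by (simp add: r_square)
    show "s (?\<beta> s) = - ?\<beta> s" using i by (simp add: \<beta> r_apply root_in gram_diag scaleR_2)
    show "?\<beta> s \<in> X" "?\<beta> s \<in> {x. \<forall>i. 0 \<le> x i}" using i by (auto simp: \<beta> root_in simple_root_apply)
    show "- ?\<beta> s \<notin> {x. \<forall>i. 0 \<le> x i}" using i by (auto simp: \<beta> intro!: exI[of _ i])
    show "s x \<in> X" "s (x + y) = s x + s y" if "x \<in> X" "y \<in> X" for x y
      using that i r_carrier GL_closed GL_add by blast+
  qed (auto simp: closed)
  show ?thesis
  proof (rule faithful[OF assms(1)])
    fix s assume "s \<in> refl_gens"
    then have "?\<beta> s \<in> X" by (rule \<beta>_in)
    then show "foldr (\<lambda>s. s) u (?\<beta> s) = ?\<beta> s"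
      using word_value_apply[OF assms(1), of "?\<beta> s"] assms(2) by (simp add: GL_one)
  qed
qed

lemma refl_coxeter_system: "coxeter_system refl_group refl_gens"
  unfolding coxeter_system_def
proof (intro conjI ballI impI)
  show "Group.group refl_group" by (rule W.is_group)
  show "finite refl_gens" using finite_index by simp
  show "refl_gens \<subseteq> carrier refl_group" using gen_in by auto
  show "generate refl_group refl_gens = carrier refl_group"
  proof -
    have "refl_gens \<subseteq> generate (GL X) refl_gens" by (blast intro: generate.incl)
    from GL.generate_consistent[OF this subgroup_refl_group] show ?thesis
      by (simp add: refl_group_def generated_subgroup_def)
  qed
  show "W.ord s = 2" if "s \<in> refl_gens" for s using that ord_r by auto
  show "word_eq refl_group refl_gens u []" if "u \<in> lists refl_gens" "word_value refl_group u = \<one>\<^bsub>refl_group\<^esub>" for u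
    using refl_word_eq that by simp
qed

lemma refl_simply_laced: "simply_laced refl_group refl_gens"
  using ord_r_r by (fastforce simp: simply_laced_def)

lemma refl_edge:
  assumes "i \<in> I" "j \<in> I"
  shows "coxeter_edge refl_group (r i) (r j) \<longleftrightarrow> i \<noteq> j \<and> f (simple_root i) (simple_root j) = -1"
proof (cases "i = j")
  case False
  then have "r i \<noteq> r j" using assms r_inj by (auto simp: inj_on_def)
  then show ?thesis using False gram_off[OF assms False] ord_r_r[OF assms False] by (auto simp: coxeter_edge_def)
qed (simp add: coxeter_edge_def)

end

section \<open>Isomorphisms with extended Coxeter systems\<close>

lemma relabel_apply:
  assumes "finite S" "inj_on f S"
  shows "t \<in> S \<Longrightarrow> (\<Sum>s\<in>S. l s *\<^sub>R simple_root (f s)) (f t) = l t"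
    and "v \<notin> f ` S \<Longrightarrow> (\<Sum>s\<in>S. l s *\<^sub>R simple_root (f s)) v = 0"
proof -
  show "(\<Sum>s\<in>S. l s *\<^sub>R simple_root (f s)) (f t) = l t" if "t \<in> S"
  proof -
    have "(\<Sum>s\<in>S. l s *\<^sub>R simple_root (f s)) (f t) = (\<Sum>s\<in>S. if s = t then l t else 0)"
      unfolding sum_fun_apply using assms(2) that by (intro sum.cong) (auto simp: simple_root_def inj_on_def)
    then show ?thesis using assms(1) that by simp
  qed
  show "(\<Sum>s\<in>S. l s *\<^sub>R simple_root (f s)) v = 0" if "v \<notin> f ` S"
    unfolding sum_fun_apply using that by (intro sum.neutral) (auto simp: simple_root_def)
qed

locale labelled_coxeter = simply_laced_coxeter W S for W :: "'g monoid" (structure) and S +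
  fixes c :: 'g and p :: "nat list" and lab :: "'g \<Rightarrow> vertex"
  assumes tree: "is_tree S (coxeter_edge W)" and c: "c \<in> S"
    and labelling: "star_labelling S (coxeter_edge W) c p lab"
begin

lemma lab_bij: "bij_betw lab S (star_vertices p)" and lab_c: "lab c = Center"
  and lab_edge: "s \<in> S \<Longrightarrow> t \<in> S \<Longrightarrow> coxeter_edge W s t \<longleftrightarrow> single_edge (lab s) (lab t)"
  using labelling by (auto simp: star_labelling_def)

lemma lab_in: "s \<in> S \<Longrightarrow> lab s \<in> star_vertices p"
  using lab_bij by (auto simp: bij_betw_def)

lemma lab_gram: "s \<in> S \<Longrightarrow> t \<in> S \<Longrightarrow> weyl_form p (simple_root (lab s)) (simple_root (lab t)) = cox_gram W s t"
  using lab_in[of s] lab_in[of t] lab_bij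
  by (auto simp: weyl_form_simple_roots weyl_gram_def cox_gram_def lab_edge bij_betw_def inj_on_def doubleton_eq_iff)

lemma relabel_in: "(\<Sum>s\<in>S. l s *\<^sub>R simple_root (lab s)) \<in> weyl_space p"
  unfolding weyl_space_def weyl_basis_def
  using lab_in by (intro span_sum span_scale span_base) auto

lemma relabel_star: "(\<Sum>s\<in>S. l s *\<^sub>R simple_root (lab s)) CenterStar = 0"
  by (rule relabel_apply(2)) (use gens_finite lab_bij in \<open>auto simp: bij_betw_def\<close>)

lemma relabel_zero:
  assumes "l \<in> cox_space S" "(\<Sum>s\<in>S. l s *\<^sub>R simple_root (lab s)) = 0"
  shows "l = 0"
proof
  fix t
  show "l t = 0 t"
  proof (cases "t \<in> S")
    case True
    then show ?thesis
      using relabel_apply(1)[of S lab t l] gens_finite lab_bij assms(2) by (simp add: bij_betw_def)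
  qed (use assms(1) in \<open>simp add: cox_space_eq\<close>)
qed

lemma simple_root_star: "simple_root CenterStar = simple_root (lab c) + vec_a"
  by (simp add: vec_a_def lab_c)

lemma basis_eq: "weyl_basis p = insert (simple_root (lab c) + vec_a) ((\<lambda>s. simple_root (lab s)) ` S)"
proof -
  have "vertices p = insert CenterStar (lab ` S)" using lab_bij by (auto simp: bij_betw_def)
  then show ?thesis by (simp add: weyl_basis_def image_image simple_root_star)
qed

lemma connected: "s \<in> S \<Longrightarrow> (c, s) \<in> {(x, y). x \<in> S \<and> y \<in> S \<and> coxeter_edge W x y}\<^sup>*"
  using tree c by (auto simp: is_tree_def)

theorem isomorphic_weyl:
  assumes "domestic p \<or> wild p"
  shows "isomorphic_pairs (ext_cox_group W S) (ext_cox_gens S c) (weyl_group p) (weyl_gens p)"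
    and "isomorphic_pairs (weyl_group p) (weyl_gens p) (ext_cox_group W S) (ext_cox_gens S c)"
proof -
  interpret F: form_space "weyl_space p" "weyl_form p" by (rule form_space_weyl)
  interpret M: reflection_model "weyl_space p" "weyl_form p" W S "\<lambda>s. simple_root (lab s)" vec_a c
  proof
    fix l :: "'g \<Rightarrow> real" assume l: "l \<in> cox_space S"
      and zero: "\<And>v. v \<in> weyl_space p \<Longrightarrow> weyl_form p (\<Sum>s\<in>S. l s *\<^sub>R simple_root (lab s)) v = 0"
    obtain d where d: "(\<Sum>s\<in>S. l s *\<^sub>R simple_root (lab s)) = d *\<^sub>R vec_a"
      using domestic_wild_radical[OF assms relabel_in zero] by blast
    \<comment> \<open>The relabelled vector has coordinate 0 at \<open>CenterStar\<close>, and
      \<open>vec_a\<close> has coordinate 1.\<close>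
    then have "d = 0" using relabel_star[of l] by simp
    then show "l = 0" using d l by (intro relabel_zero) simp_all
  next
    show "weyl_form p vec_a x = 0" for x
      using weyl_form_vec_a by (subst weyl_form_commute)
  qed (use lab_in lab_gram c connected in \<open>auto simp: simple_root_in_weyl_space vec_a_in vec_a_nonzero\<close>)
  have "M.gens = weyl_gens p" by (simp add: M.gens_def weyl_gens_def basis_eq image_image)
  then show "isomorphic_pairs (ext_cox_group W S) (ext_cox_gens S c) (weyl_group p) (weyl_gens p)"
    "isomorphic_pairs (weyl_group p) (weyl_gens p) (ext_cox_group W S) (ext_cox_gens S c)"
    using M.ext_cox_isomorphic M.ext_cox_isomorphic' by (simp_all add: weyl_group_def)
qed

theorem isomorphic_cover:
  assumes "affine_star p k"
  shows "isomorphic_pairs (ext_cox_group W S) (ext_cox_gens S c) (cover_group p k) (cover_gens p k)"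
proof -
  interpret A: affine_star p k by fact
  interpret F: form_space "cover_space p" "cover_form p k" by (rule A.cover_form_space)
  have sum_pair: "(\<Sum>s\<in>S. l s *\<^sub>R (simple_root (lab s), 0::real)) = (\<Sum>s\<in>S. l s *\<^sub>R simple_root (lab s), 0)" for l
    by (rule prod_eqI) (simp_all add: fst_sum snd_sum)
  interpret M: reflection_model "cover_space p" "cover_form p k" W S "\<lambda>s. (simple_root (lab s), 0)" "(vec_a, 0)" c
  proof
    fix l :: "'g \<Rightarrow> real" assume l: "l \<in> cox_space S"
      and zero: "\<And>v. v \<in> cover_space p \<Longrightarrow> cover_form p k (\<Sum>s\<in>S. l s *\<^sub>R (simple_root (lab s), 0)) v = 0"
    have "(\<Sum>s\<in>S. l s *\<^sub>R simple_root (lab s)) = 0"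
      using A.cover_radical[OF relabel_in relabel_star] zero unfolding sum_pair by blast
    then show "l = 0" by (rule relabel_zero[OF l])
  next
    show "cover_form p k (vec_a, 0) x = 0" for x
      using weyl_form_vec_a[of p "fst x"] weyl_form_commute[of p vec_a]
      by (simp add: cover_form_def A.b_coeff_eq vec_a_in)
  next
    show "(vec_a, 0::real) \<noteq> 0" using vec_a_nonzero by (simp add: zero_prod_def)
  qed (use lab_in lab_gram c connected in \<open>auto simp: simple_root_in_weyl_space vec_a_in cover_space_def cover_form_def\<close>)
  have "M.gens = cover_gens p k" by (simp add: M.gens_def cover_gens_def basis_eq image_image)
  then show ?thesis using M.ext_cox_isomorphic by (simp add: cover_group_def)
qed

end

text \<open>The space is cut down to the span of the star vertices: with \<open>CenterStar\<close>
  the Gram entry 2 between the two central vertices would not be simply laced.\<close>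

lemma weyl_star_coxeter:
  assumes "arm_lengths p"
  shows "\<exists>(W :: ((vertex \<Rightarrow> real) \<Rightarrow> (vertex \<Rightarrow> real)) monoid) S c lab.
    star_coxeter_system W S c \<and> star_labelling S (coxeter_edge W) c p lab"
proof -
  let ?I = "star_vertices p"
  interpret F: form_space "weyl_space p" "weyl_form p" by (rule form_space_weyl)
  have sub: "x \<in> weyl_space p" if "x \<in> span (simple_root ` ?I)" for x
    using that span_mono[of "simple_root ` ?I" "weyl_basis p"] by (auto simp: weyl_space_def weyl_basis_def)
  have gram: "weyl_form p (simple_root u) (simple_root v) = (if u = v then 2 else if single_edge u v then -1 else 0)"
    if "u \<in> ?I" "v \<in> ?I" for u v
    using that by (auto simp: weyl_form_simple_roots weyl_gram_def doubleton_eq_iff)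
  interpret simply_laced_gram "span (simple_root ` ?I)" "weyl_form p" ?I
  proof
    show "Real_Vector_Spaces.subspace (span (simple_root ` ?I))" by (rule subspace_span)
  qed (use sub F.form_add_right F.form_scale_right F.form_commute gram finite_vertices in auto)
  let ?lab = "inv_into ?I r" and ?E = "coxeter_edge refl_group"
  let ?deg = "degree_in refl_gens ?E"
  have bij: "bij_betw r ?I refl_gens" using r_inj by (simp add: bij_betw_def)
  then have lab_bij: "bij_betw ?lab refl_gens ?I" by (rule bij_betw_inv_into)
  have lab_r: "?lab (r v) = v" if "v \<in> ?I" for v using that r_inj by simp
  have edge: "?E (r u) (r v) \<longleftrightarrow> single_edge u v" if "u \<in> ?I" "v \<in> ?I" for u v
    using refl_edge[OF that] gram[OF that] by (auto simp: single_edge_def doubleton_eq_iff)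
  then have lab_edge: "?E s t \<longleftrightarrow> single_edge (?lab s) (?lab t)"
    if "s \<in> refl_gens" "t \<in> refl_gens" for s t
    using that lab_r by auto
  have center: "Center \<in> ?I" by simp
  have labelling: "star_labelling refl_gens (?E) (r Center) p ?lab"
    unfolding star_labelling_def using assms lab_bij lab_r[OF center] lab_edge by simp
  note tree = is_tree_iso[where E = "?E" and F = single_edge, OF lab_bij lab_edge star_is_tree]
  have degree: "?deg (r v) = degree_in ?I single_edge v" if "v \<in> ?I" for v
    using degree_in_iso[where E = "?E" and F = single_edge, OF lab_bij lab_edge, of "r v"] that lab_r by simp
  have small: "?deg (r v) \<le> 2" if "v \<in> ?I" "v \<noteq> Center" for v
    using degree[OF that(1)] star_degree_Arm[of p] that by (cases v) auto
  have deg_center: "?deg (r Center) = length p"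
    using degree[OF center] star_degree_Center[OF assms] by simp
  have "{s \<in> refl_gens. ?deg s > 2} \<subseteq> {r Center}"
    using small by (force simp: not_less)
  from card_mono[OF _ this] have "is_star refl_gens (?E)"
    using tree by (simp add: is_star_def)
  \<comment> \<open>With at most two arms the diagram is a path. With more, the center has degree at
    least 3 and every other vertex at most 2.\<close>
  moreover have "is_path refl_gens (?E) \<or>
     (\<forall>s\<in>refl_gens. ?deg s \<le>
        ?deg (r Center))"
  proof (cases "length p \<le> 2")
    case True
    then have "?deg (r v) \<le> 2" if "v \<in> ?I" for v
      using small[OF that] deg_center by (cases "v = Center") auto
    then show ?thesis using tree by (auto simp: is_path_def)
  next
    case False
    then have "?deg (r v) \<le> length p" if "v \<in> ?I" for v
      using small[OF that] deg_center by (cases "v = Center") auto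
    then show ?thesis using deg_center by auto
  qed
  ultimately have "star_coxeter_system refl_group refl_gens (r Center)"
    using refl_coxeter_system refl_simply_laced by (auto simp: star_coxeter_system_def)
  with labelling show ?thesis by blast
qed

lemma labelled_coxeterI:
  assumes "star_coxeter_system W S c" "star_labelling S (coxeter_edge W) c p lab"
  shows "labelled_coxeter W S c p lab"
proof -
  have "coxeter_system W S" "simply_laced W S" "is_tree S (coxeter_edge W)" "c \<in> S"
    using assms(1) by (auto simp: star_coxeter_system_def is_star_def)
  moreover from this have "Group.group W" by (simp add: coxeter_system_def)
  ultimately show ?thesis
    using assms(2)
    by (simp add: labelled_coxeter_def labelled_coxeter_axioms_def simply_laced_coxeter_def
        simply_laced_coxeter_axioms_def coxeter_def coxeter_axioms_def plain_group_def)
qed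

text \<open>A branch vertex other than \<open>c\<close> would force \<open>c\<close>, whose degree
  is maximal unless the diagram is a path, to be a second branch vertex.\<close>

lemma star_coxeter_labelling:
  assumes "star_coxeter_system W S c"
  obtains p lab where "sorted p" "star_labelling S (coxeter_edge W) c p lab"
proof -
  let ?E = "coxeter_edge W"
  let ?deg = "degree_in S ?E"
  have sys: "coxeter_system W S" "simply_laced W S" "is_tree S (?E)" "c \<in> S"
    and one: "card {v \<in> S. ?deg v > 2} \<le> 1"
    and center: "is_path S (?E) \<or>
      (\<forall>s\<in>S. ?deg s \<le> ?deg c)"
    using assms by (auto simp: star_coxeter_system_def is_star_def)
  interpret simply_laced_coxeter W S
    using sys by (simp add: simply_laced_coxeter_def simply_laced_coxeter_axioms_def coxeter_def
        coxeter_axioms_def plain_group_def coxeter_system_def)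
  have "?deg v \<le> 2" if v: "v \<in> S" "v \<noteq> c" for v
    using center
  proof
    assume "\<forall>s\<in>S. ?deg s \<le> ?deg c"
    then have le: "?deg v \<le> ?deg c" using v by blast
    show ?thesis
    proof (rule ccontr)
      assume "\<not> ?thesis"
      then have "{v, c} \<subseteq> {v \<in> S. ?deg v > 2}" using v sys(4) le by auto
      from card_mono[OF _ this] show False using one v gens_finite by simp
    qed
  qed (use v in \<open>auto simp: is_path_def\<close>)
  then obtain p f where f: "star_labelling S (?E) c p f"
    using star_labelling_exists[OF sys(3,4)] ord_commute by (fastforce simp: coxeter_edge_def)
  obtain g where "star_labelling S (?E) c (sort p) g"
    using star_labelling_permute[OF f, of "sort p"] by auto
  then show thesis by (rule that[OF sorted_sort])
qed

text \<open>In each of the four lists, every length plus one divides the greatest length plus one.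
  Only that greatest value matters, so the choice among several longest arms is free.\<close>

lemma affine_starI:
  assumes "p \<in> {[1,1,1,1], [2,2,2], [1,3,3], [1,2,5]}" "delta_norm p = 0" "maximal_arm p k"
  shows "affine_star p k"
proof
  show "arm_lengths p" using assms(1) by (auto simp: arm_lengths_def)
  show "k < length p" using assms(3) by (simp add: maximal_arm_def)
  show "Suc (p ! i) dvd Suc (p ! k)" if "i < length p" for i
  proof -
    have "p ! i \<in> set p" "p ! k \<in> set p" "\<forall>x\<in>set p. x \<le> p ! k"
      using assms(3) that by (auto simp: maximal_arm_def in_set_conv_nth)
    then show ?thesis using assms(1) by (auto simp flip: numeral_2_eq_2)
  qed
qed (rule assms(2))

theorem proposition5p2:
  shows "(\<forall>p. arm_lengths p \<and> (domestic p \<or> wild p) \<longrightarrow>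
            (\<exists>(W :: ((vertex \<Rightarrow> real) \<Rightarrow> (vertex \<Rightarrow> real)) monoid) S c.
               star_coxeter_system W S c \<and>
               isomorphic_pairs (weyl_group p) (weyl_gens p) (ext_cox_group W S) (ext_cox_gens S c)))
       \<and> (\<forall>(W :: 'g monoid) S c. star_coxeter_system W S c \<longrightarrow>
            (\<not> affine_diagram S (coxeter_edge W) \<longrightarrow>
               (\<exists>p. arm_lengths p \<and> (domestic p \<or> wild p) \<and>
                  isomorphic_pairs (ext_cox_group W S) (ext_cox_gens S c) (weyl_group p) (weyl_gens p))) \<and>
            (affine_diagram S (coxeter_edge W) \<longrightarrow>
               (\<exists>p. arm_lengths p \<and> tubular p \<and> (\<exists>k. maximal_arm p k) \<and>
                  (\<forall>k. maximal_arm p k \<longrightarrow>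
                     isomorphic_pairs (ext_cox_group W S) (ext_cox_gens S c)
                       (cover_group p k) (cover_gens p k)))))"
proof (intro conjI allI impI)
  fix p assume p: "arm_lengths p \<and> (domestic p \<or> wild p)"
  then obtain W :: "((vertex \<Rightarrow> real) \<Rightarrow> (vertex \<Rightarrow> real)) monoid" and S c lab
    where W: "star_coxeter_system W S c" and lab: "star_labelling S (coxeter_edge W) c p lab"
    using weyl_star_coxeter by blast
  interpret labelled_coxeter W S c p lab using W lab by (rule labelled_coxeterI)
  show "\<exists>(W :: ((vertex \<Rightarrow> real) \<Rightarrow> (vertex \<Rightarrow> real)) monoid) S c.
      star_coxeter_system W S c \<and>
      isomorphic_pairs (weyl_group p) (weyl_gens p) (ext_cox_group W S) (ext_cox_gens S c)"
    using W isomorphic_weyl(2) p by blast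
next
  fix W :: "'g monoid" and S c assume W: "star_coxeter_system W S c"
  then obtain p lab where p: "sorted p" and lab: "star_labelling S (coxeter_edge W) c p lab"
    by (rule star_coxeter_labelling)
  interpret labelled_coxeter W S c p lab using W lab by (rule labelled_coxeterI)
  have arms: "arm_lengths p" using lab by (simp add: star_labelling_def)
  have iso: "isomorphic_diagrams S (coxeter_edge W) (star_vertices p) single_edge"
    using lab by (rule star_labelling_isomorphic)
  have affine: "affine_diagram S (coxeter_edge W) \<longleftrightarrow> delta_norm p = 0"
    using affine_diagram_iff[OF arms p] affine_diagram_iso[OF iso]
      affine_diagram_iso[OF isomorphic_diagrams_sym[OF iso]] by blast
  show "\<exists>p. arm_lengths p \<and> (domestic p \<or> wild p) \<and>
      isomorphic_pairs (ext_cox_group W S) (ext_cox_gens S c) (weyl_group p) (weyl_gens p)"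
    if "\<not> affine_diagram S (coxeter_edge W)"
  proof -
    have "domestic p \<or> wild p" using that affine domesticI[of p] wildI[of p] by linarith
    then show ?thesis using arms isomorphic_weyl(1) by blast
  qed
  show "\<exists>p. arm_lengths p \<and> tubular p \<and> (\<exists>k. maximal_arm p k) \<and>
      (\<forall>k. maximal_arm p k \<longrightarrow>
        isomorphic_pairs (ext_cox_group W S) (ext_cox_gens S c) (cover_group p k) (cover_gens p k))"
    if "affine_diagram S (coxeter_edge W)"
  proof -
    have norm: "delta_norm p = 0" using that affine by simp
    have list: "p \<in> {[1,1,1,1], [2,2,2], [1,3,3], [1,2,5]}" by (rule affine_arm_lengths[OF arms p norm])
    \<comment> \<open>The lengths are sorted, so the last arm is a longest one; this provides
      existence, while the isomorphism holds for every longest arm.\<close>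
    have "maximal_arm p (length p - 1)"
      unfolding maximal_arm_def
    proof (intro conjI allI impI)
      show "length p - 1 < length p" using list by auto
      show "p ! i \<le> p ! (length p - 1)" if "i < length p" for i
        using p that by (intro sorted_nth_mono) auto
    qed
    then show ?thesis
      using arms tubularI[OF norm] isomorphic_cover affine_starI[OF list norm] by blast
  qed
qed

end
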